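(* Let $M\in\mathbb{Z}_+$ be fixed. GDF and GPF restricted to instances $(G,\mathbf k,\mathbf u)$ with $u(v)\leq M$ for all vertices $v$ are polynomial-time solvable on graphs of bounded clique-width (i.e. on graphs of clique-width at most $c$, for any fixed constant $c$). As a consequence, for a given $\ell\in\mathbb{Z}_+$, Free $\ell$-$\mathcal L$DF, Free $\ell$-$\mathcal L$PF and $\ell$-$\mathcal L$DF are polynomial-time solvable on graphs of bounded clique-width.
   Context: Graphs are finite, simple, undirected; $N[v]$ is the closed neighborhood; $f(U)=\sum_{x\in U}f(x)$; $[0,\ell]=\{0,\dots,\ell\}$; $F$ is a symbol meaning "free". The clique-width of a graph $G$ is the minimum number of labels needed to construct $G$ using: creation of a new vertex with label $i$; disjoint union of two labelled graphs; joining by an edge every vertex labelled $i$ to every vertex labelled $j$ ($i\neq j$); renaming label $i$ to label $j$. GDF (resp. GPF): given $G=(V,E)$ and $\mathbf k,\mathbf u\in\mathbb{Z}_+^V$, compute the minimum (resp. maximum) of $f(V)$ over $f:V\to\mathbb{Z}_+$ with $f(v)\leq u(v)$ and $f(N[v])\geq k(v)$ (resp. $f(N[v])\leq k(v)$) for all $v$. For fixed $\ell$: $\ell$-$\mathcal L$DF (resp. $\ell$-$\mathcal L$PF): given $G$, $\mathbf k\in\mathbb{Z}_+^V$, $\mathbf t\in\{0,F\}^V$, compute the minimum (resp. maximum) of $f(V)$ over $f:V\to[0,\ell]$ with $f(N[v])\geq k(v)$ (resp. $f(N[v])\leq k(v)$) for all $v$ and $f(v)=0$ whenever $t(v)=0$.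 The Free versions restrict to instances with $t(v)=F$ for all $v$. *)

theory Defs
  imports
    "HOL-Computational_Algebra.Polynomial"
    "Graph_Theory.Pair_Digraph"
begin

section \<open>Clique-width\<close>

text \<open>
  A finite simple undirected graph is a \<^locale>\<open>pair_graph\<close>: each edge is represented by the two
  arcs joining its ends. The predicate \<open>cw_constructible c G lab\<close> says that \<open>G\<close>, with the vertex
  labelling \<open>lab\<close>, can be built from the label set \<open>{..<c}\<close>. Values of \<open>lab\<close> outside
  \<open>pverts G\<close> are irrelevant.
\<close>

inductive cw_constructible :: "nat \<Rightarrow> 'a pair_pre_digraph \<Rightarrow> ('a \<Rightarrow> nat) \<Rightarrow> bool"
  for c :: nat where
  create: "i < c \<Longrightarrow> lab v = i \<Longrightarrow> cw_constructible c \<lparr>pverts = {v}, parcs = {}\<rparr> lab"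
| disjoint_union:
    "cw_constructible c G lab \<Longrightarrow> cw_constructible c H lab' \<Longrightarrow> pverts G \<inter> pverts H = {} \<Longrightarrow>
     cw_constructible c \<lparr>pverts = pverts G \<union> pverts H, parcs = parcs G \<union> parcs H\<rparr>
       (\<lambda>v. if v \<in> pverts G then lab v else lab' v)"
| join:
    "cw_constructible c G lab \<Longrightarrow> i < c \<Longrightarrow> j < c \<Longrightarrow> i \<noteq> j \<Longrightarrow>
     cw_constructible c
       \<lparr>pverts = pverts G,
        parcs = parcs G \<union> {(v, w). v \<in> pverts G \<and> w \<in> pverts G \<and>
                                  (lab v = i \<and> lab w = j \<or> lab v = j \<and> lab w = i)}\<rparr> lab"
| rename:
    "cw_constructible c G lab \<Longrightarrow> i < c \<Longrightarrow> j < c \<Longrightarrow>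
     cw_constructible c G (\<lambda>v. if lab v = i then j else lab v)"

text \<open>The graph without vertices, which no expression constructs, gets clique-width 0.\<close>

definition clique_width :: "'a pair_pre_digraph \<Rightarrow> nat" where
  "clique_width G =
     (if pverts G = {} then 0 else (LEAST c. \<exists>lab. cw_constructible c G lab))"


section \<open>Domination and packing problems\<close>

definition closed_nbhd :: "'a pair_pre_digraph \<Rightarrow> 'a \<Rightarrow> 'a set" where
  "closed_nbhd G v = insert v {w. (v, w) \<in> parcs G}"

text \<open>The optimum is \<^const>\<open>None\<close> if there is no feasible solution.\<close>

definition min_value :: "nat set \<Rightarrow> nat option" where
  "min_value S = (if S = {} then None else Some (Min S))"

definition max_value :: "nat set \<Rightarrow> nat option" where
  "max_value S = (if S = {} then None else Some (Max S))"

datatype mark = Zero | Free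

type_synonym graph = "nat pair_pre_digraph"
type_synonym bounded_inst = "graph \<times> (nat \<Rightarrow> nat) \<times> (nat \<Rightarrow> nat)"
type_synonym marked_inst = "graph \<times> (nat \<Rightarrow> nat) \<times> (nat \<Rightarrow> mark)"

fun GDF :: "bounded_inst \<Rightarrow> nat option" where
  "GDF (G, k, u) = min_value {\<Sum>v\<in>pverts G. f v | f :: nat \<Rightarrow> nat.
     \<forall>v\<in>pverts G. f v \<le> u v \<and> (\<Sum>w\<in>closed_nbhd G v. f w) \<ge> k v}"

fun GPF :: "bounded_inst \<Rightarrow> nat option" where
  "GPF (G, k, u) = max_value {\<Sum>v\<in>pverts G. f v | f :: nat \<Rightarrow> nat.
     \<forall>v\<in>pverts G. f v \<le> u v \<and> (\<Sum>w\<in>closed_nbhd G v. f w) \<le> k v}"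

fun LDF :: "nat \<Rightarrow> marked_inst \<Rightarrow> nat option" where
  "LDF l (G, k, t) = min_value {\<Sum>v\<in>pverts G. f v | f :: nat \<Rightarrow> nat.
     \<forall>v\<in>pverts G. f v \<in> {0..l} \<and> (\<Sum>w\<in>closed_nbhd G v. f w) \<ge> k v \<and> (t v = Zero \<longrightarrow> f v = 0)}"

fun LPF :: "nat \<Rightarrow> marked_inst \<Rightarrow> nat option" where
  "LPF l (G, k, t) = max_value {\<Sum>v\<in>pverts G. f v | f :: nat \<Rightarrow> nat.
     \<forall>v\<in>pverts G. f v \<in> {0..l} \<and> (\<Sum>w\<in>closed_nbhd G v. f w) \<le> k v \<and> (t v = Zero \<longrightarrow> f v = 0)}"


section \<open>Polynomial-time computation\<close>

text \<open>
  The machine model is the language WHILE of N. D. Jones (Computability and Complexity: From a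
  Programming Perspective, 1997): imperative programs whose variables hold binary trees. An
  assignment is charged the size of the tree that it stores (and not one unit, as in the book), so
  no data is produced without being paid for. Hence a program and a multitape Turing machine
  simulate each other with polynomial overhead.
\<close>

datatype data = Leaf | Node data data

fun left :: "data \<Rightarrow> data" where
  "left Leaf = Leaf"
| "left (Node a b) = a"

fun right :: "data \<Rightarrow> data" where
  "right Leaf = Leaf"
| "right (Node a b) = b"

text \<open>
  On the type \<^typ>\<open>data\<close> the function \<^const>\<open>size\<close> counts the occurrences of \<^const>\<open>Node\<close>.
\<close>

datatype expr = Var nat | Nil_expr | Cons_expr expr expr | Hd_expr expr | Tl_expr expr

type_synonym store = "nat \<Rightarrow> data"

fun eval_expr :: "expr \<Rightarrow> store \<Rightarrow> data" where
  "eval_expr (Var x) s = s x"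
| "eval_expr Nil_expr s = Leaf"
| "eval_expr (Cons_expr d e) s = Node (eval_expr d s) (eval_expr e s)"
| "eval_expr (Hd_expr e) s = left (eval_expr e s)"
| "eval_expr (Tl_expr e) s = right (eval_expr e s)"

datatype com = Skip | Assign nat expr | Seq com com | Cond expr com com | While expr com

text \<open>\<open>exec p s n s'\<close>: the program \<open>p\<close>, started in \<open>s\<close>, terminates in \<open>s'\<close> after time \<open>n\<close>.\<close>

inductive exec :: "com \<Rightarrow> store \<Rightarrow> nat \<Rightarrow> store \<Rightarrow> bool" where
  Skip: "exec Skip s 1 s"
| Assign: "exec (Assign x e) s (1 + size (eval_expr e s)) (s(x := eval_expr e s))"
| Seq: "exec p s m s' \<Longrightarrow> exec q s' n s'' \<Longrightarrow> exec (Seq p q) s (m + n) s''"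
| CondTrue: "eval_expr e s \<noteq> Leaf \<Longrightarrow> exec p s n s' \<Longrightarrow> exec (Cond e p q) s (1 + n) s'"
| CondFalse: "eval_expr e s = Leaf \<Longrightarrow> exec q s n s' \<Longrightarrow> exec (Cond e p q) s (1 + n) s'"
| WhileFalse: "eval_expr e s = Leaf \<Longrightarrow> exec (While e p) s 1 s"
| WhileTrue: "eval_expr e s \<noteq> Leaf \<Longrightarrow> exec p s m s' \<Longrightarrow> exec (While e p) s' n s'' \<Longrightarrow>
    exec (While e p) s (1 + m + n) s''"

text \<open>Input and output are passed in variable 0; all other variables are initially \<^const>\<open>Leaf\<close>.\<close>

definition computes_in_time :: "com \<Rightarrow> data \<Rightarrow> nat \<Rightarrow> data \<Rightarrow> bool" where
  "computes_in_time p d n r \<longleftrightarrow> (\<exists>s. exec p ((\<lambda>_. Leaf)(0 := d)) n s \<and> s 0 = r)"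

fun enc_bool :: "bool \<Rightarrow> data" where
  "enc_bool False = Leaf"
| "enc_bool True = Node Leaf Leaf"

fun enc_mark :: "mark \<Rightarrow> data" where
  "enc_mark Zero = Leaf"
| "enc_mark Free = Node Leaf Leaf"

text \<open>Numbers are in binary, as lists of bits with the least significant bit first.\<close>

fun enc_nat :: "nat \<Rightarrow> data" where
  "enc_nat n = (if n = 0 then Leaf else Node (enc_bool (odd n)) (enc_nat (n div 2)))"

declare enc_nat.simps [simp del]

fun enc_option :: "nat option \<Rightarrow> data" where
  "enc_option None = Leaf"
| "enc_option (Some n) = Node Leaf (enc_nat n)"

definition enc_list :: "data list \<Rightarrow> data" where
  "enc_list ds = foldr Node ds Leaf"

text \<open>Input graphs have vertex set \<open>{..<n}\<close> for some \<open>n\<close> and are given by their adjacency matrix.\<close>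

definition input_graph :: "graph \<Rightarrow> bool" where
  "input_graph G \<longleftrightarrow> pair_graph G \<and> (\<exists>n. pverts G = {..<n})"

definition enc_vector :: "('b \<Rightarrow> data) \<Rightarrow> graph \<Rightarrow> (nat \<Rightarrow> 'b) \<Rightarrow> data" where
  "enc_vector enc G x = enc_list (map (\<lambda>v. enc (x v)) [0..<card (pverts G)])"

definition enc_graph :: "graph \<Rightarrow> data" where
  "enc_graph G = enc_vector (enc_vector enc_bool G) G (\<lambda>v w. (v, w) \<in> parcs G)"

fun enc_bounded_inst :: "bounded_inst \<Rightarrow> data" where
  "enc_bounded_inst (G, k, u) =
     Node (enc_graph G) (Node (enc_vector enc_nat G k) (enc_vector enc_nat G u))"

fun enc_marked_inst :: "marked_inst \<Rightarrow> data" where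
  "enc_marked_inst (G, k, t) =
     Node (enc_graph G) (Node (enc_vector enc_nat G k) (enc_vector enc_mark G t))"

text \<open>
  \<open>poly_time_solvable enc I P\<close>: the problem \<open>P\<close> restricted to the instances in \<open>I\<close> is solved by a
  polynomial-time algorithm; nothing is required of the algorithm on other inputs.
\<close>

definition poly_time_solvable :: "('i \<Rightarrow> data) \<Rightarrow> 'i set \<Rightarrow> ('i \<Rightarrow> nat option) \<Rightarrow> bool" where
  "poly_time_solvable enc I P \<longleftrightarrow>
     (\<exists>p. \<exists>q :: nat poly. \<forall>x\<in>I. \<exists>n \<le> poly q (size (enc x)).
        computes_in_time p (enc x) n (enc_option (P x)))"

end

theory Submission
  imports Defs "HOL-Library.FuncSet"
begin

text \<open>
  A graph of clique-width at most \<open>c\<close> has, for every vertex set \<open>W\<close>, a cut of rank at most \<open>c\<close>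
  over GF(2) that splits \<open>W\<close> in a balanced way: follow the construction towards the heavier
  part. Cut-rank is submodular, so such a cut splits any vertex set \<open>Z\<close> of cut-rank at most
  \<open>6 * c\<close> into two nonempty parts of cut-rank at most \<open>6 * c\<close> again, where \<open>W\<close> is a row basis
  of the cut matrix of \<open>Z\<close>. Such a split is found in polynomial time: once a row basis and
  separating columns are guessed for both parts, membership in the first part spreads from any of
  its vertices by implications between pairs of vertices, and the closure under these implications
  is again a split.

  Iterating splits gives a decomposition tree. The state of a partial solution on a cell assigns to
  each vertex the weight of its neighbours across the cut; for solutions it is constant on
  boundedly many classes of vertices, so there are polynomially many states.
\<close>

section \<open>Polynomial-time functions\<close>

class coded = fixes encode :: "'a \<Rightarrow> data"

abbreviation csize :: "'a::coded \<Rightarrow> nat" where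
  "csize x \<equiv> size (encode x)"

instantiation bool :: coded begin
definition encode_bool :: "bool \<Rightarrow> data" where "encode_bool = enc_bool"
instance ..
end

instantiation unit :: coded begin
definition encode_unit :: "unit \<Rightarrow> data" where "encode_unit x = Leaf"
instance ..
end

instantiation nat :: coded begin
definition encode_nat :: "nat \<Rightarrow> data" where "encode_nat n = enc_list (replicate n Leaf)"
instance ..
end

instantiation list :: (coded) coded begin
definition encode_list :: "'a list \<Rightarrow> data" where "encode_list xs = enc_list (map encode xs)"
instance ..
end

instantiation prod :: (coded, coded) coded begin
definition encode_prod :: "'a \<times> 'b \<Rightarrow> data" where
  "encode_prod p = Node (encode (fst p)) (encode (snd p))"
instance ..
end

lemma encode_unit_eq [simp]: "encode () = Leaf"
  by (simp add: encode_unit_def)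

lemma encode_bool_simps [simp]: "encode True = Node Leaf Leaf" "encode False = Leaf"
  by (simp_all add: encode_bool_def)

lemma encode_nat_simps [simp]: "encode (0::nat) = Leaf" "encode (Suc n) = Node Leaf (encode n)"
  by (simp_all add: encode_nat_def enc_list_def)

lemma encode_list_simps [simp]:
  "encode [] = Leaf" "encode (x # xs) = Node (encode x) (encode xs)"
  by (simp_all add: encode_list_def enc_list_def)

lemma encode_pair [simp]: "encode (a, b) = Node (encode a) (encode b)"
  by (simp add: encode_prod_def)

lemma csize_nat [simp]: "csize (n::nat) = n"
  by (induction n) auto

lemma csize_bool_le: "csize (b::bool) \<le> 1"
  by (cases b) auto

lemma csize_prod: "csize p = Suc (csize (fst p) + csize (snd p))"
  by (simp add: encode_prod_def)

lemma length_le_csize: "length xs \<le> csize xs"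
  by (induction xs) auto

lemma csize_le_csize_list: "x \<in> set xs \<Longrightarrow> csize x \<le> csize xs"
  by (induction xs) auto

lemma csize_append [simp]: "csize (xs @ ys) = csize xs + csize ys"
  by (induction xs) auto

lemma csize_rev [simp]: "csize (rev xs) = csize xs"
  by (induction xs) auto

lemma csize_filter_le: "csize (filter P xs) \<le> csize xs"
  by (induction xs) auto

lemma csize_concat_le: "csize (concat xss) \<le> csize xss"
  by (induction xss) auto

lemma csize_take_le: "csize (take i xs) \<le> csize xs"
  by (metis append_take_drop_id csize_append le_add1)

lemma csize_drop_le: "csize (drop i xs) \<le> csize xs"
  by (metis append_take_drop_id csize_append le_add2)

lemma csize_list_le:
  assumes "\<And>x. x \<in> set xs \<Longrightarrow> csize x \<le> b"
  shows "csize xs \<le> length xs * (b + 1)"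
  using assms
proof (induction xs)
  case (Cons x xs)
  have "csize x \<le> b" "csize xs \<le> length xs * (b + 1)" using Cons by auto
  then show ?case by simp
qed simp

lemma csize_bool_list_le: "csize (xs :: bool list) \<le> 2 * length xs"
  using csize_list_le[of xs 1] csize_bool_le by simp

subsection \<open>Polynomially bounded functions\<close>

definition pbounded :: "('a::coded \<Rightarrow> nat) \<Rightarrow> bool" where
  "pbounded f \<longleftrightarrow> (\<exists>k. \<forall>x. f x \<le> (csize x + 2) ^ k)"

named_theorems pbounded_intros

lemma pbounded_mono: "pbounded g \<Longrightarrow> (\<And>x. f x \<le> g x) \<Longrightarrow> pbounded f"
  unfolding pbounded_def by (meson le_trans)

lemma pboundedE:
  assumes "pbounded f"
  obtains k where "\<And>x. f x \<le> (csize x + 2) ^ k"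
  using assms unfolding pbounded_def by blast

lemma pbounded_const [pbounded_intros]: "pbounded (\<lambda>x. c)"
proof -
  have "c \<le> (csize x + 2) ^ c" for x :: 'a
    using power_mono[of 2 "csize x + 2" c] less_exp[of c] by simp
  then show ?thesis unfolding pbounded_def by blast
qed

lemma pbounded_csize [pbounded_intros]: "pbounded (\<lambda>x. csize x)"
  unfolding pbounded_def by (rule exI[of _ 1]) auto

lemma pbounded_add [pbounded_intros]:
  assumes "pbounded f" "pbounded g"
  shows "pbounded (\<lambda>x. f x + g x)"
proof -
  obtain k l where bounds: "\<And>x. f x \<le> (csize x + 2) ^ k" "\<And>x. g x \<le> (csize x + 2) ^ l"
    using assms by (meson pboundedE)
  have "f x + g x \<le> (csize x + 2) ^ Suc (max k l)" for x
  proof -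
    have "f x \<le> (csize x + 2) ^ max k l" "g x \<le> (csize x + 2) ^ max k l"
      using bounds[of x] by (meson le_trans power_increasing max.cobounded1 max.cobounded2
          le_add2 one_le_numeral)+
    then have "f x + g x \<le> 2 * (csize x + 2) ^ max k l" by simp
    also have "\<dots> \<le> (csize x + 2) ^ Suc (max k l)" by simp
    finally show ?thesis .
  qed
  then show ?thesis unfolding pbounded_def by blast
qed

lemma pbounded_mult [pbounded_intros]:
  assumes "pbounded f" "pbounded g"
  shows "pbounded (\<lambda>x. f x * g x)"
proof -
  obtain k l where "\<And>x. f x \<le> (csize x + 2) ^ k" "\<And>x. g x \<le> (csize x + 2) ^ l"
    using assms by (meson pboundedE)
  then have "f x * g x \<le> (csize x + 2) ^ (k + l)" for x
    unfolding power_add by (intro mult_le_mono)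
  then show ?thesis unfolding pbounded_def by blast
qed

lemma pbounded_power [pbounded_intros]: "pbounded f \<Longrightarrow> pbounded (\<lambda>x. f x ^ k)"
  by (induction k) (auto intro: pbounded_intros)

lemma pbounded_comp:
  assumes "pbounded f" "pbounded (\<lambda>x. csize (g x))"
  shows "pbounded (\<lambda>x. f (g x))"
proof -
  obtain k where k: "\<And>y. f y \<le> (csize y + 2) ^ k" using assms(1) by (meson pboundedE)
  show ?thesis
  proof (rule pbounded_mono)
    show "pbounded (\<lambda>x. (csize (g x) + 2) ^ k)" by (intro pbounded_intros assms)
  qed (rule k)
qed

subsection \<open>Timed weakest preconditions\<close>

definition wp :: "com \<Rightarrow> nat \<Rightarrow> (store \<Rightarrow> bool) \<Rightarrow> store \<Rightarrow> bool" where
  "wp p t Q s \<longleftrightarrow> (\<exists>n\<le>t. \<exists>s'. exec p s n s' \<and> Q s')"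

lemma wp_mono: "wp p m P s \<Longrightarrow> m \<le> n \<Longrightarrow> (\<And>s'. P s' \<Longrightarrow> Q s') \<Longrightarrow> wp p n Q s"
  unfolding wp_def by (meson le_trans)

lemma wp_Assign:
  "size (eval_expr e s) \<le> n \<Longrightarrow> Q (s(x := eval_expr e s)) \<Longrightarrow> wp (Assign x e) (1 + n) Q s"
  unfolding wp_def using exec.Assign by (meson add_left_mono)

lemma wp_Seq: "wp p m (wp q n Q) s \<Longrightarrow> wp (Seq p q) (m + n) Q s"
  unfolding wp_def by (meson add_mono exec.Seq)

lemma wp_Cond:
  assumes "eval_expr e s \<noteq> Leaf \<Longrightarrow> wp p n Q s" "eval_expr e s = Leaf \<Longrightarrow> wp q n Q s"
  shows "wp (Cond e p q) (1 + n) Q s"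
  using assms unfolding wp_def by (meson add_left_mono exec.CondTrue exec.CondFalse)

lemma wp_While_exit: "eval_expr e s = Leaf \<Longrightarrow> Q s \<Longrightarrow> wp (While e p) 1 Q s"
  unfolding wp_def by (meson exec.WhileFalse order_refl)

lemma wp_While_step:
  "eval_expr e s \<noteq> Leaf \<Longrightarrow> wp p m (wp (While e p) n Q) s \<Longrightarrow> wp (While e p) (1 + m + n) Q s"
  unfolding wp_def by (meson add_mono exec.WhileTrue order_refl)

lemma exec_size_growth: "exec p s n s' \<Longrightarrow> size (s' v) \<le> size (s v) + n"
proof (induction arbitrary: v rule: exec.induct)
  case (Seq p s m s' q n s'')
  show ?case using Seq.IH[of v] by linarith
next
  case (WhileTrue e s p m s' n s'')
  show ?case using WhileTrue.IH[of v] by linarith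
qed (auto simp: le_SucI)

text \<open>The bound \<open>B\<close> on the registers touched by the program makes programs composable: a caller
  keeps its own data in the registers from \<open>B\<close> on.\<close>

definition subroutine :: "com \<Rightarrow> nat \<Rightarrow> ('a::coded \<Rightarrow> nat) \<Rightarrow> ('a \<Rightarrow> 'b::coded) \<Rightarrow> bool" where
  "subroutine p B T f \<longleftrightarrow> (\<forall>x s. s 0 = encode x \<longrightarrow>
     wp p (T x) (\<lambda>s'. s' 0 = encode (f x) \<and> (\<forall>v\<ge>B. s' v = s v)) s)"

lemma wp_subroutine:
  assumes "subroutine p B T f" "s 0 = encode x"
    and "\<And>s'. s' 0 = encode (f x) \<Longrightarrow> \<forall>v\<ge>B. s' v = s v \<Longrightarrow> Q s'"
  shows "wp p (T x) Q s"
proof (rule wp_mono[OF _ order_refl assms(3)])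
  show "wp p (T x) (\<lambda>s'. s' 0 = encode (f x) \<and> (\<forall>v\<ge>B. s' v = s v)) s"
    using assms(1,2) unfolding subroutine_def by blast
qed auto

lemma subroutine_mono:
  assumes "subroutine p B T f" "B \<le> B'"
  shows "subroutine p B' T f"
  unfolding subroutine_def
  by (intro allI impI wp_subroutine[OF assms(1)]) (use assms(2) in auto)

subsection \<open>Basic polynomial-time functions\<close>

definition ptime :: "('a::coded \<Rightarrow> 'b::coded) \<Rightarrow> bool" where
  "ptime f \<longleftrightarrow> (\<exists>p B T. pbounded T \<and> subroutine p B T f)"

lemma ptimeE:
  assumes "ptime f"
  obtains p B T where "pbounded T" "\<forall>B'\<ge>B. subroutine p B' T f"
  using assms unfolding ptime_def by (metis subroutine_mono)

lemma ptimeI: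
  assumes "pbounded T"
    and "\<And>x s. s 0 = encode x \<Longrightarrow> wp p (T x) (\<lambda>s'. s' 0 = encode (f x) \<and> (\<forall>v\<ge>B. s' v = s v)) s"
  shows "ptime f"
  unfolding ptime_def subroutine_def using assms by blast

lemma pbounded_csize_ptime:
  assumes "ptime f"
  shows "pbounded (\<lambda>x. csize (f x))"
proof -
  obtain p B T where T: "pbounded T" and p: "subroutine p B T f"
    using assms unfolding ptime_def by blast
  have "csize (f x) \<le> csize x + T x" for x
  proof -
    obtain n s' where "n \<le> T x" "exec p (\<lambda>_. encode x) n s'" "s' 0 = encode (f x)"
      using p unfolding subroutine_def wp_def by fastforce
    then show ?thesis using exec_size_growth[of p "\<lambda>_. encode x" n s' 0] by simp
  qed
  then show ?thesis by (rule pbounded_mono[rotated]) (intro pbounded_intros T)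
qed

named_theorems ptime_intros

lemma ptime_expr:
  assumes "\<And>x s. s 0 = encode x \<Longrightarrow> eval_expr e s = encode (f x)" "pbounded (\<lambda>x. csize (f x))"
  shows "ptime f"
proof (rule ptimeI)
  show "pbounded (\<lambda>x. 1 + csize (f x))" by (intro pbounded_intros assms)
  show "wp (Assign 0 e) (1 + csize (f x)) (\<lambda>s'. s' 0 = encode (f x) \<and> (\<forall>v\<ge>1. s' v = s v)) s"
    if "s 0 = encode x" for x s
    using assms(1)[of s x] that by (intro wp_Assign) auto
qed

lemma ptime_same_code: "(\<And>x. encode (f x) = encode x) \<Longrightarrow> ptime f"
  by (rule ptime_expr[of "Var 0"]) (auto intro: pbounded_intros)

lemma ptime_id [ptime_intros]: "ptime (\<lambda>x. x)"
  by (rule ptime_same_code) simp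

lemma ptime_comp:
  assumes "ptime f" "ptime g"
  shows "ptime (\<lambda>x. f (g x))"
proof -
  obtain p B T where T: "pbounded T" and p: "\<forall>B'\<ge>B. subroutine p B' T f"
    using assms(1) by (rule ptimeE)
  obtain q C U where U: "pbounded U" and q: "\<forall>B'\<ge>C. subroutine q B' U g"
    using assms(2) by (rule ptimeE)
  have p': "subroutine p (max B C) T f" and q': "subroutine q (max B C) U g" using p q by auto
  show ?thesis
  proof (rule ptimeI)
    show "pbounded (\<lambda>x. U x + T (g x))"
      by (intro pbounded_intros U pbounded_comp[OF T] pbounded_csize_ptime assms)
    show "wp (Seq q p) (U x + T (g x))
        (\<lambda>s'. s' 0 = encode (f (g x)) \<and> (\<forall>v\<ge>max B C. s' v = s v)) s" if "s 0 = encode x" for x s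
      using that by (intro wp_Seq wp_subroutine[OF q'] wp_subroutine[OF p']) auto
  qed
qed

lemma ptime_Pair [ptime_intros]:
  assumes "ptime f" "ptime g"
  shows "ptime (\<lambda>x. (f x, g x))"
proof -
  obtain p B T where T: "pbounded T" and p: "\<forall>B'\<ge>B. subroutine p B' T f"
    using assms(1) by (rule ptimeE)
  obtain q C U where U: "pbounded U" and q: "\<forall>B'\<ge>C. subroutine q B' U g"
    using assms(2) by (rule ptimeE)
  define D where "D = Suc (max B C)"
  have p': "subroutine p D T f" and q': "subroutine q D U g" and D: "0 < D"
    using p q unfolding D_def by auto
  let ?r = "Seq (Assign D (Var 0)) (Seq p (Seq (Assign (Suc D) (Var 0)) (Seq (Assign 0 (Var D))
    (Seq q (Assign 0 (Cons_expr (Var (Suc D)) (Var 0)))))))"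
  let ?t = "\<lambda>x. (1 + csize x) + (T x + ((1 + csize (f x)) + ((1 + csize x) +
    (U x + (1 + (csize (f x) + csize (g x) + 1))))))"
  show ?thesis
  proof (rule ptimeI)
    show "pbounded ?t" by (intro pbounded_intros T U pbounded_csize_ptime assms)
    show "wp ?r (?t x) (\<lambda>s'. s' 0 = encode (f x, g x) \<and> (\<forall>v\<ge>D + 2. s' v = s v)) s"
      if "s 0 = encode x" for x s
      using that D
      by (intro wp_Seq wp_Assign wp_subroutine[OF p', of _ x] wp_subroutine[OF q', of _ x]) auto
  qed
qed

lemma ptime_fst_snd: "ptime (fst :: 'a \<times> 'b \<Rightarrow> 'a::coded)" "ptime (snd :: 'a \<times> 'b \<Rightarrow> 'b::coded)"
proof -
  have "pbounded (\<lambda>p::'a \<times> 'b. csize (fst p))" "pbounded (\<lambda>p::'a \<times> 'b. csize (snd p))"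
    by (rule pbounded_mono[OF pbounded_csize], simp add: csize_prod)+
  then show "ptime (fst :: 'a \<times> 'b \<Rightarrow> 'a)" "ptime (snd :: 'a \<times> 'b \<Rightarrow> 'b)"
    by (auto intro: ptime_expr[of "Hd_expr (Var 0)"] ptime_expr[of "Tl_expr (Var 0)"]
        simp: encode_prod_def)
qed

lemmas [ptime_intros] = ptime_fst_snd[THEN ptime_comp]

lemma ptime_comp2:
  assumes "ptime (\<lambda>p. F (fst p) (snd p))" "ptime f" "ptime g"
  shows "ptime (\<lambda>x. F (f x) (g x))"
  using ptime_comp[OF assms(1) ptime_Pair[OF assms(2,3)]] by simp

lemma ptime_Let [ptime_intros]:
  assumes "ptime f" "ptime (\<lambda>p. h (fst p) (snd p))"
  shows "ptime (\<lambda>x. let y = f x in h x y)"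
  using ptime_comp2[OF assms(2) ptime_id assms(1)] by (simp add: Let_def)

lemma ptime_comp3:
  assumes "ptime (\<lambda>p. F (fst p) (fst (snd p)) (snd (snd p)))" "ptime f" "ptime g" "ptime h"
  shows "ptime (\<lambda>x. F (f x) (g x) (h x))"
  using ptime_comp2[of "\<lambda>a p. F a (fst p) (snd p)", OF assms(1,2) ptime_Pair[OF assms(3,4)]] by simp

lemma ptime_comp4:
  assumes "ptime (\<lambda>p. F (fst p) (fst (snd p)) (fst (snd (snd p))) (snd (snd (snd p))))"
    and "ptime f" "ptime g" "ptime h" "ptime i"
  shows "ptime (\<lambda>x. F (f x) (g x) (h x) (i x))"
  using ptime_comp3[of "\<lambda>a b p. F a b (fst p) (snd p)", OF assms(1-3) ptime_Pair[OF assms(4,5)]]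
  by simp

primrec data_expr :: "data \<Rightarrow> expr" where
  "data_expr Leaf = Nil_expr"
| "data_expr (Node a b) = Cons_expr (data_expr a) (data_expr b)"

lemma eval_data_expr [simp]: "eval_expr (data_expr d) s = d"
  by (induction d) auto

lemma ptime_const [ptime_intros]: "ptime (\<lambda>x. c)"
  by (rule ptime_expr[of "data_expr (encode c)"]) (auto intro: pbounded_intros)

lemma ptime_Cons [ptime_intros]: "ptime f \<Longrightarrow> ptime g \<Longrightarrow> ptime (\<lambda>x. f x # g x)"
proof (rule ptime_comp2[of "(#)"])
  show "ptime (\<lambda>p. fst p # snd p :: 'b list)"
    by (rule ptime_same_code) (simp add: encode_prod_def)
qed

lemma ptime_Suc [ptime_intros]: "ptime f \<Longrightarrow> ptime (\<lambda>x. Suc (f x))"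
proof (rule ptime_comp[of Suc])
  have "pbounded (\<lambda>n::nat. csize n + 1)" by (intro pbounded_intros)
  then show "ptime Suc" by (intro ptime_expr[of "Cons_expr Nil_expr (Var 0)"]) auto
qed

subsection \<open>Branching\<close>

text \<open>The branch is decided by whether the code of \<open>b x\<close> is \<^const>\<open>Leaf\<close>. If it is not, then it is
  reinterpreted as the code of \<open>c x\<close>: the code of a nonempty list, for instance, is the code of
  the pair of its head and its tail.\<close>

lemma ptime_branch:
  assumes ptime: "ptime b" "ptime f" "ptime g"
    and code: "\<And>x. encode (b x) = (if P x then encode (c x) else Leaf)"
      "\<And>x. P x \<Longrightarrow> encode (c x) \<noteq> Leaf"
  shows "ptime (\<lambda>x. if P x then f (x, c x) else g x)"
proof -
  obtain pb A S where S: "pbounded S" and pb: "\<forall>B'\<ge>A. subroutine pb B' S b"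
    using ptime(1) by (rule ptimeE)
  obtain pf B T where T: "pbounded T" and pf: "\<forall>B'\<ge>B. subroutine pf B' T f"
    using ptime(2) by (rule ptimeE)
  obtain pg C U where U: "pbounded U" and pg: "\<forall>B'\<ge>C. subroutine pg B' U g"
    using ptime(3) by (rule ptimeE)
  obtain k where k: "\<And>p. T p \<le> (csize p + 2) ^ k" using T by (meson pboundedE)
  define D where "D = Suc (max A (max B C))"
  have subs: "subroutine pb D S b" "subroutine pf D T f" "subroutine pg D U g" and D: "0 < D"
    using pb pf pg unfolding D_def by auto
  let ?r = "Seq (Assign D (Var 0)) (Seq pb (Cond (Var 0)
    (Seq (Assign 0 (Cons_expr (Var D) (Var 0))) pf) (Seq (Assign 0 (Var D)) pg)))"
  let ?n = "\<lambda>x. csize x + csize (b x) + 1"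
  let ?t = "\<lambda>x. (1 + csize x) + (S x + (1 + ((1 + ?n x) + ((?n x + 2) ^ k + U x))))"
  show ?thesis
  proof (rule ptimeI)
    show "pbounded ?t" by (intro pbounded_intros S U pbounded_csize_ptime ptime)
    fix x :: 'a and s :: store assume s: "s 0 = encode x"
    let ?Q = "\<lambda>s'. s' 0 = encode (if P x then f (x, c x) else g x) \<and> (\<forall>v\<ge>D + 1. s' v = s v)"
    have then_branch: "wp pf ((?n x + 2) ^ k + U x) ?Q s'"
      if "P x" "s' 0 = encode (x, c x)" "\<forall>v\<ge>D + 1. s' v = s v" for s'
    proof (rule wp_mono)
      show "wp pf (T (x, c x)) ?Q s'" using that by (intro wp_subroutine[OF subs(2)]) auto
      show "T (x, c x) \<le> (?n x + 2) ^ k + U x" using k[of "(x, c x)"] code(1)[of x] that by simp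
    qed
    have else_branch: "wp pg ((?n x + 2) ^ k + U x) ?Q s'"
      if "\<not> P x" "s' 0 = encode x" "\<forall>v\<ge>D + 1. s' v = s v" for s'
    proof (rule wp_mono)
      show "wp pg (U x) ?Q s'" using that by (intro wp_subroutine[OF subs(3)]) auto
    qed simp
    show "wp ?r (?t x) ?Q s"
      using s D code[of x]
      by (intro wp_Seq wp_Assign wp_subroutine[OF subs(1), of _ x] wp_Cond then_branch else_branch)
        (auto split: if_splits)
  qed
qed

lemma ptime_if [ptime_intros]:
  assumes "ptime P" "ptime f" "ptime g"
  shows "ptime (\<lambda>x. if P x then f x else g x)"
proof -
  have "ptime (\<lambda>p. f (fst p))" by (intro ptime_comp[OF assms(2)] ptime_fst_snd)
  from ptime_branch[OF assms(1) this assms(3), of P "\<lambda>_. True"] show ?thesis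
    by (simp cong: if_cong)
qed

lemma ptime_case_list [ptime_intros]:
  assumes "ptime f" "ptime g" "ptime (\<lambda>p. h (fst p) (fst (snd p)) (snd (snd p)))"
  shows "ptime (\<lambda>x. case f x of [] \<Rightarrow> g x | y # ys \<Rightarrow> h x y ys)"
proof -
  have "encode (f x) = (if f x \<noteq> [] then encode (hd (f x), tl (f x)) else Leaf)" for x
    by (cases "f x") auto
  from ptime_branch[OF assms(1,3,2) this] have
    "ptime (\<lambda>x. if f x \<noteq> [] then h x (hd (f x)) (tl (f x)) else g x)"
    by (simp cong: if_cong)
  then show ?thesis by (rule back_subst[of ptime]) (auto split: list.split)
qed

lemma ptime_case_nat [ptime_intros]:
  assumes "ptime f" "ptime g" "ptime (\<lambda>p. h (fst p) (snd p))"
  shows "ptime (\<lambda>x. case f x of 0 \<Rightarrow> g x | Suc n \<Rightarrow> h x n)"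
proof -
  have ptime_h: "ptime (\<lambda>p. h (fst p) (snd (snd p)))"
    by (rule ptime_comp2[OF assms(3)]) (intro ptime_intros)+
  have "encode (f x) = (if f x \<noteq> 0 then encode ((), f x - 1) else Leaf)" for x
    by (cases "f x") auto
  from ptime_branch[OF assms(1) ptime_h assms(2) this] have
    "ptime (\<lambda>x. if f x \<noteq> 0 then h x (f x - 1) else g x)"
    by (simp cong: if_cong)
  then show ?thesis by (rule back_subst[of ptime]) (auto split: nat.split)
qed

subsection \<open>Loops\<close>

text \<open>Register \<open>D\<close> holds the environment, register \<open>Suc D\<close> the remaining list, register 0 the
  accumulator.\<close>

definition fold_loop :: "com \<Rightarrow> nat \<Rightarrow> com" where
  "fold_loop p D = While (Var (Suc D))
    (Seq (Assign 0 (Cons_expr (Var D) (Cons_expr (Hd_expr (Var (Suc D))) (Var 0))))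
      (Seq p (Assign (Suc D) (Tl_expr (Var (Suc D))))))"

lemma wp_fold_loop:
  fixes step :: "'e::coded \<Rightarrow> 'x::coded \<Rightarrow> 'a::coded \<Rightarrow> 'a"
  assumes p: "subroutine p D T (\<lambda>p. step (fst p) (fst (snd p)) (snd (snd p)))" and D: "0 < D"
    and T: "\<And>p. T p \<le> (csize p + 2) ^ k"
    and regs: "s 0 = encode a" "s D = encode e" "s (Suc D) = encode xs"
    and bounds: "csize xs \<le> l" "\<And>i. i \<le> length xs \<Longrightarrow> csize (fold (step e) (take i xs) a) \<le> b"
  shows "wp (fold_loop p D)
    (length xs * (5 + (csize e + l + b + l) + (csize e + l + b + 4) ^ k) + 1)
    (\<lambda>s'. s' 0 = encode (fold (step e) xs a) \<and> (\<forall>v\<ge>D + 2. s' v = s v)) s"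
  using regs bounds
proof (induction xs arbitrary: s a)
  case Nil
  then show ?case unfolding fold_loop_def by (simp add: wp_While_exit[simplified])
next
  case (Cons x xs)
  define m where "m = csize e + l + b"
  let ?n = "length xs * (5 + (m + l) + (m + 4) ^ k) + 1"
  let ?Q = "\<lambda>s'. s' 0 = encode (fold (step e) (x # xs) a) \<and> (\<forall>v\<ge>D + 2. s' v = s v)"
  have size: "csize a \<le> b" "csize x + csize xs < l" using Cons.prems(4) Cons.prems(5)[of 0] by auto
  then have "(csize (e, x, a) + 2) ^ k \<le> (m + 4) ^ k" by (intro power_mono) (auto simp: m_def)
  then have "T (e, x, a) \<le> (m + 4) ^ k" using T[of "(e, x, a)"] by simp
  then have time: "1 + ((1 + (m + 2)) + (T (e, x, a) + (1 + l))) + ?n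
      \<le> length (x # xs) * (5 + (m + l) + (m + 4) ^ k) + 1"
    by simp
  have rest: "wp (fold_loop p D) ?n ?Q s'"
    if "s' 0 = encode (step e x a)" "s' D = encode e" "s' (Suc D) = encode xs"
      "\<forall>v\<ge>D + 2. s' v = s v" for s'
  proof (rule wp_mono[OF Cons.IH[OF that(1-3)]])
    show "csize (fold (step e) (take i xs) (step e x a)) \<le> b" if "i \<le> length xs" for i
      using Cons.prems(5)[of "Suc i"] that by simp
  qed (use that size in \<open>auto simp: m_def\<close>)
  have "wp (fold_loop p D) (1 + ((1 + (m + 2)) + (T (e, x, a) + (1 + l))) + ?n) ?Q s"
    unfolding fold_loop_def
    by (rule wp_While_step; (intro wp_Seq wp_Assign wp_subroutine[OF p, of _ "(e, x, a)"]
          rest[unfolded fold_loop_def])?) (use size D Cons.prems(1-3) in \<open>auto simp: m_def\<close>)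
  then show ?case unfolding m_def[symmetric] using time by (rule wp_mono)
qed

lemma ptime_fold:
  assumes step: "ptime (\<lambda>p. step (fst p) (fst (snd p)) (snd (snd p)))"
    and L: "ptime L" and init: "ptime init" and bound: "pbounded bound"
      "\<And>e i. i \<le> length (L e) \<Longrightarrow> csize (fold (step e) (take i (L e)) (init e)) \<le> bound e"
  shows "ptime (\<lambda>e. fold (step e) (L e) (init e))"
proof -
  obtain p B T where T: "pbounded T" and
    p: "\<forall>B'\<ge>B. subroutine p B' T (\<lambda>p. step (fst p) (fst (snd p)) (snd (snd p)))"
    using step by (rule ptimeE)
  obtain k where k: "\<And>x. T x \<le> (csize x + 2) ^ k" using T by (meson pboundedE)
  have "ptime (\<lambda>e. (e, L e, init e))" by (intro ptime_intros L init)
  then obtain q C U where U: "pbounded U" and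
    q: "\<forall>B'\<ge>C. subroutine q B' U (\<lambda>e. (e, L e, init e))"
    by (rule ptimeE)
  define D where "D = Suc (max B C)"
  have p': "subroutine p D T (\<lambda>p. step (fst p) (fst (snd p)) (snd (snd p)))"
    and q': "subroutine q D U (\<lambda>e. (e, L e, init e))" and D: "0 < D"
    using p q unfolding D_def by auto
  let ?r = "Seq q (Seq (Assign D (Hd_expr (Var 0)))
    (Seq (Assign (Suc D) (Hd_expr (Tl_expr (Var 0))))
    (Seq (Assign 0 (Tl_expr (Tl_expr (Var 0)))) (fold_loop p D))))"
  let ?iter = "\<lambda>e. 5 + (csize e + csize (L e) + bound e + csize (L e)) +
    (csize e + csize (L e) + bound e + 4) ^ k"
  let ?t = "\<lambda>e. U e + ((1 + csize e) + ((1 + csize (L e)) + ((1 + csize (init e)) +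
    (csize (L e) * ?iter e + 1))))"
  show ?thesis
  proof (rule ptimeI)
    show "pbounded ?t" by (intro pbounded_intros U pbounded_csize_ptime L init bound)
    fix e :: 'a and s :: store assume s: "s 0 = encode e"
    let ?Q = "\<lambda>s'. s' 0 = encode (fold (step e) (L e) (init e)) \<and> (\<forall>v\<ge>D + 2. s' v = s v)"
    have loop: "wp (fold_loop p D) (csize (L e) * ?iter e + 1) ?Q s'"
      if "s' 0 = encode (init e)" "s' D = encode e" "s' (Suc D) = encode (L e)"
        "\<forall>v\<ge>D + 2. s' v = s v" for s'
      by (rule wp_mono[OF wp_fold_loop[OF p' D k that(1-3) order_refl bound(2)]])
        (use that length_le_csize in auto)
    show "wp ?r (?t e) ?Q s"
      using s D by (intro wp_Seq wp_Assign wp_subroutine[OF q', of _ e] loop) auto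
  qed
qed

lemma ptime_funpow:
  fixes step :: "'a::coded \<Rightarrow> 'b::coded \<Rightarrow> 'b"
  assumes "ptime (\<lambda>p. step (fst p) (snd p))" "ptime N" "ptime init" "pbounded bound"
    and bound: "\<And>e i. i \<le> N e \<Longrightarrow> csize ((step e ^^ i) (init e)) \<le> bound e"
  shows "ptime (\<lambda>e. (step e ^^ N e) (init e))"
proof -
  have fold_replicate: "fold (\<lambda>_. f) (replicate n ()) a = (f ^^ n) a" for f and n and a :: 'b
    by (induction n arbitrary: a) (auto simp: funpow_swap1)
  have encode_replicate: "encode (replicate n ()) = encode n" for n
    by (induction n) auto
  have units: "ptime (\<lambda>e. replicate (N e) ())"
    by (rule ptime_comp[OF ptime_same_code assms(2)]) (rule encode_replicate)
  have "ptime (\<lambda>e. fold (\<lambda>_. step e) (replicate (N e) ()) (init e))"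
  proof (rule ptime_fold[OF _ units assms(3,4)])
    show "ptime (\<lambda>p :: 'a \<times> unit \<times> 'b. step (fst p) (snd (snd p)))"
      by (rule ptime_comp2[OF assms(1)]) (intro ptime_intros)+
  qed (auto simp: take_replicate fold_replicate bound)
  then show ?thesis by (simp add: fold_replicate)
qed

subsection \<open>Truth values\<close>

lemma ptime_conj [ptime_intros]: "ptime P \<Longrightarrow> ptime Q \<Longrightarrow> ptime (\<lambda>x. P x \<and> Q x)"
  using ptime_if[of P Q "\<lambda>_. False", OF _ _ ptime_const] by (rule back_subst[of ptime]) auto

lemma ptime_not [ptime_intros]: "ptime P \<Longrightarrow> ptime (\<lambda>x. \<not> P x)"
  using ptime_if[of P "\<lambda>_. False" "\<lambda>_. True", OF _ ptime_const ptime_const]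
  by (rule back_subst[of ptime]) auto

lemma ptime_disj [ptime_intros]: "ptime P \<Longrightarrow> ptime Q \<Longrightarrow> ptime (\<lambda>x. P x \<or> Q x)"
  using ptime_if[of P "\<lambda>_. True" Q, OF _ ptime_const] by (rule back_subst[of ptime]) auto

lemma ptime_imp [ptime_intros]: "ptime P \<Longrightarrow> ptime Q \<Longrightarrow> ptime (\<lambda>x. P x \<longrightarrow> Q x)"
  unfolding imp_conv_disj by (intro ptime_intros)

lemma ptime_iff [ptime_intros]: "ptime P \<Longrightarrow> ptime Q \<Longrightarrow> ptime (\<lambda>x. P x \<longleftrightarrow> Q x)"
  unfolding iff_conv_conj_imp by (intro ptime_intros)

subsection \<open>Lists\<close>

lemma ptime_tl [ptime_intros]: "ptime f \<Longrightarrow> ptime (\<lambda>x. tl (f x))"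
  unfolding tl_def by (intro ptime_intros)

lemma ptime_null [ptime_intros]:
  assumes "ptime f"
  shows "ptime (\<lambda>x. f x = [])"
proof -
  have "ptime (\<lambda>x. case f x of [] \<Rightarrow> True | _ # _ \<Rightarrow> False)" by (intro ptime_intros assms)
  moreover have "(case xs of [] \<Rightarrow> True | _ # _ \<Rightarrow> False) \<longleftrightarrow> xs = []" for xs :: "'b list"
    by (cases xs) auto
  ultimately show ?thesis by simp
qed

lemma ptime_rev [ptime_intros]:
  assumes "ptime f"
  shows "ptime (\<lambda>x. rev (f x))"
proof -
  have "ptime (\<lambda>xs :: 'b list. fold (#) xs [])"
    by (rule ptime_fold[OF _ _ _ pbounded_csize])
      (auto simp: fold_Cons_rev csize_take_le intro!: ptime_intros)
  from ptime_comp[OF this assms] show ?thesis by (simp add: fold_Cons_rev)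
qed

lemma ptime_append [ptime_intros]: "ptime f \<Longrightarrow> ptime g \<Longrightarrow> ptime (\<lambda>x. f x @ g x)"
proof (rule ptime_comp2[of "(@)"])
  have "csize (take i (rev xs)) \<le> csize xs" for i and xs :: "'b list"
    using csize_take_le[of i "rev xs"] by simp
  then have "ptime (\<lambda>p :: 'b list \<times> 'b list. fold (#) (rev (fst p)) (snd p))"
    by (intro ptime_fold[OF _ _ _ pbounded_csize] ptime_intros)
      (auto simp: fold_Cons_rev csize_prod le_SucI)
  then show "ptime (\<lambda>p :: 'b list \<times> 'b list. fst p @ snd p)" by (simp add: fold_Cons_rev)
qed

lemma pbounded_csize_map:
  assumes h: "ptime (\<lambda>p. h (fst p) (snd p))" and L: "ptime L"
  obtains b where "pbounded b" "\<And>e i. csize (map (h e) (take i (L e))) \<le> b e"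
proof -
  obtain k where k: "\<And>p. csize (h (fst p) (snd p)) \<le> (csize p + 2) ^ k"
    using pbounded_csize_ptime[OF h] by (meson pboundedE)
  let ?b = "\<lambda>e. (csize e + csize (L e) + 3) ^ k"
  have "csize (map (h e) (take i (L e))) \<le> csize (L e) * (?b e + 1)" for e i
  proof -
    have "csize (h e x) \<le> ?b e" if "x \<in> set (L e)" for x
    proof -
      have "csize (h e x) \<le> (csize (e, x) + 2) ^ k" using k[of "(e, x)"] by simp
      also have "\<dots> \<le> ?b e" using csize_le_csize_list[OF that] by (intro power_mono) auto
      finally show ?thesis .
    qed
    then have "csize (map (h e) (take i (L e))) \<le> length (map (h e) (take i (L e))) * (?b e + 1)"
      by (intro csize_list_le) (auto dest: in_set_takeD)
    also have "\<dots> \<le> csize (L e) * (?b e + 1)"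
      using length_le_csize[of "L e"] by (intro mult_le_mono1) simp
    finally show ?thesis .
  qed
  moreover have "pbounded (\<lambda>e. csize (L e) * (?b e + 1))"
    by (intro pbounded_intros pbounded_csize_ptime L)
  ultimately show ?thesis using that by blast
qed

lemma ptime_map [ptime_intros]:
  assumes h: "ptime (\<lambda>p. h (fst p) (snd p))" and L: "ptime L"
  shows "ptime (\<lambda>e. map (h e) (L e))"
proof -
  have fold_map: "fold (\<lambda>x ys. f x # ys) xs ys = rev (map f xs) @ ys"
    for f :: "'b \<Rightarrow> 'c" and xs ys
    by (induction xs arbitrary: ys) auto
  obtain b where bound: "pbounded b" "\<And>e i. csize (map (h e) (take i (L e))) \<le> b e"
    using pbounded_csize_map[OF h L] by blast
  have "ptime (\<lambda>e. fold (\<lambda>x ys. h e x # ys) (L e) [])"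
  proof (rule ptime_fold[OF _ L ptime_const bound(1)])
    show "ptime (\<lambda>p. h (fst p) (fst (snd p)) # snd (snd p))"
      by (intro ptime_intros ptime_comp2[OF h])
  qed (simp add: fold_map bound)
  from ptime_rev[OF this] show ?thesis by (simp add: fold_map)
qed

lemma ptime_concat [ptime_intros]:
  assumes "ptime f"
  shows "ptime (\<lambda>x. concat (f x))"
proof -
  have fold_concat: "fold (\<lambda>xs ys. ys @ xs) xss ys = ys @ concat xss"
    for xss :: "'b list list" and ys
    by (induction xss arbitrary: ys) auto
  have "ptime (\<lambda>xss :: 'b list list. fold (\<lambda>xs ys. ys @ xs) xss [])"
  proof (rule ptime_fold[OF _ ptime_id ptime_const pbounded_csize])
    show "csize (fold (\<lambda>xs ys. ys @ xs) (take i xss) []) \<le> csize xss"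
      for i and xss :: "'b list list"
      unfolding fold_concat by (simp add: order_trans[OF csize_concat_le csize_take_le])
  qed (intro ptime_intros)
  from ptime_comp[OF this assms] show ?thesis by (simp add: fold_concat)
qed

lemma ptime_filter [ptime_intros]:
  assumes "ptime (\<lambda>p. P (fst p) (snd p))" "ptime L"
  shows "ptime (\<lambda>e. filter (P e) (L e))"
proof -
  have "ptime (\<lambda>e. concat (map (\<lambda>x. if P e x then [x] else []) (L e)))"
    by (intro ptime_intros assms)
  moreover have "concat (map (\<lambda>x. if Q x then [x] else []) xs) = filter Q xs"
    for Q :: "'b \<Rightarrow> bool" and xs
    by (induction xs) auto
  ultimately show ?thesis by simp
qed

lemma ptime_Bex [ptime_intros]:
  assumes "ptime (\<lambda>p. P (fst p) (snd p))" "ptime L"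
  shows "ptime (\<lambda>e. \<exists>x\<in>set (L e). P e x)"
proof -
  have "ptime (\<lambda>e. filter (P e) (L e) \<noteq> [])" by (intro ptime_intros assms)
  then show ?thesis by (simp add: filter_empty_conv)
qed

lemma ptime_Ball [ptime_intros]:
  assumes "ptime (\<lambda>p. P (fst p) (snd p))" "ptime L"
  shows "ptime (\<lambda>e. \<forall>x\<in>set (L e). P e x)"
proof -
  have "ptime (\<lambda>e. \<not> (\<exists>x\<in>set (L e). \<not> P e x))" by (intro ptime_intros assms)
  then show ?thesis by simp
qed

lemma ptime_length [ptime_intros]:
  assumes "ptime f"
  shows "ptime (\<lambda>x. length (f x))"
proof -
  have "encode (length xs) = encode xs" for xs :: "unit list"
    by (induction xs) auto
  then have "ptime (length :: unit list \<Rightarrow> nat)" by (rule ptime_same_code)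
  from ptime_comp[OF this ptime_map[OF ptime_const assms]] show ?thesis by simp
qed

text \<open>Unlike \<^const>\<open>nth\<close>, this is specified, and computable, also beyond the end of the list.\<close>

definition lookup :: "'a \<Rightarrow> 'a list \<Rightarrow> nat \<Rightarrow> 'a" where
  "lookup d xs i = (case drop i xs of [] \<Rightarrow> d | x # _ \<Rightarrow> x)"

lemma lookup_nth: "lookup d xs i = (if i < length xs then xs ! i else d)"
  by (auto simp: lookup_def Cons_nth_drop_Suc[symmetric])

lemma lookup_map_upt: "lookup d (map f [0..<n]) i = (if i < n then f i else d)"
  by (simp add: lookup_nth)

lemma ptime_drop [ptime_intros]: "ptime f \<Longrightarrow> ptime g \<Longrightarrow> ptime (\<lambda>x. drop (f x) (g x))"
proof (rule ptime_comp2[of drop])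
  have tl_pow: "(tl ^^ n) xs = drop n xs" for n and xs :: "'b list"
    by (induction n) (auto simp: drop_Suc tl_drop)
  have "ptime (\<lambda>p :: nat \<times> 'b list. (tl ^^ fst p) (snd p))"
    by (rule ptime_funpow[of "\<lambda>_. tl" fst snd csize]; (intro ptime_intros pbounded_intros)?)
      (auto simp: tl_pow csize_prod csize_drop_le intro: le_SucI[OF trans_le_add2])
  then show "ptime (\<lambda>p :: nat \<times> 'b list. drop (fst p) (snd p))" by (simp only: tl_pow)
qed

lemma ptime_lookup [ptime_intros]: "ptime f \<Longrightarrow> ptime g \<Longrightarrow> ptime (\<lambda>x. lookup d (f x) (g x))"
  unfolding lookup_def by (intro ptime_intros)

subsection \<open>Numbers\<close>

lemma ptime_pred: "ptime f \<Longrightarrow> ptime (\<lambda>x. f x - 1 :: nat)"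
proof -
  assume "ptime f"
  then have "ptime (\<lambda>x. case f x of 0 \<Rightarrow> 0 | Suc n \<Rightarrow> n)" by (intro ptime_intros)
  then show ?thesis by (rule back_subst[of ptime]) (auto split: nat.split)
qed

lemma ptime_eq_0 [ptime_intros]:
  assumes "ptime f"
  shows "ptime (\<lambda>x. f x = (0::nat))"
proof -
  have "ptime (\<lambda>x. case f x of 0 \<Rightarrow> True | Suc _ \<Rightarrow> False)" by (intro ptime_intros assms)
  moreover have "(case n of 0 \<Rightarrow> True | Suc _ \<Rightarrow> False) \<longleftrightarrow> n = 0" for n by (cases n) auto
  ultimately show ?thesis by simp
qed

lemma ptime_plus [ptime_intros]: "ptime f \<Longrightarrow> ptime g \<Longrightarrow> ptime (\<lambda>x. f x + g x :: nat)"
proof (rule ptime_comp2[of "(+)"])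
  have Suc_pow: "(Suc ^^ m) n = m + n" for m n by (induction m) auto
  have "ptime (\<lambda>p :: nat \<times> nat. (Suc ^^ fst p) (snd p))"
    by (rule ptime_funpow[of "\<lambda>_. Suc" fst snd csize]; (intro ptime_intros pbounded_intros)?)
      (auto simp: Suc_pow csize_prod)
  then show "ptime (\<lambda>p :: nat \<times> nat. fst p + snd p)" by (simp add: Suc_pow)
qed

lemma ptime_minus [ptime_intros]: "ptime f \<Longrightarrow> ptime g \<Longrightarrow> ptime (\<lambda>x. f x - g x :: nat)"
proof (rule ptime_comp2[of "(-)"])
  have pred_pow: "((\<lambda>n. n - 1) ^^ m) n = n - m" for m n :: nat by (induction m) auto
  have "ptime (\<lambda>p :: nat \<times> nat. ((\<lambda>n. n - 1) ^^ snd p) (fst p))"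
  proof (rule ptime_funpow[of "\<lambda>_ n. n - 1" snd fst csize])
    show "csize (((\<lambda>n. n - 1) ^^ i) (fst p)) \<le> csize p" for i and p :: "nat \<times> nat"
      unfolding pred_pow by (simp add: csize_prod)
  qed (intro ptime_pred ptime_intros pbounded_intros)+
  then show "ptime (\<lambda>p :: nat \<times> nat. fst p - snd p)" by (simp only: pred_pow)
qed

lemma ptime_mult [ptime_intros]: "ptime f \<Longrightarrow> ptime g \<Longrightarrow> ptime (\<lambda>x. f x * g x :: nat)"
proof (rule ptime_comp2[of "(*)"])
  have plus_pow: "(((+) k) ^^ m) 0 = m * k" for m k :: nat by (induction m) auto
  have "ptime (\<lambda>p :: nat \<times> nat. (((+) (snd p)) ^^ fst p) 0)"
    by (rule ptime_funpow[of "\<lambda>p n. snd p + n" fst "\<lambda>_. 0" "\<lambda>p. csize (fst p) * csize (snd p)"];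
        (intro ptime_intros pbounded_intros pbounded_csize_ptime)?) (auto simp: plus_pow)
  then show "ptime (\<lambda>p :: nat \<times> nat. fst p * snd p)" by (simp add: plus_pow)
qed

lemma ptime_le [ptime_intros]: "ptime f \<Longrightarrow> ptime g \<Longrightarrow> ptime (\<lambda>x. f x \<le> (g x :: nat))"
  unfolding diff_is_0_eq[symmetric] by (intro ptime_intros)

lemma ptime_less [ptime_intros]: "ptime f \<Longrightarrow> ptime g \<Longrightarrow> ptime (\<lambda>x. f x < (g x :: nat))"
  unfolding less_eq_Suc_le by (intro ptime_intros)

lemma ptime_eq_nat [ptime_intros]: "ptime f \<Longrightarrow> ptime g \<Longrightarrow> ptime (\<lambda>x. f x = (g x :: nat))"
  unfolding order_eq_iff by (intro ptime_intros)

lemma ptime_upt [ptime_intros]: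
  assumes "ptime f"
  shows "ptime (\<lambda>x. [0..<f x])"
proof -
  let ?step = "\<lambda>xs. xs @ [length xs]"
  have step_pow: "(?step ^^ n) [] = [0..<n]" for n by (induction n) auto
  have "csize [0..<i] \<le> n * (n + 1)" if "i \<le> n" for i n
  proof -
    have "csize [0..<i] \<le> length [0..<i] * (n + 1)" using that by (intro csize_list_le) auto
    also have "\<dots> \<le> n * (n + 1)" using that by (intro mult_le_mono1) auto
    finally show ?thesis .
  qed
  then have "ptime (\<lambda>n. (?step ^^ n) [])"
    by (intro ptime_funpow[of "\<lambda>_. ?step" "\<lambda>n. n" "\<lambda>_. []" "\<lambda>n. csize n * (csize n + 1)"]
        ptime_intros pbounded_intros) (simp add: step_pow)
  from ptime_comp[OF this assms] show ?thesis by (simp add: step_pow)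
qed

lemma ptime_Ex_less [ptime_intros]:
  "ptime (\<lambda>p. P (fst p) (snd p)) \<Longrightarrow> ptime N \<Longrightarrow> ptime (\<lambda>e. \<exists>v<N e :: nat. P e v)"
  using ptime_Bex[of P "\<lambda>e. [0..<N e]"] ptime_upt[of N] by (simp add: Bex_def)

lemma ptime_All_less [ptime_intros]:
  "ptime (\<lambda>p. P (fst p) (snd p)) \<Longrightarrow> ptime N \<Longrightarrow> ptime (\<lambda>e. \<forall>v<N e :: nat. P e v)"
  using ptime_Ball[of P "\<lambda>e. [0..<N e]"] ptime_upt[of N] by (simp add: Ball_def)

lemma ptime_div2 [ptime_intros]:
  assumes "ptime f"
  shows "ptime (\<lambda>x. f x div 2 :: nat)"
proof -
  have div2_eq: "n div 2 = length (filter (\<lambda>m. Suc (m + m) < n) [0..<n])" for n :: nat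
  proof -
    have "{m. m < n \<and> Suc (m + m) < n} = {..<n div 2}" by auto
    then show ?thesis by (simp add: length_filter_conv_card cong: conj_cong)
  qed
  have "ptime (\<lambda>n::nat. n div 2)" unfolding div2_eq by (intro ptime_intros)
  from ptime_comp[OF this assms] show ?thesis .
qed

lemma ptime_odd [ptime_intros]:
  assumes "ptime f"
  shows "ptime (\<lambda>x. odd (f x :: nat))"
proof -
  have odd_iff: "odd n \<longleftrightarrow> n \<noteq> n div 2 + n div 2" for n :: nat by presburger
  show ?thesis unfolding odd_iff by (intro ptime_intros assms)
qed

section \<open>Cut-rank\<close>

definition sdiff :: "'a set \<Rightarrow> 'a set \<Rightarrow> 'a set" (infixl "\<ominus>" 65) where
  "A \<ominus> B = sym_diff A B"

lemma sdiff_cancel [simp]: "A \<ominus> B = A \<ominus> C \<longleftrightarrow> B = C" "B \<ominus> A = C \<ominus> A \<longleftrightarrow> B = C"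
  unfolding sdiff_def by blast+

lemma sdiff_exchange: "A \<ominus> B = C \<ominus> D \<Longrightarrow> A \<ominus> C = B \<ominus> D"
  unfolding sdiff_def by blast

lemma sdiff_empty [simp]: "{} \<ominus> A = A" "A \<ominus> {} = A"
  unfolding sdiff_def by auto

lemma sdiff_eq_empty_iff [simp]: "A \<ominus> B = {} \<longleftrightarrow> A = B"
  unfolding sdiff_def by blast

lemma sdiff_subset: "A \<subseteq> X \<Longrightarrow> B \<subseteq> X \<Longrightarrow> A \<ominus> B \<subseteq> X"
  unfolding sdiff_def by blast

lemma sdiff_Int_distrib: "(A \<ominus> B) \<inter> C = (A \<inter> C) \<ominus> (B \<inter> C)"
  unfolding sdiff_def by blast

lemma insert_eq_sdiff: "x \<notin> A \<Longrightarrow> insert x A = {x} \<ominus> A"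
  unfolding sdiff_def by blast

lemma odd_card_sdiff:
  assumes "finite A" "finite B"
  shows "odd (card (A \<ominus> B)) \<longleftrightarrow> odd (card A) \<noteq> odd (card B)"
proof -
  have "card (A \<ominus> B) = card (A - B) + card (B - A)"
    unfolding sdiff_def using assms by (intro card_Un_disjoint) auto
  moreover have "card A = card (A \<inter> B) + card (A - B)" "card B = card (A \<inter> B) + card (B - A)"
    using assms card_Int_Diff[of A B] card_Int_Diff[of B A] by (auto simp: Int_commute)
  ultimately show ?thesis by auto
qed

subsection \<open>Sums of rows over GF(2)\<close>

text \<open>A vector over GF(2) is the set of the positions of its ones. The matrix is a relation, with
  rows indexed by the first argument.\<close>

definition gf2_subspace :: "'a set set \<Rightarrow> bool" where
  "gf2_subspace M \<longleftrightarrow> {} \<in> M \<and> (\<forall>A\<in>M. \<forall>B\<in>M. A \<ominus> B \<in> M)"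

definition row_sum :: "('a \<Rightarrow> 'b \<Rightarrow> bool) \<Rightarrow> 'a set \<Rightarrow> 'b set" where
  "row_sum E A = {w. odd (card {a \<in> A. E a w})}"

definition row_space :: "('a \<Rightarrow> 'b \<Rightarrow> bool) \<Rightarrow> 'a set \<Rightarrow> 'b set \<Rightarrow> 'b set set" where
  "row_space E X C = (\<lambda>A. row_sum E A \<inter> C) ` Pow X"

definition row_kernel :: "('a \<Rightarrow> 'b \<Rightarrow> bool) \<Rightarrow> 'a set \<Rightarrow> 'b set \<Rightarrow> 'a set set" where
  "row_kernel E X C = {A. A \<subseteq> X \<and> row_sum E A \<inter> C = {}}"

definition independent_rows :: "('a \<Rightarrow> 'b \<Rightarrow> bool) \<Rightarrow> 'a set \<Rightarrow> 'b set \<Rightarrow> bool" where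
  "independent_rows E W C \<longleftrightarrow> row_kernel E W C = {{}}"

definition rank :: "('a \<Rightarrow> 'b \<Rightarrow> bool) \<Rightarrow> 'a set \<Rightarrow> 'b set \<Rightarrow> nat" where
  "rank E X C = Max (card ` {W. W \<subseteq> X \<and> independent_rows E W C})"

lemma row_sum_empty [simp]: "row_sum E {} = {}"
  by (simp add: row_sum_def)

lemma row_sum_singleton [simp]: "row_sum E {x} = {w. E x w}"
proof -
  have "{a \<in> {x}. E a w} = (if E x w then {x} else {})" for w by auto
  then show ?thesis by (auto simp: row_sum_def)
qed

lemma row_sum_sdiff:
  assumes "finite A" "finite B"
  shows "row_sum E (A \<ominus> B) = row_sum E A \<ominus> row_sum E B"
proof -
  have "{a \<in> A \<ominus> B. E a w} = {a \<in> A. E a w} \<ominus> {a \<in> B. E a w}" for w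
    by (auto simp: sdiff_def)
  then have "w \<in> row_sum E (A \<ominus> B) \<longleftrightarrow> (w \<in> row_sum E A) \<noteq> (w \<in> row_sum E B)" for w
    using assms by (simp add: row_sum_def odd_card_sdiff)
  then show ?thesis by (auto simp: sdiff_def)
qed

lemma row_sum_insert: "finite A \<Longrightarrow> x \<notin> A \<Longrightarrow> row_sum E (insert x A) = {w. E x w} \<ominus> row_sum E A"
  using row_sum_sdiff[of "{x}" A E] insert_eq_sdiff[of x A] by simp

lemma odd_card_Int_row_sum:
  assumes "finite S" "finite N"
  shows "odd (card (N \<inter> row_sum E S)) \<longleftrightarrow> odd (card (S \<inter> row_sum (\<lambda>w a. E a w) N))"
proof -
  have "(\<Sum>w\<in>N. card {a \<in> S. E a w}) = (\<Sum>a\<in>S. card {w \<in> N. E a w})"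
    unfolding card_eq_sum using assms by (intro sum.swap_restrict)
  then have "odd (card {w \<in> N. odd (card {a \<in> S. E a w})}) \<longleftrightarrow>
      odd (card {a \<in> S. odd (card {w \<in> N. E a w})})"
    using even_sum_iff[OF assms(2), of "\<lambda>w. card {a \<in> S. E a w}"]
      even_sum_iff[OF assms(1), of "\<lambda>a. card {w \<in> N. E a w}"] by simp
  moreover have "{w \<in> N. odd (card {a \<in> S. E a w})} = N \<inter> row_sum E S"
    "{a \<in> S. odd (card {w \<in> N. E a w})} = S \<inter> row_sum (\<lambda>w a. E a w) N"
    by (auto simp: row_sum_def)
  ultimately show ?thesis by simp
qed

lemma gf2_subspace_row_space:
  assumes "finite X"
  shows "gf2_subspace (row_space E X C)"
  unfolding gf2_subspace_def
proof (intro conjI ballI)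
  show "{} \<in> row_space E X C" unfolding row_space_def by (intro image_eqI[of _ _ "{}"]) auto
  fix a b assume "a \<in> row_space E X C" "b \<in> row_space E X C"
  then obtain A B where "A \<subseteq> X" "a = row_sum E A \<inter> C" "B \<subseteq> X" "b = row_sum E B \<inter> C"
    by (auto simp: row_space_def)
  moreover from this have "finite A" "finite B" using assms by (auto intro: finite_subset)
  ultimately show "a \<ominus> b \<in> row_space E X C"
    unfolding row_space_def
    by (intro image_eqI[of _ _ "A \<ominus> B"])
      (simp_all add: row_sum_sdiff sdiff_Int_distrib sdiff_subset)
qed

lemma row_space_subset_subspace:
  assumes "finite X" and M: "gf2_subspace M" and rows: "\<And>x. x \<in> X \<Longrightarrow> {w. E x w} \<inter> C \<in> M"
  shows "row_space E X C \<subseteq> M"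
proof -
  have "row_sum E A \<inter> C \<in> M" if "finite A" "A \<subseteq> X" for A
    using that
  proof (induction A)
    case empty
    show ?case using M by (simp add: gf2_subspace_def)
  next
    case (insert x A)
    then show ?case
      using M rows[of x] by (simp add: row_sum_insert sdiff_Int_distrib gf2_subspace_def)
  qed
  then show ?thesis using finite_subset[OF _ \<open>finite X\<close>] by (auto simp: row_space_def)
qed

lemma gf2_subspace_Int:
  assumes "gf2_subspace M"
  shows "gf2_subspace ((\<lambda>A. A \<inter> C) ` M)"
  unfolding gf2_subspace_def
proof (intro conjI ballI)
  show "{} \<in> (\<lambda>A. A \<inter> C) ` M" using assms by (force simp: gf2_subspace_def)
  fix a b assume "a \<in> (\<lambda>A. A \<inter> C) ` M" "b \<in> (\<lambda>A. A \<inter> C) ` M"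
  then obtain A B where AB: "A \<in> M" "a = A \<inter> C" "B \<in> M" "b = B \<inter> C" by blast
  then have "A \<ominus> B \<in> M" using assms by (simp add: gf2_subspace_def)
  then show "a \<ominus> b \<in> (\<lambda>A. A \<inter> C) ` M"
    unfolding AB sdiff_Int_distrib[symmetric] by (rule imageI)
qed

lemma gf2_subspace_extend:
  assumes "gf2_subspace M"
  shows "gf2_subspace (M \<union> (\<lambda>a. N \<ominus> a) ` M)"
  unfolding gf2_subspace_def
proof (intro conjI ballI)
  show "{} \<in> M \<union> (\<lambda>a. N \<ominus> a) ` M" using assms by (simp add: gf2_subspace_def)
  fix a b assume a: "a \<in> M \<union> (\<lambda>a. N \<ominus> a) ` M" and b: "b \<in> M \<union> (\<lambda>a. N \<ominus> a) ` M"
  obtain a' where a': "a' \<in> M" "a = a' \<or> a = N \<ominus> a'" using a by auto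
  obtain b' where b': "b' \<in> M" "b = b' \<or> b = N \<ominus> b'" using b by auto
  have "a \<ominus> b = a' \<ominus> b' \<or> a \<ominus> b = N \<ominus> (a' \<ominus> b')"
    using a'(2) b'(2) unfolding sdiff_def by blast
  moreover have "a' \<ominus> b' \<in> M" using assms a'(1) b'(1) by (simp add: gf2_subspace_def)
  ultimately show "a \<ominus> b \<in> M \<union> (\<lambda>a. N \<ominus> a) ` M" by auto
qed

lemma row_space_insert:
  assumes "finite X" "x \<notin> X"
  shows "row_space E (insert x X) C =
    row_space E X C \<union> (\<lambda>a. ({w. E x w} \<inter> C) \<ominus> a) ` row_space E X C"
proof -
  have "row_sum E (insert x A) \<inter> C = ({w. E x w} \<inter> C) \<ominus> (row_sum E A \<inter> C)" if "A \<subseteq> X" for A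
    using that assms by (subst row_sum_insert) (auto simp: sdiff_Int_distrib intro: finite_subset)
  then show ?thesis unfolding row_space_def Pow_insert image_Un image_image by simp
qed

lemma finite_row_kernel: "finite X \<Longrightarrow> finite (row_kernel E X C)"
  by (rule finite_subset[of _ "Pow X"]) (auto simp: row_kernel_def)

lemma finite_row_space: "finite X \<Longrightarrow> finite (row_space E X C)"
  by (simp add: row_space_def)

lemma sdiff_in_row_kernel:
  assumes "finite A" "finite B" "A \<subseteq> X" "B \<subseteq> X" "row_sum E A \<inter> C = row_sum E B \<inter> C"
  shows "A \<ominus> B \<in> row_kernel E X C"
  using assms by (simp add: row_kernel_def row_sum_sdiff sdiff_Int_distrib sdiff_subset)

lemma independent_rowsI:
  assumes "\<And>A. A \<subseteq> W \<Longrightarrow> row_sum E A \<inter> C = {} \<Longrightarrow> A = {}"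
  shows "independent_rows E W C"
  unfolding independent_rows_def row_kernel_def using assms by auto

lemma independent_rowsD:
  "independent_rows E W C \<Longrightarrow> A \<subseteq> W \<Longrightarrow> row_sum E A \<inter> C = {} \<Longrightarrow> A = {}"
  unfolding independent_rows_def row_kernel_def by blast

lemma independent_rows_mono:
  "independent_rows E W C \<Longrightarrow> W' \<subseteq> W \<Longrightarrow> C \<subseteq> D \<Longrightarrow> independent_rows E W' D"
  by (rule independent_rowsI) (blast dest: independent_rowsD)

lemma independent_rows_inj:
  assumes "finite W" "independent_rows E W C"
  shows "inj_on (\<lambda>A. row_sum E A \<inter> C) (Pow W)"
proof (rule inj_onI)
  fix A B assume "A \<in> Pow W" "B \<in> Pow W" "row_sum E A \<inter> C = row_sum E B \<inter> C"
  moreover from this have "finite A" "finite B" using assms(1) by (auto intro: finite_subset)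
  ultimately have "A \<ominus> B \<in> row_kernel E W C" by (intro sdiff_in_row_kernel) auto
  then show "A = B" using assms(2) by (simp add: independent_rows_def)
qed

subsection \<open>Rank\<close>

lemma card_le_rank:
  assumes "finite X" "W \<subseteq> X" "independent_rows E W C"
  shows "card W \<le> rank E X C"
  unfolding rank_def using assms by (intro Max_ge) auto

lemma row_basis:
  assumes "finite X"
  obtains W where "W \<subseteq> X" "independent_rows E W C" "card W = rank E X C"
    "row_space E W C = row_space E X C"
proof -
  let ?I = "{W. W \<subseteq> X \<and> independent_rows E W C}"
  have "{} \<in> ?I" by (auto intro: independent_rowsI)
  then have "rank E X C \<in> card ` ?I"
    unfolding rank_def using assms by (intro Max_in) auto
  then obtain W where W: "W \<subseteq> X" "independent_rows E W C" and card: "card W = rank E X C" by auto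
  have finW: "finite W" using W(1) assms by (rule finite_subset)
  have "{w. E x w} \<inter> C \<in> row_space E W C" if x: "x \<in> X" for x
  proof (cases "x \<in> W")
    case True
    then show ?thesis unfolding row_space_def by (intro image_eqI[of _ _ "{x}"]) auto
  next
    case False
    then have "card (insert x W) > rank E X C" using finW card by simp
    then have "\<not> independent_rows E (insert x W) C"
      using card_le_rank[OF assms, of "insert x W" E C] W(1) x by auto
    then obtain A where A: "A \<subseteq> insert x W" "row_sum E A \<inter> C = {}" "A \<noteq> {}"
      by (meson independent_rowsI)
    have "x \<in> A" using A W(2) by (metis independent_rowsD subset_insert)
    then have "row_sum E A = {w. E x w} \<ominus> row_sum E (A - {x})"
      using finite_subset[OF A(1)] finW row_sum_insert[of "A - {x}" x E]
      by (simp add: insert_absorb)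
    then have "{w. E x w} \<inter> C = row_sum E (A - {x}) \<inter> C" using A(2) by (simp add: sdiff_Int_distrib)
    then show ?thesis unfolding row_space_def using A(1) by (intro image_eqI[of _ _ "A - {x}"]) auto
  qed
  then have "row_space E X C \<subseteq> row_space E W C"
    by (intro row_space_subset_subspace assms gf2_subspace_row_space finW)
  moreover have "row_space E W C \<subseteq> row_space E X C"
    using W(1) unfolding row_space_def by (intro image_mono) auto
  ultimately show ?thesis using that W card by auto
qed

lemma card_row_space:
  assumes "finite X"
  shows "card (row_space E X C) = 2 ^ rank E X C"
proof -
  obtain W where W: "W \<subseteq> X" "independent_rows E W C" "card W = rank E X C"
    "row_space E W C = row_space E X C"
    by (rule row_basis[OF assms])
  have "finite W" using W(1) assms by (rule finite_subset)
  then have "card (row_space E W C) = 2 ^ card W"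
    unfolding row_space_def using independent_rows_inj[OF _ W(2)] by (simp add: card_image card_Pow)
  then show ?thesis using W(3,4) by simp
qed

lemma rank_le_card_subspace:
  assumes "finite X" "finite M" "gf2_subspace M" "\<And>x. x \<in> X \<Longrightarrow> {w. E x w} \<inter> C \<in> M"
  shows "2 ^ rank E X C \<le> card M"
  using card_mono[OF assms(2) row_space_subset_subspace[OF assms(1,3,4)]]
  by (simp add: card_row_space[OF assms(1)])

lemma bij_betw_row_kernel_times_Pow:
  assumes "finite X" and W: "W \<subseteq> X" "independent_rows E W C" "row_space E W C = row_space E X C"
  shows "bij_betw (\<lambda>(K, S). K \<ominus> S) (row_kernel E X C \<times> Pow W) (Pow X)"
proof -
  let ?f = "\<lambda>(K, S). K \<ominus> S"
  have fin: "finite A" if "A \<subseteq> X" for A using that assms(1) by (rule finite_subset)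
  show ?thesis
  proof (intro bij_betwI' ballI)
    fix p q assume "p \<in> row_kernel E X C \<times> Pow W" "q \<in> row_kernel E X C \<times> Pow W"
    then obtain K S L T where KS: "p = (K, S)" "K \<subseteq> X" "row_sum E K \<inter> C = {}" "S \<subseteq> W"
      and LT: "q = (L, T)" "L \<subseteq> X" "row_sum E L \<inter> C = {}" "T \<subseteq> W"
      by (auto simp: row_kernel_def)
    have "p = q" if "K \<ominus> S = L \<ominus> T"
    proof -
      have "row_sum E (S \<ominus> T) \<inter> C = {}"
        unfolding sdiff_exchange[OF that, symmetric]
        using KS(2,3) LT(2,3) by (simp add: row_sum_sdiff fin sdiff_Int_distrib)
      from independent_rowsD[OF W(2) sdiff_subset[OF KS(4) LT(4)] this] have "S = T" by simp
      then show ?thesis using that KS(1) LT(1) by simp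
    qed
    then show "(?f p = ?f q) = (p = q)" unfolding KS(1) LT(1) by auto
  next
    fix p assume "p \<in> row_kernel E X C \<times> Pow W"
    then obtain K S where "p = (K, S)" "K \<subseteq> X" "S \<subseteq> X" using W(1) by (auto simp: row_kernel_def)
    then show "?f p \<in> Pow X" by (simp add: sdiff_subset)
  next
    fix A assume A: "A \<in> Pow X"
    then have "row_sum E A \<inter> C \<in> row_space E X C" unfolding row_space_def by (rule imageI)
    then have "row_sum E A \<inter> C \<in> row_space E W C" unfolding W(3) .
    then obtain S where S: "S \<subseteq> W" "row_sum E A \<inter> C = row_sum E S \<inter> C"
      unfolding row_space_def by blast
    then have "A \<ominus> S \<in> row_kernel E X C" using A W(1) fin by (intro sdiff_in_row_kernel) auto
    moreover have "(A \<ominus> S) \<ominus> S = A" by (auto simp: sdiff_def)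
    ultimately show "\<exists>p\<in>row_kernel E X C \<times> Pow W. A = ?f p"
      using S(1) by (intro bexI[of _ "(A \<ominus> S, S)"]) auto
  qed
qed

lemma card_row_kernel:
  assumes "finite X"
  shows "card (row_kernel E X C) * 2 ^ rank E X C = 2 ^ card X"
proof -
  obtain W where W: "W \<subseteq> X" "independent_rows E W C" "card W = rank E X C"
    "row_space E W C = row_space E X C"
    by (rule row_basis[OF assms])
  have "card (row_kernel E X C \<times> Pow W) = card (Pow X)"
    using bij_betw_row_kernel_times_Pow[OF assms W(1,2,4)] by (rule bij_betw_same_card)
  then show ?thesis
    using finite_subset[OF W(1) assms] W(3) by (simp add: card_cartesian_product card_Pow assms)
qed

lemma rank_mono:
  assumes "finite Y" "X \<subseteq> Y" "C \<subseteq> D"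
  shows "rank E X C \<le> rank E Y D"
proof -
  obtain W where W: "W \<subseteq> X" "independent_rows E W C" "card W = rank E X C"
    "row_space E W C = row_space E X C"
    by (rule row_basis[OF finite_subset[OF assms(2,1)]])
  have "independent_rows E W D" by (rule independent_rows_mono[OF W(2) order_refl assms(3)])
  then show ?thesis using card_le_rank[OF assms(1), of W E D] W(1,3) assms(2) by simp
qed

lemma rank_le_card_rows:
  assumes "finite X"
  shows "rank E X C \<le> card X"
proof -
  obtain W where W: "W \<subseteq> X" "independent_rows E W C" "card W = rank E X C"
    "row_space E W C = row_space E X C"
    by (rule row_basis[OF assms])
  then show ?thesis using card_mono[OF assms W(1)] by simp
qed

lemma rank_independent_rows:
  assumes "finite W" "independent_rows E W C"
  shows "rank E W C = card W"
  using rank_le_card_rows[OF assms(1)] card_le_rank[OF assms(1) order_refl assms(2)]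
  by (rule antisym)

lemma sdiff_row_kernels:
  assumes "finite X" "finite Y" and A: "A \<in> row_kernel E X C" and B: "B \<in> row_kernel E Y D"
  shows "A \<ominus> B \<in> row_kernel E (X \<union> Y) (C \<inter> D)"
proof -
  have "finite A" "finite B" using A B assms(1,2) finite_subset by (auto simp: row_kernel_def)
  then have "row_sum E (A \<ominus> B) = row_sum E A \<ominus> row_sum E B" by (rule row_sum_sdiff)
  then have "row_sum E (A \<ominus> B) \<inter> (C \<inter> D) = {}" using A B by (auto simp: row_kernel_def sdiff_def)
  then show ?thesis using A B sdiff_subset[of A "X \<union> Y" B] by (auto simp: row_kernel_def)
qed

lemma sdiff_row_kernels_fibre:
  assumes "finite X" "finite Y" and "A \<in> row_kernel E X C" "B \<in> row_kernel E Y D"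
    and "A' \<in> row_kernel E X C" "B' \<in> row_kernel E Y D" and eq: "A \<ominus> B = A' \<ominus> B'"
  shows "A \<ominus> A' \<in> row_kernel E (X \<inter> Y) (C \<union> D)"
proof -
  have "A \<ominus> A' \<in> row_kernel E X C" using sdiff_row_kernels[OF assms(1,1,3,5)] by simp
  moreover have "B \<ominus> B' \<in> row_kernel E Y D" using sdiff_row_kernels[OF assms(2,2,4,6)] by simp
  ultimately show ?thesis unfolding sdiff_exchange[OF eq, symmetric] by (auto simp: row_kernel_def)
qed

text \<open>Up to translation, the fibres of \<open>(A, B) \<mapsto> A \<ominus> B\<close> on pairs of kernel elements embed into
  \<open>row_kernel E (X \<inter> Y) (C \<union> D)\<close>.\<close>

lemma row_kernel_submodular:
  assumes fin: "finite X" "finite Y"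
  shows "card (row_kernel E X C) * card (row_kernel E Y D) \<le>
    card (row_kernel E (X \<inter> Y) (C \<union> D)) * card (row_kernel E (X \<union> Y) (C \<inter> D))"
proof -
  let ?S = "row_kernel E X C \<times> row_kernel E Y D" and ?f = "\<lambda>(A, B). A \<ominus> B"
  let ?I = "row_kernel E (X \<inter> Y) (C \<union> D)" and ?U = "row_kernel E (X \<union> Y) (C \<inter> D)"
  have "?f \<in> ?S \<rightarrow> ?U" using sdiff_row_kernels[OF fin] by auto
  moreover have "{} \<in> ?U" by (simp add: row_kernel_def)
  ultimately obtain y where fibre: "card ?S \<le> card (?f -` {y} \<inter> ?S) * card ?U"
    using pigeonhole_card[of ?f ?S ?U] fin by (auto simp: finite_row_kernel)
  have "card (?f -` {y} \<inter> ?S) \<le> card ?I"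
  proof (cases "?f -` {y} \<inter> ?S = {}")
    case False
    then obtain A0 B0 where base: "A0 \<in> row_kernel E X C" "B0 \<in> row_kernel E Y D" "A0 \<ominus> B0 = y"
      by auto
    have "(\<lambda>(A, B). A \<ominus> A0) ` (?f -` {y} \<inter> ?S) \<subseteq> ?I"
      using sdiff_row_kernels_fibre[OF fin _ _ base(1,2)] base(3) by auto
    moreover have "inj_on (\<lambda>(A, B). A \<ominus> A0) (?f -` {y} \<inter> ?S)"
      by (rule inj_onI) (auto split: prod.splits)
    ultimately show ?thesis using fin by (intro card_inj_on_le) (auto simp: finite_row_kernel)
  qed simp
  then have "card (?f -` {y} \<inter> ?S) * card ?U \<le> card ?I * card ?U" by (rule mult_le_mono1)
  from order_trans[OF fibre this] show ?thesis by (simp add: card_cartesian_product)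
qed

lemma rank_submodular:
  assumes fin: "finite X" "finite Y"
  shows "rank E (X \<union> Y) (C \<inter> D) + rank E (X \<inter> Y) (C \<union> D) \<le> rank E X C + rank E Y D"
proof -
  let ?k = "\<lambda>X C. card (row_kernel E X C)" and ?r = "rank E"
  define before where "before = ?k X C * ?k Y D"
  define after where "after = ?k (X \<inter> Y) (C \<union> D) * ?k (X \<union> Y) (C \<inter> D)"
  let ?s = "?r X C + ?r Y D" and ?t = "?r (X \<union> Y) (C \<inter> D) + ?r (X \<inter> Y) (C \<union> D)"
  have "before * 2 ^ ?s = (?k X C * 2 ^ ?r X C) * (?k Y D * 2 ^ ?r Y D)"
    by (simp only: before_def power_add mult_ac)
  also have "\<dots> = 2 ^ (card X + card Y)" using fin by (simp add: card_row_kernel power_add)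
  finally have total: "before * 2 ^ ?s = 2 ^ (card X + card Y)" .
  have "before * 2 ^ ?t \<le> after * 2 ^ ?t"
    unfolding before_def after_def using row_kernel_submodular[OF fin] by (rule mult_le_mono1)
  also have "\<dots> = (?k (X \<union> Y) (C \<inter> D) * 2 ^ ?r (X \<union> Y) (C \<inter> D)) *
      (?k (X \<inter> Y) (C \<union> D) * 2 ^ ?r (X \<inter> Y) (C \<union> D))"
    by (simp only: after_def power_add mult_ac)
  also have "\<dots> = 2 ^ (card (X \<union> Y) + card (X \<inter> Y))"
    using fin by (simp add: card_row_kernel power_add)
  also have "\<dots> = before * 2 ^ ?s" unfolding total using card_Un_Int[OF fin] by simp
  finally have "before * 2 ^ ?t \<le> before * 2 ^ ?s" .
  moreover have "before \<noteq> 0"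
  proof
    assume "before = 0"
    with total show False by simp
  qed
  ultimately show ?thesis by simp
qed

lemma rank_Un_columns_le: "finite X \<Longrightarrow> rank E X (C \<union> D) \<le> rank E X C + rank E X D"
  using rank_submodular[of X X E C D] by simp

text \<open>So a sum of columns is determined by its restriction to a row basis \<open>W\<close>.\<close>

lemma column_sum_mem_iff:
  assumes fin: "finite W" "finite C" and W: "row_space E W C = row_space E X C" and x: "x \<in> X"
  obtains S where "S \<subseteq> W"
    "\<forall>N\<subseteq>C. x \<in> row_sum (\<lambda>w x. E x w) N \<longleftrightarrow> odd (card (S \<inter> row_sum (\<lambda>w x. E x w) N))"
proof -
  have "row_sum E {x} \<inter> C \<in> row_space E X C" using x unfolding row_space_def by blast
  then have "{w. E x w} \<inter> C \<in> row_space E W C" unfolding W by simp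
  then obtain S where S: "S \<subseteq> W" "{w. E x w} \<inter> C = row_sum E S \<inter> C"
    unfolding row_space_def by blast
  have "x \<in> row_sum (\<lambda>w x. E x w) N \<longleftrightarrow> odd (card (S \<inter> row_sum (\<lambda>w x. E x w) N))" if N: "N \<subseteq> C" for N
  proof -
    have "{w \<in> N. E x w} = N \<inter> row_sum E S" using N S(2) by auto
    moreover have "finite S" "finite N" using S(1) N fin by (auto intro: finite_subset)
    ultimately show ?thesis using odd_card_Int_row_sum[of S N E] by (simp add: row_sum_def)
  qed
  then show ?thesis using that S(1) by blast
qed

lemma rank_transpose_le:
  assumes fin: "finite X" "finite C"
  shows "rank (\<lambda>w x. E x w) C X \<le> rank E X C"
proof -
  let ?sum = "row_sum (\<lambda>w x. E x w)" and ?columns = "row_space (\<lambda>w x. E x w) C X"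
  obtain W where W: "W \<subseteq> X" "independent_rows E W C" "card W = rank E X C"
    "row_space E W C = row_space E X C"
    by (rule row_basis[OF fin(1)])
  have finW: "finite W" using W(1) fin(1) by (rule finite_subset)
  have "inj_on (\<lambda>y. y \<inter> W) ?columns"
  proof (rule inj_onI)
    fix y z assume "y \<in> ?columns" "z \<in> ?columns" and eq: "y \<inter> W = z \<inter> W"
    then obtain N N' where N: "N \<subseteq> C" "y = ?sum N \<inter> X" and N': "N' \<subseteq> C" "z = ?sum N' \<inter> X"
      unfolding row_space_def by blast
    have "x \<in> ?sum N \<longleftrightarrow> x \<in> ?sum N'" if x: "x \<in> X" for x
    proof -
      obtain S where S: "S \<subseteq> W" "\<forall>N\<subseteq>C. x \<in> ?sum N \<longleftrightarrow> odd (card (S \<inter> ?sum N))"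
        by (rule column_sum_mem_iff[OF finW fin(2) W(4) x])
      have "S \<inter> ?sum N = S \<inter> ?sum N'" using eq S(1) W(1) unfolding N(2) N'(2) by blast
      then show ?thesis using S(2) N(1) N'(1) by simp
    qed
    then show "y = z" unfolding N(2) N'(2) by blast
  qed
  moreover have "(\<lambda>y. y \<inter> W) ` ?columns \<subseteq> Pow W" by auto
  ultimately have "card ?columns \<le> card (Pow W)" using finW by (intro card_inj_on_le) auto
  then show ?thesis using finW W(3) by (simp add: card_row_space[OF fin(2)] card_Pow)
qed

lemma rank_transpose:
  "finite X \<Longrightarrow> finite C \<Longrightarrow> rank (\<lambda>w x. E x w) C X = rank E X C"
  using rank_transpose_le[of X C E] rank_transpose_le[of C X "\<lambda>w x. E x w"] by simp

subsection \<open>Splitting a set of low cut-rank\<close>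

definition cut_rank :: "('a \<Rightarrow> 'a \<Rightarrow> bool) \<Rightarrow> 'a set \<Rightarrow> 'a set \<Rightarrow> nat" where
  "cut_rank E V X = rank E X (V - X)"

definition low_rank_split :: "('a \<Rightarrow> 'a \<Rightarrow> bool) \<Rightarrow> 'a set \<Rightarrow> nat \<Rightarrow> 'a set \<Rightarrow> 'a set \<Rightarrow> bool" where
  "low_rank_split E V r Z X \<longleftrightarrow> X \<noteq> {} \<and> X \<subset> Z \<and> cut_rank E V X \<le> r \<and> cut_rank E V (Z - X) \<le> r"

lemma low_rank_splitD:
  assumes "low_rank_split E V r Z X"
  shows "X \<noteq> {}" "X \<subset> Z" "cut_rank E V X \<le> r"
    and "Z - X \<noteq> {}" "Z - X \<subset> Z" "cut_rank E V (Z - X) \<le> r"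
  using assms unfolding low_rank_split_def by blast+

lemma cut_rank_compl:
  assumes "finite V" "symp E" "X \<subseteq> V"
  shows "cut_rank E V (V - X) = cut_rank E V X"
proof -
  have "(\<lambda>w x. E x w) = E" using assms(2) by (auto simp: symp_def fun_eq_iff)
  moreover have "V - (V - X) = X" using assms(3) by auto
  ultimately show ?thesis
    using rank_transpose[of X "V - X" E] finite_subset[OF assms(3,1)] assms(1)
    by (simp add: cut_rank_def)
qed

lemma cut_rank_le_card: "finite X \<Longrightarrow> cut_rank E V X \<le> card X"
  unfolding cut_rank_def by (rule rank_le_card_rows)

lemma cut_rank_submodular:
  assumes "finite V" "X \<subseteq> V" "Y \<subseteq> V"
  shows "cut_rank E V (X \<union> Y) + cut_rank E V (X \<inter> Y) \<le> cut_rank E V X + cut_rank E V Y"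
  using rank_submodular[OF finite_subset[OF assms(2,1)] finite_subset[OF assms(3,1)],
      of E "V - X" "V - Y"]
  by (simp add: cut_rank_def Diff_Un Diff_Int)

lemma cut_rank_Un_ge:
  assumes fin: "finite V" and sub: "Z \<subseteq> V" "U \<subseteq> V" and E: "symp E"
    and W: "W \<subseteq> Z" "independent_rows E W (V - Z)"
  shows "card (W - U) \<le> cut_rank E V (Z \<union> U) + cut_rank E V U"
proof -
  have finites: "finite W" "finite (V - U)" "finite (Z \<union> U)"
    using fin sub W(1) by (auto intro: finite_subset)
  have "independent_rows E (W - U) (V - Z)" by (rule independent_rows_mono[OF W(2)]) auto
  then have "card (W - U) = rank E (W - U) (V - Z)"
    using finites(1) by (simp add: rank_independent_rows)
  also have "\<dots> \<le> rank E (W - U) ((V - (Z \<union> U)) \<union> U)" using finites(1) by (intro rank_mono) auto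
  also have "\<dots> \<le> rank E (W - U) (V - (Z \<union> U)) + rank E (W - U) U"
    using finites(1) by (intro rank_Un_columns_le) simp
  also have "rank E (W - U) (V - (Z \<union> U)) \<le> cut_rank E V (Z \<union> U)"
    unfolding cut_rank_def using W(1) by (intro rank_mono finites) auto
  also have "rank E (W - U) U \<le> cut_rank E V (V - U)"
    unfolding cut_rank_def using W(1) sub by (intro rank_mono finites) auto
  finally show ?thesis using cut_rank_compl[OF fin E sub(2)] by simp
qed

lemma cut_rank_Int_le:
  assumes "finite V" "Z \<subseteq> V" "U \<subseteq> V" "symp E" "W \<subseteq> Z" "independent_rows E W (V - Z)"
  shows "cut_rank E V (Z \<inter> U) + card (W - U) \<le> cut_rank E V Z + 2 * cut_rank E V U"
  using cut_rank_submodular[OF assms(1-3), of E] cut_rank_Un_ge[OF assms] by linarith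

text \<open>If \<open>Z\<close> has cut-rank \<open>6 * c\<close>, then a balanced cut leaves at least \<open>2 * c\<close> elements of a row basis
  on either side, which pays for the term \<open>2 * cut_rank E V U\<close> in \<open>cut_rank_Int_le\<close>.\<close>

lemma exists_low_rank_split:
  assumes V: "finite V" "symp E" and c_pos: "1 \<le> c"
    and balanced: "\<And>W. W \<subseteq> V \<Longrightarrow> 2 * c \<le> card W \<Longrightarrow>
      \<exists>U\<subseteq>V. 2 * c \<le> card (W \<inter> U) \<and> card (W \<inter> U) < 4 * c \<and> cut_rank E V U \<le> c"
    and Z: "Z \<subseteq> V" "2 \<le> card Z" "cut_rank E V Z \<le> 6 * c"
  shows "\<exists>X. low_rank_split E V (6 * c) Z X"
proof (cases "cut_rank E V Z = 6 * c")
  case True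
  obtain W where W: "W \<subseteq> Z" "independent_rows E W (V - Z)" and "card W = rank E Z (V - Z)"
    "row_space E W (V - Z) = row_space E Z (V - Z)"
    by (rule row_basis[OF finite_subset[OF Z(1) V(1)]])
  then have card_W: "card W = 6 * c" using True by (simp add: cut_rank_def)
  moreover have "W \<subseteq> V" using W(1) Z(1) by simp
  ultimately obtain U where U: "U \<subseteq> V" "2 * c \<le> card (W \<inter> U)" "card (W \<inter> U) < 4 * c"
    "cut_rank E V U \<le> c"
    using balanced[of W] by auto
  have "finite W" using card_W c_pos by (intro card_ge_0_finite) simp
  then have outside: "2 * c \<le> card (W - U)" using card_Int_Diff[of W U] card_W U(3) by simp
  have "W - (V - U) = W \<inter> U" "Z - Z \<inter> U = Z \<inter> (V - U)" using \<open>W \<subseteq> V\<close> Z(1) by auto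
  then have "cut_rank E V (Z \<inter> U) \<le> 6 * c" "cut_rank E V (Z - Z \<inter> U) \<le> 6 * c"
    using cut_rank_Int_le[OF V(1) Z(1) U(1) V(2) W] outside U(2,4) Z(3)
      cut_rank_Int_le[OF V(1) Z(1) Diff_subset V(2) W, of U] cut_rank_compl[OF V U(1)] by simp_all
  moreover have "W \<inter> U \<noteq> {}" "W - U \<noteq> {}" using U(2) outside c_pos by force+
  ultimately show ?thesis unfolding low_rank_split_def using W(1) by (intro exI[of _ "Z \<inter> U"]) auto
next
  case False
  obtain v where v: "v \<in> Z" using Z(2) by fastforce
  have "{v} \<subseteq> V" using v Z(1) by auto
  then have "cut_rank E V (V - {v}) \<le> 1"
    using cut_rank_compl[OF V, of "{v}"] cut_rank_le_card[of "{v}" E V] by simp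
  moreover have "Z \<inter> (V - {v}) = Z - {v}" using Z(1) by auto
  ultimately have "cut_rank E V (Z - {v}) \<le> 6 * c"
    using cut_rank_submodular[OF V(1) Z(1) Diff_subset, of E "{v}"] False Z(3) by simp
  moreover have "cut_rank E V {v} \<le> 6 * c" using cut_rank_le_card[of "{v}" E V] c_pos by simp
  moreover have "Z \<noteq> {v}" using Z(2) by auto
  ultimately show ?thesis unfolding low_rank_split_def using v by (intro exI[of _ "{v}"]) auto
qed

lemma cut_rank_le_classes:
  assumes "finite U" and classes: "\<And>u. u \<in> U \<Longrightarrow> l u < (c::nat)"
    and same: "\<And>x y w. x \<in> U \<Longrightarrow> y \<in> U \<Longrightarrow> l x = l y \<Longrightarrow> w \<in> V - U \<Longrightarrow> E x w \<longleftrightarrow> E y w"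
  shows "cut_rank E V U \<le> c"
proof -
  obtain W where W: "W \<subseteq> U" "independent_rows E W (V - U)" "card W = rank E U (V - U)"
    "row_space E W (V - U) = row_space E U (V - U)"
    by (rule row_basis[OF assms(1)])
  have "inj_on l W"
  proof (rule inj_onI)
    fix x y assume xy: "x \<in> W" "y \<in> W" "l x = l y"
    then have "row_sum E {x} \<inter> (V - U) = row_sum E {y} \<inter> (V - U)"
      using same[of x y] W(1) by auto
    from inj_onD[OF independent_rows_inj[OF finite_subset[OF W(1) assms(1)] W(2)] this]
    have "{x} = {y}" using xy(1,2) by simp
    then show "x = y" by simp
  qed
  moreover have "l ` W \<subseteq> {..<c}" using W(1) classes by auto
  ultimately have "card W \<le> c" using card_inj_on_le[of l W "{..<c}"] by simp
  then show ?thesis by (simp add: cut_rank_def W(3))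
qed

section \<open>Separations from clique-width\<close>

lemma cw_constructible_wf:
  assumes "cw_constructible c G lab"
  shows "finite (pverts G)" "\<And>v. v \<in> pverts G \<Longrightarrow> lab v < c" "parcs G \<subseteq> pverts G \<times> pverts G"
  using assms by (induction) auto

lemma cw_constructible_mono: "cw_constructible c G lab \<Longrightarrow> c \<le> d \<Longrightarrow> cw_constructible d G lab"
  by (induction rule: cw_constructible.induct) 
    (auto intro: cw_constructible.intros(2-4) cw_constructible.create[OF _ refl])

text \<open>The vertices of an intermediate graph of a construction are distinguished by the rest of the
  graph only through their labels. The condition on \<open>lab\<close> keeps this invariant under later
  operations.\<close>

definition label_cut :: "nat \<Rightarrow> 'a pair_pre_digraph \<Rightarrow> ('a \<Rightarrow> nat) \<Rightarrow> 'a set \<Rightarrow> bool" where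
  "label_cut c G lab U \<longleftrightarrow> U \<subseteq> pverts G \<and> (\<exists>l. (\<forall>u\<in>U. l u < c) \<and>
     (\<forall>x\<in>U. \<forall>y\<in>U. l x = l y \<longrightarrow> lab x = lab y \<and>
       (\<forall>w\<in>pverts G - U. (x, w) \<in> parcs G \<longleftrightarrow> (y, w) \<in> parcs G)))"

lemma label_cut_pverts:
  assumes "cw_constructible c G lab"
  shows "label_cut c G lab (pverts G)"
  unfolding label_cut_def using cw_constructible_wf(2)[OF assms] by auto

lemma label_cut_extend:
  assumes "label_cut c G lab U" "pverts G \<subseteq> pverts H"
    and lab: "\<And>x y. x \<in> U \<Longrightarrow> y \<in> U \<Longrightarrow> lab x = lab y \<Longrightarrow> lab' x = lab' y"
    and arcs: "\<And>x y w. x \<in> U \<Longrightarrow> y \<in> U \<Longrightarrow> lab x = lab y \<Longrightarrow> w \<in> pverts H - U \<Longrightarrow>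
      (w \<in> pverts G \<Longrightarrow> (x, w) \<in> parcs G \<longleftrightarrow> (y, w) \<in> parcs G) \<Longrightarrow>
      (x, w) \<in> parcs H \<longleftrightarrow> (y, w) \<in> parcs H"
  shows "label_cut c H lab' U"
proof -
  obtain l where l: "\<forall>u\<in>U. l u < c" "\<And>x y. x \<in> U \<Longrightarrow> y \<in> U \<Longrightarrow> l x = l y \<Longrightarrow> lab x = lab y \<and>
      (\<forall>w\<in>pverts G - U. (x, w) \<in> parcs G \<longleftrightarrow> (y, w) \<in> parcs G)"
    using assms(1) unfolding label_cut_def by blast
  have "lab' x = lab' y \<and> (\<forall>w\<in>pverts H - U. (x, w) \<in> parcs H \<longleftrightarrow> (y, w) \<in> parcs H)"
    if xy: "x \<in> U" "y \<in> U" "l x = l y" for x y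
    using l(2)[OF xy] by (intro conjI ballI lab[OF xy(1,2)] arcs[OF xy(1,2)]) blast+
  moreover have "U \<subseteq> pverts H" using assms(1,2) by (auto simp: label_cut_def)
  ultimately show ?thesis unfolding label_cut_def using l(1) by blast
qed

lemma label_cut_disjoint_union:
  assumes "cw_constructible c G lab" "cw_constructible c H lab'" "pverts G \<inter> pverts H = {}"
    and "label_cut c G lab U \<or> label_cut c H lab' U"
  shows "label_cut c \<lparr>pverts = pverts G \<union> pverts H, parcs = parcs G \<union> parcs H\<rparr>
    (\<lambda>v. if v \<in> pverts G then lab v else lab' v) U"
proof -
  have arcs: "(x, w) \<in> parcs G \<Longrightarrow> x \<in> pverts G \<and> w \<in> pverts G"
    "(x, w) \<in> parcs H \<Longrightarrow> x \<in> pverts H \<and> w \<in> pverts H" for x w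
    using cw_constructible_wf(3)[OF assms(1)] cw_constructible_wf(3)[OF assms(2)] by auto
  from assms(4) show ?thesis
  proof
    assume U: "label_cut c G lab U"
    then have "U \<subseteq> pverts G" by (simp add: label_cut_def)
    then show ?thesis
      by (intro label_cut_extend[OF U]) (use assms(3) arcs in \<open>auto 4 4\<close>)
  next
    assume U: "label_cut c H lab' U"
    then have "U \<subseteq> pverts H" by (simp add: label_cut_def)
    then show ?thesis
      by (intro label_cut_extend[OF U]) (use assms(3) arcs in \<open>auto 4 4\<close>)
  qed
qed

lemma label_cut_join:
  assumes "label_cut c G lab U"
  shows "label_cut c \<lparr>pverts = pverts G, parcs = parcs G \<union> {(v, w). v \<in> pverts G \<and> w \<in> pverts G \<and>
    (lab v = i \<and> lab w = j \<or> lab v = j \<and> lab w = i)}\<rparr> lab U"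
proof -
  have "U \<subseteq> pverts G" using assms by (simp add: label_cut_def)
  then show ?thesis by (intro label_cut_extend[OF assms]) auto
qed

lemma label_cut_rename:
  assumes "label_cut c G lab U"
  shows "label_cut c G (\<lambda>v. if lab v = i then j else lab v) U"
  by (rule label_cut_extend[OF assms]) auto

text \<open>Descend towards the part that is heavier in \<open>W\<close> until its weight drops below \<open>2 * s\<close>.\<close>

lemma cw_constructible_balanced_cut:
  assumes "cw_constructible c G lab" "1 \<le> s" "s \<le> card (W \<inter> pverts G)"
  shows "\<exists>U. label_cut c G lab U \<and> s \<le> card (W \<inter> U) \<and> card (W \<inter> U) < 2 * s"
  using assms(1,3)
proof induction
  case (create i lab v)
  have "card (W \<inter> {v}) \<le> card {v}" by (intro card_mono) auto
  moreover have "label_cut c \<lparr>pverts = {v}, parcs = {}\<rparr> lab {v}"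
    using create.hyps by (auto simp: label_cut_def)
  ultimately show ?case using create.prems assms(2) by (intro exI[of _ "{v}"]) auto
next
  case (disjoint_union G lab H lab')
  note union = label_cut_disjoint_union[OF disjoint_union.hyps]
  consider "s \<le> card (W \<inter> pverts G)" | "s \<le> card (W \<inter> pverts H)"
    | "card (W \<inter> pverts G) < s" "card (W \<inter> pverts H) < s"
    by linarith
  then show ?case
  proof cases
    case 3
    have "card (W \<inter> (pverts G \<union> pverts H)) \<le> card (W \<inter> pverts G) + card (W \<inter> pverts H)"
      unfolding Int_Un_distrib by (rule card_Un_le)
    moreover note label_cut_pverts[OF cw_constructible.disjoint_union[OF disjoint_union.hyps]]
    ultimately show ?thesis
      using 3 disjoint_union.prems by (intro exI[of _ "pverts G \<union> pverts H"]) simp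
  qed (use disjoint_union.IH union in blast)+
next
  case (join G lab i j)
  then show ?case using label_cut_join[of c G lab _ i j] by auto
next
  case (rename G lab i j)
  then show ?case using label_cut_rename by blast
qed

lemma cw_constructible_edgeless:
  "Suc m \<le> c \<Longrightarrow> cw_constructible c \<lparr>pverts = {..<Suc m}, parcs = {}\<rparr> (\<lambda>v. v)"
proof (induction m)
  case 0
  have "cw_constructible c \<lparr>pverts = {0::nat}, parcs = {}\<rparr> (\<lambda>v. v)"
    using 0 by (intro cw_constructible.create) auto
  then show ?case by (simp add: lessThan_Suc)
next
  case (Suc m)
  have new: "cw_constructible c \<lparr>pverts = {Suc m}, parcs = {}\<rparr> (\<lambda>v. v)"
    using Suc.prems by (intro cw_constructible.create) auto
  have old: "cw_constructible c \<lparr>pverts = {..<Suc m}, parcs = {}\<rparr> (\<lambda>v. v)"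
    using Suc by simp
  have "{..<Suc m} \<union> {Suc m} = {..<Suc (Suc m)}" by auto
  then show ?case using cw_constructible.disjoint_union[OF old new] by simp
qed

lemma input_graph_verts: "input_graph G \<Longrightarrow> pverts G = {..<card (pverts G)}"
  unfolding input_graph_def by (metis card_lessThan)

lemma input_graph_finite: "input_graph G \<Longrightarrow> finite (pverts G)"
  by (subst input_graph_verts) simp_all

lemma input_graph_sym:
  assumes "input_graph G"
  shows "(v, w) \<in> parcs G \<longleftrightarrow> (w, v) \<in> parcs G"
proof -
  interpret pair_graph G using assms unfolding input_graph_def by simp
  show ?thesis using pair_sym_arcs unfolding symmetric_def sym_def by auto
qed

lemma input_graph_arcs:
  assumes "input_graph G" "(v, w) \<in> parcs G"
  shows "v \<in> pverts G" "w \<in> pverts G" "v \<noteq> w"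
proof -
  interpret pair_graph G using assms(1) unfolding input_graph_def by simp
  show "v \<in> pverts G" "w \<in> pverts G" "v \<noteq> w"
    using arc_fst_in_verts[OF assms(2)] arc_snd_in_verts[OF assms(2)] pair_no_loops[OF assms(2)]
    by auto
qed

text \<open>With a label of its own for every vertex, the edges can be added one by one.\<close>

lemma input_graph_cw_constructible:
  assumes G: "input_graph G" and "pverts G \<noteq> {}"
  shows "\<exists>c lab. cw_constructible c G lab"
proof -
  define n where "n = card (pverts G)"
  have verts: "pverts G = {..<n}" unfolding n_def by (rule input_graph_verts[OF G])
  have add_arcs: "cw_constructible n \<lparr>pverts = {..<n}, parcs = F \<union> F\<inverse>\<rparr> (\<lambda>v. v)"
    if "finite F" "F \<subseteq> parcs G" for F
    using that
  proof (induction F)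
    case empty
    have "0 < n" using verts assms(2) by auto
    then show ?case using cw_constructible_edgeless[of "n - 1" n] by simp
  next
    case (insert arc F)
    obtain i j where arc: "arc = (i, j)" by (cases arc)
    have ends: "i < n" "j < n" "i \<noteq> j"
      using input_graph_arcs[OF G, of i j] insert.prems verts arc by auto
    have "cw_constructible n \<lparr>pverts = {..<n}, parcs = F \<union> F\<inverse>\<rparr> (\<lambda>v. v)" using insert by simp
    from cw_constructible.join[OF this ends]
    have "cw_constructible n \<lparr>pverts = {..<n}, parcs = (F \<union> F\<inverse>) \<union>
      {(v, w). v < n \<and> w < n \<and> (v = i \<and> w = j \<or> v = j \<and> w = i)}\<rparr> (\<lambda>v. v)" by simp
    moreover have "(F \<union> F\<inverse>) \<union> {(v, w). v < n \<and> w < n \<and> (v = i \<and> w = j \<or> v = j \<and> w = i)} =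
      insert arc F \<union> (insert arc F)\<inverse>" using ends by (auto simp: arc)
    ultimately show ?case by simp
  qed
  have "parcs G \<subseteq> pverts G \<times> pverts G" using input_graph_arcs[OF G] by auto
  then have "finite (parcs G)" using finite_subset input_graph_finite[OF G] by blast
  moreover have "parcs G \<union> (parcs G)\<inverse> = parcs G" using input_graph_sym[OF G] by auto
  ultimately have "cw_constructible n G (\<lambda>v. v)"
    using add_arcs[of "parcs G"] by (cases G) (simp flip: verts)
  then show ?thesis by blast
qed

lemma clique_width_le_imp_constructible:
  assumes "input_graph G" "pverts G \<noteq> {}" "clique_width G \<le> c"
  shows "\<exists>lab. cw_constructible c G lab"
proof -
  have "\<exists>lab. cw_constructible (clique_width G) G lab"
    using input_graph_cw_constructible[OF assms(1,2)] assms(2)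
      LeastI_ex[of "\<lambda>c. \<exists>lab. cw_constructible c G lab"]
    unfolding clique_width_def by simp
  then show ?thesis using cw_constructible_mono[OF _ assms(3)] by blast
qed

lemma clique_width_balanced_cut:
  assumes G: "input_graph G" and cw: "clique_width G \<le> c"
    and W: "W \<subseteq> pverts G" "1 \<le> s" "s \<le> card W"
  shows "\<exists>U\<subseteq>pverts G. s \<le> card (W \<inter> U) \<and> card (W \<inter> U) < 2 * s \<and>
    cut_rank (\<lambda>v w. (v, w) \<in> parcs G) (pverts G) U \<le> c"
proof -
  have "pverts G \<noteq> {}" using W by auto
  then obtain lab where "cw_constructible c G lab"
    using clique_width_le_imp_constructible[OF G _ cw] by blast
  moreover have "s \<le> card (W \<inter> pverts G)" using W by (simp add: Int_absorb2)
  ultimately obtain U where U: "label_cut c G lab U" "s \<le> card (W \<inter> U)" "card (W \<inter> U) < 2 * s"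
    using cw_constructible_balanced_cut W(2) by blast
  then have sub: "U \<subseteq> pverts G" by (simp add: label_cut_def)
  have "cut_rank (\<lambda>v w. (v, w) \<in> parcs G) (pverts G) U \<le> c"
  proof -
    obtain l where "\<And>u. u \<in> U \<Longrightarrow> l u < c" "\<And>x y w. x \<in> U \<Longrightarrow> y \<in> U \<Longrightarrow> l x = l y \<Longrightarrow>
        w \<in> pverts G - U \<Longrightarrow> (x, w) \<in> parcs G \<longleftrightarrow> (y, w) \<in> parcs G"
      using U(1) unfolding label_cut_def by blast
    with finite_subset[OF sub input_graph_finite[OF G]] show ?thesis
      by (rule cut_rank_le_classes)
  qed
  then show ?thesis using sub U(2,3) by blast
qed

theorem clique_width_low_rank_split:
  assumes G: "input_graph G" and cw: "clique_width G \<le> c" and c_pos: "1 \<le> c"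
  defines "E \<equiv> \<lambda>v w. (v, w) \<in> parcs G"
  assumes Z: "Z \<subseteq> pverts G" "2 \<le> card Z" "cut_rank E (pverts G) Z \<le> 6 * c"
  shows "\<exists>X. low_rank_split E (pverts G) (6 * c) Z X"
proof (rule exists_low_rank_split[OF input_graph_finite[OF G] _ c_pos _ Z])
  show "symp E" unfolding E_def symp_def using input_graph_sym[OF G] by blast
  show "\<exists>U\<subseteq>pverts G. 2 * c \<le> card (W \<inter> U) \<and> card (W \<inter> U) < 4 * c \<and> cut_rank E (pverts G) U \<le> c"
    if "W \<subseteq> pverts G" "2 * c \<le> card W" for W
    using clique_width_balanced_cut[OF G cw that(1) _ that(2)] c_pos unfolding E_def by simp
qed

section \<open>Searching for a split of low cut-rank\<close>

text \<open>Vertex sets and vectors over GF(2) are lists of bits; positions beyond the end count as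
  \<^const>\<open>False\<close>. Vectors of numbers are extended by 0 in the same way.\<close>

type_synonym vec = "bool list"
type_synonym matrix = "vec list"

abbreviation mem :: "vec \<Rightarrow> nat \<Rightarrow> bool" where
  "mem X v \<equiv> lookup False X v"

abbreviation val :: "nat list \<Rightarrow> nat \<Rightarrow> nat" where
  "val s v \<equiv> lookup 0 s v"

abbreviation row :: "matrix \<Rightarrow> nat \<Rightarrow> vec" where
  "row A v \<equiv> lookup [] A v"

subsection \<open>The algorithm\<close>

definition xor_vec :: "nat \<Rightarrow> vec \<Rightarrow> vec \<Rightarrow> vec" where
  "xor_vec n a b = map (\<lambda>i. mem a i \<longleftrightarrow> \<not> mem b i) [0..<n]"

definition diff_vec :: "nat \<Rightarrow> vec \<Rightarrow> vec \<Rightarrow> vec" where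
  "diff_vec n a b = map (\<lambda>i. mem a i \<and> \<not> mem b i) [0..<n]"

text \<open>The row with index \<open>length A\<close> is the zero vector; it fills up families of fewer than \<open>r\<close>
  rows.\<close>

primrec spans :: "matrix \<Rightarrow> nat \<Rightarrow> vec list list" where
  "spans A 0 = [[[]]]"
| "spans A (Suc r) =
     [L @ map (xor_vec (length A) (row A v)) L. L \<leftarrow> spans A r, v \<leftarrow> [0..<Suc (length A)]]"

definition low_rank :: "nat \<Rightarrow> matrix \<Rightarrow> vec \<Rightarrow> bool" where
  "low_rank r A X \<longleftrightarrow> (\<exists>L\<in>set (spans A r). \<forall>x<length A. mem X x \<longrightarrow>
     (\<exists>m\<in>set L. \<forall>w<length A. \<not> mem X w \<longrightarrow> (mem (row A x) w \<longleftrightarrow> mem m w)))"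

definition is_split :: "nat \<Rightarrow> matrix \<Rightarrow> vec \<Rightarrow> vec \<Rightarrow> bool" where
  "is_split r A Z X \<longleftrightarrow> (\<exists>x<length A. mem X x) \<and> (\<exists>z<length A. mem Z z \<and> \<not> mem X z) \<and>
     (\<forall>x<length A. mem X x \<longrightarrow> mem Z x) \<and> low_rank r A X \<and> low_rank r A (diff_vec (length A) Z X)"

primrec tuples :: "nat \<Rightarrow> nat \<Rightarrow> nat list list" where
  "tuples n 0 = [[]]"
| "tuples n (Suc q) = [v # t. t \<leftarrow> tuples n q, v \<leftarrow> [0..<n]]"

text \<open>A guess consists of the span of a row basis and of columns that separate its elements.\<close>

type_synonym guess = "vec list \<times> nat list"

definition guesses :: "nat \<Rightarrow> matrix \<Rightarrow> guess list" where
  "guesses r A = [(L, C). L \<leftarrow> spans A r, C \<leftarrow> tuples (length A) (4 ^ r)]"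

definition compatible :: "matrix \<Rightarrow> guess \<Rightarrow> nat \<Rightarrow> nat \<Rightarrow> bool" where
  "compatible A g x w \<longleftrightarrow> (\<exists>m\<in>set (fst g).
     (\<forall>c\<in>set (snd g). mem (row A x) c \<longleftrightarrow> mem m c) \<and> (mem (row A x) w \<longleftrightarrow> mem m w))"

definition closure_step :: "matrix \<Rightarrow> vec \<Rightarrow> guess \<times> guess \<Rightarrow> vec \<Rightarrow> vec" where
  "closure_step A Z gh X = map (\<lambda>z. mem X z \<or> mem Z z \<and>
     ((\<exists>x<length A. mem X x \<and> \<not> compatible A (fst gh) x z) \<or>
      (\<exists>w<length A. (mem X w \<or> \<not> mem Z w) \<and> \<not> compatible A (snd gh) z w))) [0..<length A]"

definition forced :: "matrix \<Rightarrow> vec \<Rightarrow> guess \<times> guess \<Rightarrow> nat \<Rightarrow> vec" where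
  "forced A Z gh v = (closure_step A Z gh ^^ length A) (map (\<lambda>z. z = v) [0..<length A])"

definition split_candidates :: "nat \<Rightarrow> matrix \<Rightarrow> vec \<Rightarrow> vec list" where
  "split_candidates r A Z =
     [forced A Z (g, h) v. g \<leftarrow> guesses r A, h \<leftarrow> guesses r A, v \<leftarrow> [0..<length A]]"

definition split_vec :: "nat \<Rightarrow> matrix \<Rightarrow> vec \<Rightarrow> vec" where
  "split_vec r A Z =
     (case filter (is_split r A Z) (split_candidates r A Z) of [] \<Rightarrow> [] | X # _ \<Rightarrow> X)"

lemma ptime_xor_vec [ptime_intros]:
  "ptime f \<Longrightarrow> ptime g \<Longrightarrow> ptime h \<Longrightarrow> ptime (\<lambda>x. xor_vec (f x) (g x) (h x))"
  by (rule ptime_comp3) (unfold xor_vec_def, intro ptime_intros)+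

lemma ptime_diff_vec [ptime_intros]:
  "ptime f \<Longrightarrow> ptime g \<Longrightarrow> ptime h \<Longrightarrow> ptime (\<lambda>x. diff_vec (f x) (g x) (h x))"
  by (rule ptime_comp3) (unfold diff_vec_def, intro ptime_intros)+

lemma ptime_spans [ptime_intros]: "ptime f \<Longrightarrow> ptime (\<lambda>x. spans (f x) r)"
proof (rule ptime_comp[of "\<lambda>A. spans A r"])
  show "ptime (\<lambda>A. spans A r)"
    by (induction r) (unfold spans.simps, (intro ptime_intros | assumption)+)
qed

lemma ptime_low_rank [ptime_intros]: "ptime f \<Longrightarrow> ptime g \<Longrightarrow> ptime (\<lambda>x. low_rank r (f x) (g x))"
  by (rule ptime_comp2) (unfold low_rank_def, intro ptime_intros)+

lemma ptime_is_split [ptime_intros]: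
  "ptime f \<Longrightarrow> ptime g \<Longrightarrow> ptime h \<Longrightarrow> ptime (\<lambda>x. is_split r (f x) (g x) (h x))"
  by (rule ptime_comp3) (unfold is_split_def, intro ptime_intros)+

lemma ptime_tuples [ptime_intros]: "ptime f \<Longrightarrow> ptime (\<lambda>x. tuples (f x) q)"
proof (rule ptime_comp[of "\<lambda>n. tuples n q"])
  show "ptime (\<lambda>n. tuples n q)"
    by (induction q) (unfold tuples.simps, (intro ptime_intros | assumption)+)
qed

lemma ptime_guesses [ptime_intros]: "ptime f \<Longrightarrow> ptime (\<lambda>x. guesses r (f x))"
  by (rule ptime_comp) (unfold guesses_def, intro ptime_intros)+

lemma ptime_compatible [ptime_intros]:
  "ptime f \<Longrightarrow> ptime g \<Longrightarrow> ptime h \<Longrightarrow> ptime i \<Longrightarrow> ptime (\<lambda>x. compatible (f x) (g x) (h x) (i x))"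
  by (rule ptime_comp4) (unfold compatible_def, intro ptime_intros)+

lemma ptime_closure_step [ptime_intros]:
  "ptime f \<Longrightarrow> ptime g \<Longrightarrow> ptime h \<Longrightarrow> ptime i \<Longrightarrow> ptime (\<lambda>x. closure_step (f x) (g x) (h x) (i x))"
  by (rule ptime_comp4) (unfold closure_step_def, intro ptime_intros)+

lemma length_funpow_closure_step:
  "length X = length A \<Longrightarrow> length ((closure_step A Z gh ^^ i) X) = length A"
  by (cases i) (simp_all add: closure_step_def)

lemma length_forced: "length (forced A Z gh v) = length A"
  by (simp add: forced_def length_funpow_closure_step)

lemma ptime_forced [ptime_intros]:
  "ptime f \<Longrightarrow> ptime g \<Longrightarrow> ptime h \<Longrightarrow> ptime i \<Longrightarrow> ptime (\<lambda>x. forced (f x) (g x) (h x) (i x))"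
proof (rule ptime_comp4[of forced])
  let ?A = "\<lambda>p :: matrix \<times> vec \<times> (guess \<times> guess) \<times> nat. fst p"
  let ?step = "\<lambda>p. closure_step (?A p) (fst (snd p)) (fst (snd (snd p)))"
  let ?start = "\<lambda>p. map (\<lambda>z. z = snd (snd (snd p))) [0..<length (?A p)]"
  show "ptime (\<lambda>p. forced (?A p) (fst (snd p)) (fst (snd (snd p))) (snd (snd (snd p))))"
    unfolding forced_def
  proof (rule ptime_funpow[where bound = "\<lambda>p. 2 * csize (?A p)"])
    fix p and i :: nat
    have "length ((?step p ^^ i) (?start p)) = length (?A p)"
      by (rule length_funpow_closure_step) simp
    then show "csize ((?step p ^^ i) (?start p)) \<le> 2 * csize (?A p)"
      using csize_bool_list_le[of "(?step p ^^ i) (?start p)"] length_le_csize[of "?A p"] by simp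
  qed (intro ptime_intros pbounded_intros pbounded_csize_ptime)+
qed

lemma length_split_candidates: "X \<in> set (split_candidates r A Z) \<Longrightarrow> length X = length A"
  by (auto simp: split_candidates_def length_forced)

lemma split_vec_in_candidates:
  assumes "\<exists>X\<in>set (split_candidates r A Z). is_split r A Z X"
  shows "split_vec r A Z \<in> set (split_candidates r A Z) \<and> is_split r A Z (split_vec r A Z)"
proof -
  let ?xs = "filter (is_split r A Z) (split_candidates r A Z)"
  obtain X Xs where Cons: "?xs = X # Xs" using assms by (metis filter_empty_conv list.exhaust)
  have "X \<in> set ?xs" unfolding Cons by simp
  then have "X \<in> set (split_candidates r A Z) \<and> is_split r A Z X" by simp
  then show ?thesis by (simp add: split_vec_def Cons)
qed

lemma length_split_vec_le: "length (split_vec r A Z) \<le> length A"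
proof (cases "\<exists>X\<in>set (split_candidates r A Z). is_split r A Z X")
  case True
  then show ?thesis using split_vec_in_candidates length_split_candidates by (metis order_refl)
next
  case False
  then have "filter (is_split r A Z) (split_candidates r A Z) = []" by (simp add: filter_empty_conv)
  then show ?thesis by (simp add: split_vec_def)
qed

lemma ptime_split_vec [ptime_intros]: "ptime f \<Longrightarrow> ptime g \<Longrightarrow> ptime (\<lambda>x. split_vec r (f x) (g x))"
  by (rule ptime_comp2) (unfold split_vec_def split_candidates_def, intro ptime_intros)+

subsection \<open>Correctness\<close>

definition support :: "vec \<Rightarrow> nat set" where
  "support X = {v. mem X v}"

lemma support_subset: "support X \<subseteq> {..<length X}"
  by (auto simp: support_def lookup_nth)

lemma mem_Nil [simp]: "\<not> mem [] v"
  by (simp add: lookup_nth)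

lemma mem_map_upt [simp]: "mem (map P [0..<n]) v \<longleftrightarrow> v < n \<and> P v"
  by (simp add: lookup_map_upt)

lemma mem_iff_support: "mem X v \<longleftrightarrow> v \<in> support X"
  by (simp add: support_def)

lemma support_Nil [simp]: "support [] = {}"
  by (simp add: support_def)

lemma support_diff_vec: "support X \<subseteq> {..<n} \<Longrightarrow> support (diff_vec n X Y) = support X - support Y"
  by (auto simp: support_def diff_vec_def)

lemma support_xor_vec:
  "support a \<subseteq> {..<n} \<Longrightarrow> support b \<subseteq> {..<n} \<Longrightarrow> support (xor_vec n a b) = support a \<ominus> support b"
  by (auto simp: support_def xor_vec_def sdiff_def)

lemma set_tuples: "set (tuples n q) = {xs. length xs = q \<and> set xs \<subseteq> {..<n}}"
proof (induction q)
  case (Suc q)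
  show ?case
  proof (intro set_eqI iffI)
    fix xs assume "xs \<in> {xs. length xs = Suc q \<and> set xs \<subseteq> {..<n}}"
    then show "xs \<in> set (tuples n (Suc q))" using Suc by (cases xs) auto
  qed (use Suc in auto)
qed auto

lemma inflationary_funpow_card_fixpoint:
  assumes "finite V" "S \<subseteq> V" and step: "\<And>X. X \<subseteq> V \<Longrightarrow> X \<subseteq> step X \<and> step X \<subseteq> V"
  shows "step ((step ^^ card V) S) = (step ^^ card V) S"
proof -
  let ?f = "\<lambda>i. (step ^^ i) S"
  have sub: "?f i \<subseteq> V" for i by (induction i) (use assms in auto)
  have "mono ?f" using step[OF sub] by (auto simp: mono_iff_le_Suc)
  moreover have "finite (range ?f)"
    using finite_subset[of "range ?f" "Pow V"] sub \<open>finite V\<close> by auto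
  ultimately have "?f (card V) = (\<Union>i. ?f i)"
    using sub \<open>finite V\<close>
    by (intro finite_mono_strict_prefix_implies_finite_fixpoint
        finite_mono_remains_stable_implies_strict_prefix) auto
  moreover have "step (?f (card V)) = ?f (Suc (card V))" by simp
  ultimately have "step (?f (card V)) \<subseteq> ?f (card V)" by blast
  then show ?thesis using step[OF sub] by blast
qed

locale adj_matrix =
  fixes A :: matrix
  assumes adj_less: "mem (row A v) w \<Longrightarrow> v < length A \<and> w < length A"
    and adj_sym: "mem (row A v) w \<longleftrightarrow> mem (row A w) v"
    and adj_irrefl: "\<not> mem (row A v) v"
begin

abbreviation n :: nat where "n \<equiv> length A"

abbreviation V :: "nat set" where "V \<equiv> {..<n}"

abbreviation E :: "nat \<Rightarrow> nat \<Rightarrow> bool" where "E \<equiv> \<lambda>v w. mem (row A v) w"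

lemma support_row: "support (row A v) = {w. E v w} \<inter> V"
  using adj_less by (auto simp: support_def)

lemma support_add_row:
  assumes "\<forall>m\<in>set L. support m \<subseteq> V"
  shows "support ` set (L @ map (xor_vec n (row A v)) L) =
    support ` set L \<union> (\<lambda>a. support (row A v) \<ominus> a) ` support ` set L"
proof -
  have "support (xor_vec n (row A v) m) = support (row A v) \<ominus> support m" if "m \<in> set L" for m
    using assms that by (intro support_xor_vec) (auto simp: support_row)
  then show ?thesis by (auto simp: image_Un image_image)
qed

lemma spans_sound:
  assumes "L \<in> set (spans A r)"
  shows "length L = 2 ^ r \<and> (\<forall>m\<in>set L. support m \<subseteq> V) \<and> gf2_subspace (support ` set L)"
  using assms
proof (induction r arbitrary: L)
  case 0
  then show ?case by (simp add: gf2_subspace_def)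
next
  case (Suc r)
  then obtain L' v where L': "L' \<in> set (spans A r)" and L: "L = L' @ map (xor_vec n (row A v)) L'"
    by auto
  note IH = Suc.IH[OF L']
  then have sub: "\<forall>m\<in>set L'. support m \<subseteq> V" by simp
  have "gf2_subspace (support ` set L)"
    unfolding L support_add_row[OF sub] using IH by (intro gf2_subspace_extend) simp
  moreover have "\<forall>m\<in>set L. support m \<subseteq> V"
    using IH unfolding L by (auto simp: xor_vec_def support_def subset_iff)
  ultimately show ?case using IH by (simp add: L)
qed

lemma spans_add_row:
  assumes "L \<in> set (spans A r)" "v \<le> n"
  shows "\<exists>L'\<in>set (spans A (Suc r)). support ` set L' =
    support ` set L \<union> (\<lambda>a. support (row A v) \<ominus> a) ` support ` set L"
proof (intro bexI)
  show "support ` set (L @ map (xor_vec n (row A v)) L) =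
      support ` set L \<union> (\<lambda>a. support (row A v) \<ominus> a) ` support ` set L"
    using spans_sound[OF assms(1)] by (intro support_add_row) simp
  show "L @ map (xor_vec n (row A v)) L \<in> set (spans A (Suc r))"
    using assms by (simp del: upt_Suc) (intro bexI[of _ L] imageI, auto)
qed

lemma spans_complete:
  assumes "W \<subseteq> V" "card W \<le> r"
  shows "\<exists>L\<in>set (spans A r). support ` set L = row_space E W V"
  using assms
proof (induction r arbitrary: W)
  case 0
  then have "W = {}" using finite_subset[of W V] by simp
  then show ?case by (simp add: row_space_def)
next
  case (Suc r)
  have finW: "finite W" using finite_subset[OF Suc.prems(1)] by simp
  show ?case
  proof (cases "W = {}")
    case True
    obtain L where L: "L \<in> set (spans A r)" "support ` set L = row_space E {} V"
      using Suc.IH[of "{}"] by auto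
    have "support (row A n) = {}" by (simp add: lookup_nth)
    then show ?thesis using spans_add_row[OF L(1), of n] L(2) True by auto
  next
    case False
    then obtain v where v: "v \<in> W" by blast
    then have "W - {v} \<subseteq> V" "card (W - {v}) \<le> r" using Suc.prems finW by auto
    then obtain L where L: "L \<in> set (spans A r)" "support ` set L = row_space E (W - {v}) V"
      using Suc.IH by blast
    have "row_space E W V = row_space E (W - {v}) V \<union>
        (\<lambda>a. support (row A v) \<ominus> a) ` row_space E (W - {v}) V"
      using row_space_insert[of "W - {v}" v E V] finW v by (simp add: insert_absorb support_row)
    then show ?thesis using spans_add_row[OF L(1), of v] L(2) v Suc.prems(1) by auto
  qed
qed

lemma spanning_list:
  assumes X: "X \<subseteq> V" and C: "C \<subseteq> V" and low: "rank E X C \<le> r"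
  obtains W L where "W \<subseteq> X" "independent_rows E W C" "L \<in> set (spans A r)"
    "support ` set L = row_space E W V" "\<forall>x\<in>X. \<exists>m\<in>set L. \<forall>w\<in>C. E x w \<longleftrightarrow> mem m w"
proof -
  obtain W where W: "W \<subseteq> X" "independent_rows E W C" "card W = rank E X C"
    "row_space E W C = row_space E X C"
    by (rule row_basis[OF finite_subset[OF X finite_lessThan]])
  obtain L where L: "L \<in> set (spans A r)" "support ` set L = row_space E W V"
    using spans_complete[of W r] W(1,3) X low by auto
  have "\<exists>m\<in>set L. \<forall>w\<in>C. E x w \<longleftrightarrow> mem m w" if x: "x \<in> X" for x
  proof -
    have "row_sum E {x} \<inter> C \<in> row_space E X C" using x unfolding row_space_def by blast
    then have "row_sum E {x} \<inter> C \<in> row_space E W C" unfolding W(4) .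
    then obtain S where S: "S \<subseteq> W" "row_sum E {x} \<inter> C = row_sum E S \<inter> C"
      unfolding row_space_def by blast
    then have "row_sum E S \<inter> V \<in> support ` set L" unfolding L(2) row_space_def by blast
    then obtain m where m: "m \<in> set L" "row_sum E S \<inter> V = support m" by blast
    have "E x w \<longleftrightarrow> mem m w" if "w \<in> C" for w
    proof -
      have "E x w \<longleftrightarrow> w \<in> row_sum E S" using S(2) that by auto
      also have "\<dots> \<longleftrightarrow> w \<in> row_sum E S \<inter> V" using that C by auto
      finally show ?thesis unfolding m(2) support_def by simp
    qed
    then show ?thesis using m(1) by blast
  qed
  then show ?thesis using that W(1,2) L by blast
qed

lemma cut_rank_le_spans:
  assumes "X \<subseteq> V" and L: "L \<in> set (spans A r)"
    and rows: "\<And>x. x \<in> X \<Longrightarrow> \<exists>m\<in>set L. \<forall>w\<in>V - X. E x w \<longleftrightarrow> mem m w"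
  shows "cut_rank E V X \<le> r"
proof -
  let ?M = "(\<lambda>m. m \<inter> (V - X)) ` support ` set L"
  note sound = spans_sound[OF L]
  have "2 ^ rank E X (V - X) \<le> card ?M"
  proof (rule rank_le_card_subspace)
    show "gf2_subspace ?M" using sound by (intro gf2_subspace_Int) blast
    fix x assume "x \<in> X"
    then obtain m where "m \<in> set L" "\<forall>w\<in>V - X. E x w \<longleftrightarrow> mem m w" using rows by blast
    then have "{w. E x w} \<inter> (V - X) = support m \<inter> (V - X)" by (auto simp: support_def)
    then show "{w. E x w} \<inter> (V - X) \<in> ?M" using \<open>m \<in> set L\<close> by blast
  qed (use assms(1) finite_subset in auto)
  also have "card ?M \<le> card (set L)" by (meson List.finite_set card_image_le finite_imageI le_trans)
  also have "\<dots> \<le> 2 ^ r" using card_length[of L] sound by simp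
  finally show ?thesis by (simp add: cut_rank_def)
qed

lemma low_rank_iff:
  assumes "support X \<subseteq> V"
  shows "low_rank r A X \<longleftrightarrow> cut_rank E V (support X) \<le> r"
proof
  assume "low_rank r A X"
  then obtain L where L: "L \<in> set (spans A r)" and rows: "\<forall>x<n. mem X x \<longrightarrow>
      (\<exists>m\<in>set L. \<forall>w<n. \<not> mem X w \<longrightarrow> (E x w \<longleftrightarrow> mem m w))"
    unfolding low_rank_def by blast
  have "\<exists>m\<in>set L. \<forall>w\<in>V - support X. E x w \<longleftrightarrow> mem m w" if "x \<in> support X" for x
  proof -
    have "x < n" "mem X x" using that assms by (auto simp: support_def)
    then obtain m where "m \<in> set L" "\<forall>w<n. \<not> mem X w \<longrightarrow> (E x w \<longleftrightarrow> mem m w)" using rows by blast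
    then show ?thesis by (intro bexI[of _ m]) (auto simp: support_def)
  qed
  then show "cut_rank E V (support X) \<le> r" by (rule cut_rank_le_spans[OF assms L])
next
  assume "cut_rank E V (support X) \<le> r"
  then have "rank E (support X) (V - support X) \<le> r" by (simp add: cut_rank_def)
  then obtain W L where "W \<subseteq> support X" "independent_rows E W (V - support X)"
    and L: "L \<in> set (spans A r)" and "support ` set L = row_space E W V"
    and rows: "\<forall>x\<in>support X. \<exists>m\<in>set L. \<forall>w\<in>V - support X. E x w \<longleftrightarrow> mem m w"
    by (rule spanning_list[OF assms Diff_subset])
  have "\<exists>m\<in>set L. \<forall>w<n. \<not> mem X w \<longrightarrow> (E x w \<longleftrightarrow> mem m w)" if "mem X x" for x
    using rows that unfolding support_def by blast
  then show "low_rank r A X" unfolding low_rank_def using L by blast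
qed

lemma is_split_iff:
  assumes "support Z \<subseteq> V" "support X \<subseteq> V"
  shows "is_split r A Z X \<longleftrightarrow> low_rank_split E V r (support Z) (support X)"
proof -
  have "support (diff_vec n Z X) = support Z - support X" by (rule support_diff_vec[OF assms(1)])
  then have low: "low_rank r A (diff_vec n Z X) \<longleftrightarrow> cut_rank E V (support Z - support X) \<le> r"
    using assms(1) low_rank_iff[of "diff_vec n Z X" r] by auto
  show ?thesis
    unfolding low is_split_def low_rank_split_def low_rank_iff[OF assms(2)]
      mem_iff_support[of X] mem_iff_support[of Z]
    using assms by auto
qed

subsection \<open>Guesses\<close>

definition separating :: "guess \<Rightarrow> bool" where
  "separating g \<longleftrightarrow> (\<forall>m\<in>set (fst g). \<forall>m'\<in>set (fst g).
     (\<forall>c\<in>set (snd g). mem m c \<longleftrightarrow> mem m' c) \<longrightarrow> support m = support m')"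

definition fits :: "guess \<Rightarrow> nat set \<Rightarrow> bool" where
  "fits g X \<longleftrightarrow> (\<forall>x\<in>X. \<forall>w\<in>V - X. compatible A g x w)"

lemma fits_imp_cut_rank_le:
  assumes g: "g \<in> set (guesses r A)" "separating g" and X: "X \<subset> V" "fits g X"
  shows "cut_rank E V X \<le> r"
proof (rule cut_rank_le_spans)
  show "fst g \<in> set (spans A r)" using g(1) by (auto simp: guesses_def)
  fix x assume x: "x \<in> X"
  have agree: "\<exists>m\<in>set (fst g). (\<forall>c\<in>set (snd g). E x c \<longleftrightarrow> mem m c) \<and> (E x w \<longleftrightarrow> mem m w)"
    if "w \<in> V - X" for w
    using X(2) x that unfolding fits_def compatible_def by blast
  obtain w0 where "w0 \<in> V - X" using X(1) by blast
  then obtain m where m: "m \<in> set (fst g)" "\<forall>c\<in>set (snd g). E x c \<longleftrightarrow> mem m c" using agree by blast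
  have "E x w \<longleftrightarrow> mem m w" if w: "w \<in> V - X" for w
  proof -
    obtain m' where m': "m' \<in> set (fst g)" "\<forall>c\<in>set (snd g). E x c \<longleftrightarrow> mem m' c" "E x w \<longleftrightarrow> mem m' w"
      using agree[OF w] by blast
    then have "support m = support m'" using g(2) m unfolding separating_def by blast
    then show ?thesis using m'(3) by (simp add: mem_iff_support)
  qed
  then show "\<exists>m\<in>set (fst g). \<forall>w\<in>V - X. E x w \<longleftrightarrow> mem m w" using m(1) by blast
qed (use X(1) in blast)

lemma exists_separating_columns:
  assumes "D \<noteq> {}" "D \<subseteq> V"
    and separated: "\<And>m m'. m \<in> set L \<Longrightarrow> m' \<in> set L \<Longrightarrow> support m \<noteq> support m' \<Longrightarrow>
      \<exists>w\<in>D. mem m w \<noteq> mem m' w"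
  shows "\<exists>C\<in>set (tuples n (length L * length L)). set C \<subseteq> D \<and> separating (L, C)"
proof -
  have "\<exists>w. w \<in> D \<and> (support (fst p) \<noteq> support (snd p) \<longrightarrow> mem (fst p) w \<noteq> mem (snd p) w)"
    if "p \<in> set (List.product L L)" for p
    using separated[of "fst p" "snd p"] assms(1) that by auto
  then have "\<forall>p\<in>set (List.product L L). \<exists>w. w \<in> D \<and>
      (support (fst p) \<noteq> support (snd p) \<longrightarrow> mem (fst p) w \<noteq> mem (snd p) w)"
    by blast
  then obtain d where d: "\<forall>p\<in>set (List.product L L). d p \<in> D \<and>
      (support (fst p) \<noteq> support (snd p) \<longrightarrow> mem (fst p) (d p) \<noteq> mem (snd p) (d p))"
    by (rule bchoice[THEN exE])
  let ?C = "map d (List.product L L)"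
  have "set ?C \<subseteq> D" using d by auto
  moreover from this have "?C \<in> set (tuples n (length L * length L))"
    using assms(2) by (auto simp: set_tuples)
  moreover have "separating (L, ?C)"
    unfolding separating_def using d by fastforce
  ultimately show ?thesis by blast
qed

lemma exists_fitting_guess:
  assumes X: "X \<subset> V" "cut_rank E V X \<le> r"
  shows "\<exists>g\<in>set (guesses r A). separating g \<and> fits g X"
proof -
  have sub: "X \<subseteq> V" using X(1) by blast
  obtain W L where W: "W \<subseteq> X" "independent_rows E W (V - X)"
    and L: "L \<in> set (spans A r)" "support ` set L = row_space E W V"
    and rows: "\<forall>x\<in>X. \<exists>m\<in>set L. \<forall>w\<in>V - X. E x w \<longleftrightarrow> mem m w"
    by (rule spanning_list[OF sub Diff_subset X(2)[unfolded cut_rank_def]])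
  have finW: "finite W" using finite_subset[OF subset_trans[OF W(1) sub]] by simp
  have separated: "\<exists>w\<in>V - X. mem m w \<noteq> mem m' w"
    if m: "m \<in> set L" "m' \<in> set L" "support m \<noteq> support m'" for m m'
  proof -
    have "support m \<in> row_space E W V" "support m' \<in> row_space E W V" using m(1,2) L(2) by blast+
    then obtain S S' where S: "S \<subseteq> W" "S' \<subseteq> W" "support m = row_sum E S \<inter> V"
      "support m' = row_sum E S' \<inter> V"
      unfolding row_space_def by blast
    then have "row_sum E S \<inter> (V - X) \<noteq> row_sum E S' \<inter> (V - X)"
      using inj_onD[OF independent_rows_inj[OF finW W(2)], of S S'] m(3) by blast
    then have "support m \<inter> (V - X) \<noteq> support m' \<inter> (V - X)" unfolding S(3,4) by blast
    then show ?thesis by (auto simp: support_def)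
  qed
  have "(4::nat) ^ r = 2 ^ r * 2 ^ r" by (simp flip: power_mult_distrib)
  then have "length L * length L = 4 ^ r" using spans_sound[OF L(1)] by simp
  then obtain C where C: "C \<in> set (tuples n (4 ^ r))" "set C \<subseteq> V - X" "separating (L, C)"
    using exists_separating_columns[of "V - X" L] separated X(1) by auto
  have "fits (L, C) X"
    unfolding fits_def compatible_def
  proof (intro ballI)
    fix x w assume "x \<in> X" and w: "w \<in> V - X"
    then obtain m where "m \<in> set L" "\<forall>w\<in>V - X. E x w \<longleftrightarrow> mem m w" using rows by blast
    then show "\<exists>m\<in>set (fst (L, C)). (\<forall>c\<in>set (snd (L, C)). E x c \<longleftrightarrow> mem m c) \<and> (E x w \<longleftrightarrow> mem m w)"
      using C(2) w by auto
  qed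
  moreover have "(L, C) \<in> set (guesses r A)" using L(1) C(1) by (auto simp: guesses_def)
  ultimately show ?thesis using C(3) by blast
qed

subsection \<open>Closure under implications\<close>

text \<open>Iterating this map from \<open>S\<close> gives the least superset \<open>F\<close> of \<open>S\<close> for which \<open>g\<close> fits \<open>F\<close> and
  \<open>h\<close> fits \<open>Z - F\<close>, provided that there is one inside \<open>Z\<close>.\<close>

definition closure_set :: "guess \<Rightarrow> guess \<Rightarrow> nat set \<Rightarrow> nat set \<Rightarrow> nat set" where
  "closure_set g h Z S = S \<union> {z \<in> Z. (\<exists>x\<in>S. \<not> compatible A g x z) \<or>
     (\<exists>w\<in>V. (w \<in> S \<or> w \<notin> Z) \<and> \<not> compatible A h z w)}"

lemma support_forced:
  assumes "v < n" "support Z \<subseteq> V"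
  shows "support (forced A Z (g, h) v) = (closure_set g h (support Z) ^^ n) {v}"
proof -
  have "support ((closure_step A Z (g, h) ^^ i) X) = (closure_set g h (support Z) ^^ i) (support X)"
    if "length X = n" for i X
  proof (induction i)
    case (Suc i)
    define Y where "Y = (closure_step A Z (g, h) ^^ i) X"
    have "mem Y z \<Longrightarrow> z < n" "mem Z z \<Longrightarrow> z < n" for z
      using length_funpow_closure_step[OF that] support_subset[of Y] assms(2)
      unfolding Y_def support_def by auto
    then have "support (closure_step A Z (g, h) Y) = closure_set g h (support Z) (support Y)"
      unfolding closure_step_def closure_set_def support_def by (auto, blast+)
    then show ?case using Suc by (simp add: Y_def)
  qed simp
  moreover have "support (map (\<lambda>z. z = v) [0..<n]) = {v}" using assms(1) by (auto simp: support_def)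
  ultimately show ?thesis using assms(1) unfolding forced_def by simp
qed

lemma subset_closure_set: "S \<subseteq> closure_set g h Z S"
  unfolding closure_set_def by blast

lemma closure_set_subset:
  assumes "fits g X" "fits h (Z - X)" "X \<subseteq> Z" "Z \<subseteq> V" "S \<subseteq> X"
  shows "closure_set g h Z S \<subseteq> X"
  using assms unfolding closure_set_def fits_def by blast

lemma closure_set_fixpoint_fits:
  assumes fixpoint: "closure_set g h Z F = F" and F: "F \<subseteq> X" and X: "X \<subseteq> Z" "fits g X"
  shows "fits g F" "fits h (Z - F)"
proof -
  have closed: "z \<in> F" if "z \<in> Z" "(\<exists>x\<in>F. \<not> compatible A g x z) \<or>
      (\<exists>w\<in>V. (w \<in> F \<or> w \<notin> Z) \<and> \<not> compatible A h z w)" for z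
    using fixpoint that unfolding closure_set_def by blast
  show "fits g F" using closed F X unfolding fits_def by blast
  show "fits h (Z - F)" using closed unfolding fits_def by blast
qed

lemma low_rank_split_forced:
  assumes Z: "support Z \<subseteq> V" and X: "low_rank_split E V r (support Z) X"
  shows "\<exists>g\<in>set (guesses r A). \<exists>h\<in>set (guesses r A). \<exists>v<n.
    low_rank_split E V r (support Z) (support (forced A Z (g, h) v))"
proof -
  obtain v where v: "v \<in> X" and sub: "X \<subset> support Z" using X unfolding low_rank_split_def by blast
  obtain g where g: "g \<in> set (guesses r A)" "separating g" "fits g X"
    using exists_fitting_guess[of X r] X Z unfolding low_rank_split_def by blast
  have "support Z - X \<subset> V" using v sub Z by blast
  then obtain h where h: "h \<in> set (guesses r A)" "separating h" "fits h (support Z - X)"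
    using exists_fitting_guess[of "support Z - X" r] X unfolding low_rank_split_def by blast
  let ?step = "closure_set g h (support Z)"
  define F where "F = (?step ^^ n) {v}"
  have "?step ((?step ^^ card V) {v}) = (?step ^^ card V) {v}"
    by (rule inflationary_funpow_card_fixpoint) (use v sub Z in \<open>auto simp: closure_set_def\<close>)
  then have fixpoint: "?step F = F" by (simp add: F_def)
  have "v \<in> (?step ^^ i) {v} \<and> (?step ^^ i) {v} \<subseteq> X" for i
  proof (induction i)
    case (Suc i)
    then have "?step ((?step ^^ i) {v}) \<subseteq> X"
      using g(3) h(3) sub Z by (intro closure_set_subset) auto
    then show ?case using Suc subset_closure_set[of "(?step ^^ i) {v}" g h "support Z"] by auto
  qed (use v in simp)
  then have F: "v \<in> F" "F \<subseteq> X" by (simp_all add: F_def)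
  note fit = closure_set_fixpoint_fits[OF fixpoint F(2) _ g(3)]
  have "cut_rank E V F \<le> r" using g fit(1) F(2) sub Z by (intro fits_imp_cut_rank_le) auto
  moreover have "cut_rank E V (support Z - F) \<le> r"
    using h fit(2) F(1) v sub Z by (intro fits_imp_cut_rank_le) auto
  ultimately have "low_rank_split E V r (support Z) F"
    unfolding low_rank_split_def using F sub by blast
  moreover have "v < n" using v sub Z by auto
  ultimately show ?thesis
    using support_forced[OF _ Z, of v g h] g(1) h(1) unfolding F_def by metis
qed

theorem low_rank_split_split_vec:
  assumes Z: "support Z \<subseteq> V" and "\<exists>X. low_rank_split E V r (support Z) X"
  shows "low_rank_split E V r (support Z) (support (split_vec r A Z))"
proof -
  have splits: "is_split r A Z X \<longleftrightarrow> low_rank_split E V r (support Z) (support X)"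
    if "X \<in> set (split_candidates r A Z)" for X
    using that support_subset[of X]
    by (intro is_split_iff[OF Z]) (auto simp: length_split_candidates)
  obtain g h v where "g \<in> set (guesses r A)" "h \<in> set (guesses r A)" "v < n"
    "low_rank_split E V r (support Z) (support (forced A Z (g, h) v))"
    using low_rank_split_forced[OF Z] assms(2) by blast
  moreover from this have "forced A Z (g, h) v \<in> set (split_candidates r A Z)"
    by (simp add: split_candidates_def) (intro bexI[of _ g] bexI[of _ h]; simp)
  ultimately have "split_vec r A Z \<in> set (split_candidates r A Z)"
    "is_split r A Z (split_vec r A Z)"
    using split_vec_in_candidates splits by blast+
  then show ?thesis using splits by blast
qed

end

section \<open>Dynamic programming\<close>

subsection \<open>The algorithm\<close>

text \<open>A fictitious vertex \<open>length A\<close>, adjacent to all others, makes the weight of a partial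
  solution one of the entries of its state.\<close>

definition nbr :: "matrix \<Rightarrow> nat \<Rightarrow> nat \<Rightarrow> bool" where
  "nbr A v w \<longleftrightarrow> v = length A \<or> mem (row A v) w"

definition twins :: "matrix \<Rightarrow> vec \<Rightarrow> nat \<Rightarrow> nat \<Rightarrow> bool" where
  "twins A Z p v \<longleftrightarrow> (mem Z p \<longleftrightarrow> mem Z v) \<and>
     (\<forall>w<length A. (mem Z w \<longleftrightarrow> \<not> mem Z p) \<longrightarrow> (nbr A p w \<longleftrightarrow> nbr A v w))"

text \<open>The vectors that are constant on at most \<open>i\<close> classes of twins and vanish elsewhere.\<close>

primrec class_vectors :: "nat \<Rightarrow> matrix \<Rightarrow> vec \<Rightarrow> nat \<Rightarrow> nat list list" where
  "class_vectors M A Z 0 = [[]]"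
| "class_vectors M A Z (Suc i) =
     [map (\<lambda>v. if twins A Z p v then y else val s v) [0..<Suc (length A)].
        s \<leftarrow> class_vectors M A Z i, p \<leftarrow> [0..<Suc (length A)], y \<leftarrow> [0..<Suc (M * length A)]]"

definition states :: "nat \<Rightarrow> nat \<Rightarrow> matrix \<Rightarrow> vec \<Rightarrow> nat list list" where
  "states r M A Z = class_vectors M A Z (2 ^ r + 2 ^ r + 1)"

text \<open>The adjacency matrix with the vectors \<open>k\<close> and \<open>u\<close>.\<close>

type_synonym inst = "matrix \<times> nat list \<times> nat list"

text \<open>The flag \<open>cover\<close> distinguishes domination from packing.\<close>

definition admissible :: "bool \<Rightarrow> inst \<Rightarrow> nat \<Rightarrow> nat \<Rightarrow> nat \<Rightarrow> bool" where
  "admissible cover e v x t \<longleftrightarrow> x \<le> val (snd (snd e)) v \<and>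
     (if cover then val (fst (snd e)) v \<le> t else t \<le> val (fst (snd e)) v)"

definition leaf_table :: "nat \<Rightarrow> nat \<Rightarrow> bool \<Rightarrow> inst \<Rightarrow> vec \<Rightarrow> nat list list" where
  "leaf_table r M cover e Z = filter (\<lambda>s. \<exists>v<length (fst e). mem Z v \<and>
     (\<exists>x<Suc M. admissible cover e v x (x + val s v) \<and>
       (\<forall>w<Suc (length (fst e)). w \<noteq> v \<longrightarrow> val s w = (if nbr (fst e) w v then x else 0))))
     (states r M (fst e) Z)"

text \<open>The entry of a state at \<open>v\<close> is the weight of the neighbours of \<open>v\<close> on the other side of the
  cut. For a partition of the vertices into three cells, the entry at \<open>v\<close> for the cell of \<open>v\<close>
  is the sum of the entries for the other two cells.\<close>

definition joins :: "nat \<Rightarrow> vec \<Rightarrow> vec \<Rightarrow> nat list \<Rightarrow> nat list \<Rightarrow> nat list \<Rightarrow> bool" where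
  "joins n Z X t t' s \<longleftrightarrow> (\<forall>v<Suc n.
     if mem X v then val t v = val t' v + val s v
     else if mem Z v then val t' v = val t v + val s v
     else val s v = val t v + val t' v)"

definition join_table ::
  "nat \<Rightarrow> nat \<Rightarrow> inst \<Rightarrow> vec \<Rightarrow> vec \<Rightarrow> nat list list \<Rightarrow> nat list list \<Rightarrow> nat list list" where
  "join_table r M e Z X T T' =
     filter (\<lambda>s. \<exists>t\<in>set T. \<exists>t'\<in>set T'. joins (length (fst e)) Z X t t' s) (states r M (fst e) Z)"

definition is_single :: "nat \<Rightarrow> vec \<Rightarrow> bool" where
  "is_single n Z \<longleftrightarrow> (\<forall>v<n. \<forall>w<n. mem Z v \<longrightarrow> mem Z w \<longrightarrow> v = w)"

text \<open>The recursion is unfolded with a stack of tasks and a stack of tables: \<open>Solve Z\<close> asks for the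
  table of \<open>Z\<close>, and \<open>Combine Z X\<close> asks to combine the two topmost tables, those of \<open>Z - X\<close> and \<open>X\<close>.\<close>

datatype task = Solve vec | Combine vec vec

type_synonym machine = "task list \<times> nat list list list"

definition machine_step :: "nat \<Rightarrow> nat \<Rightarrow> bool \<Rightarrow> inst \<Rightarrow> machine \<Rightarrow> machine" where
  "machine_step r M cover e s =
    (case fst s of
      [] \<Rightarrow> s
    | Solve Z # ts \<Rightarrow>
        if is_single (length (fst e)) Z then (ts, leaf_table r M cover e Z # snd s)
        else let X = split_vec r (fst e) Z in
          (Solve X # Solve (diff_vec (length (fst e)) Z X) # Combine Z X # ts, snd s)
    | Combine Z X # ts \<Rightarrow>
        (case snd s of T' # T # Ts \<Rightarrow> (ts, join_table r M e Z X T T' # Ts) | _ \<Rightarrow> s))"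

definition run_machine :: "nat \<Rightarrow> nat \<Rightarrow> bool \<Rightarrow> inst \<Rightarrow> nat \<Rightarrow> machine" where
  "run_machine r M cover e i =
    (machine_step r M cover e ^^ i) ([Solve (map (\<lambda>_. True) [0..<length (fst e)])], [])"

definition root_table :: "nat \<Rightarrow> nat \<Rightarrow> bool \<Rightarrow> inst \<Rightarrow> nat list list" where
  "root_table r M cover e =
    (case snd (run_machine r M cover e (3 * length (fst e))) of [] \<Rightarrow> [] | T # _ \<Rightarrow> T)"

definition weights :: "nat \<Rightarrow> nat \<Rightarrow> bool \<Rightarrow> inst \<Rightarrow> nat list" where
  "weights r M cover e = filter (\<lambda>x. \<exists>s\<in>set (root_table r M cover e).
     (\<forall>v<length (fst e). val s v = 0) \<and> val s (length (fst e)) = x) [0..<Suc (M * length (fst e))]"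

subsection \<open>Running time\<close>

lemma ptime_nbr [ptime_intros]: "ptime f \<Longrightarrow> ptime g \<Longrightarrow> ptime h \<Longrightarrow> ptime (\<lambda>x. nbr (f x) (g x) (h x))"
  unfolding nbr_def by (intro ptime_intros)

lemma ptime_twins [ptime_intros]:
  "ptime f \<Longrightarrow> ptime g \<Longrightarrow> ptime h \<Longrightarrow> ptime i \<Longrightarrow> ptime (\<lambda>x. twins (f x) (g x) (h x) (i x))"
  by (rule ptime_comp4) (unfold twins_def, intro ptime_intros)+

lemma ptime_states [ptime_intros]: "ptime f \<Longrightarrow> ptime g \<Longrightarrow> ptime (\<lambda>x. states r M (f x) (g x))"
proof (rule ptime_comp2[of "states r M"])
  have "ptime (\<lambda>p. class_vectors M (fst p) (snd p) i)" for i
    by (induction i) (unfold class_vectors.simps, (intro ptime_intros | assumption)+)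
  then show "ptime (\<lambda>p. states r M (fst p) (snd p))" unfolding states_def .
qed

lemma ptime_admissible [ptime_intros]:
  "ptime f \<Longrightarrow> ptime g \<Longrightarrow> ptime h \<Longrightarrow> ptime i \<Longrightarrow> ptime (\<lambda>x. admissible cover (f x) (g x) (h x) (i x))"
  unfolding admissible_def by (intro ptime_intros)

lemma ptime_leaf_table [ptime_intros]:
  "ptime f \<Longrightarrow> ptime g \<Longrightarrow> ptime (\<lambda>x. leaf_table r M cover (f x) (g x))"
  by (rule ptime_comp2) (unfold leaf_table_def, intro ptime_intros)+

lemma ptime_join_table [ptime_intros]:
  assumes "ptime f" "ptime g" "ptime h" "ptime i" "ptime j"
  shows "ptime (\<lambda>x. join_table r M (f x) (g x) (h x) (i x) (j x))"
proof -
  have "ptime (\<lambda>p. join_table r M (fst p) (fst (snd p)) (fst (snd (snd p)))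
      (fst (snd (snd (snd p)))) (snd (snd (snd (snd p)))))"
    unfolding join_table_def joins_def by (intro ptime_intros)
  from ptime_comp[OF this, of "\<lambda>x. (f x, g x, h x, i x, j x)"] show ?thesis
    by (simp add: ptime_Pair assms)
qed

lemma ptime_is_single [ptime_intros]: "ptime f \<Longrightarrow> ptime g \<Longrightarrow> ptime (\<lambda>x. is_single (f x) (g x))"
  by (rule ptime_comp2) (unfold is_single_def, intro ptime_intros)+

fun dest_task :: "task \<Rightarrow> bool \<times> vec \<times> vec" where
  "dest_task (Solve Z) = (True, Z, [])"
| "dest_task (Combine Z X) = (False, Z, X)"

instantiation task :: coded begin
definition encode_task :: "task \<Rightarrow> data" where "encode_task t = encode (dest_task t)"
instance ..
end

lemma ptime_Solve [ptime_intros]: "ptime f \<Longrightarrow> ptime (\<lambda>x. Solve (f x))"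
proof (rule ptime_comp[of Solve])
  have "ptime (\<lambda>Z :: vec. (True, Z, [] :: vec))" by (intro ptime_intros)
  then show "ptime Solve" unfolding ptime_def subroutine_def by (simp add: encode_task_def)
qed

lemma ptime_Combine [ptime_intros]: "ptime f \<Longrightarrow> ptime g \<Longrightarrow> ptime (\<lambda>x. Combine (f x) (g x))"
proof (rule ptime_comp2[of Combine])
  have "ptime (\<lambda>p :: vec \<times> vec. (False, fst p, snd p))" by (intro ptime_intros)
  then show "ptime (\<lambda>p. Combine (fst p) (snd p))"
    unfolding ptime_def subroutine_def by (simp add: encode_task_def)
qed

lemma ptime_case_task [ptime_intros]:
  assumes "ptime f" "ptime (\<lambda>p. g (fst p) (snd p))"
    and "ptime (\<lambda>p. h (fst p) (fst (snd p)) (snd (snd p)))"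
  shows "ptime (\<lambda>x. case f x of Solve Z \<Rightarrow> g x Z | Combine Z X \<Rightarrow> h x Z X)"
proof -
  have "ptime dest_task" by (rule ptime_same_code) (simp add: encode_task_def)
  from ptime_comp[OF this assms(1)]
  have "ptime (\<lambda>x. if fst (dest_task (f x)) then g x (fst (snd (dest_task (f x))))
      else h x (fst (snd (dest_task (f x)))) (snd (snd (dest_task (f x)))))"
    by (intro ptime_intros ptime_comp2[OF assms(2)] ptime_comp3[OF assms(3)])
  then show ?thesis by (rule back_subst[of ptime]) (auto split: task.split)
qed

lemma ptime_machine_step [ptime_intros]:
  "ptime f \<Longrightarrow> ptime g \<Longrightarrow> ptime (\<lambda>x. machine_step r M cover (f x) (g x))"
  by (rule ptime_comp2) (unfold machine_step_def, intro ptime_intros)+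

definition machine_bounded :: "nat \<Rightarrow> nat \<Rightarrow> nat \<Rightarrow> machine \<Rightarrow> bool" where
  "machine_bounded n K i s \<longleftrightarrow> length (fst s) \<le> 1 + 2 * i \<and> length (snd s) \<le> i \<and>
     (\<forall>t\<in>set (fst s). length (fst (snd (dest_task t))) \<le> n \<and> length (snd (snd (dest_task t))) \<le> n) \<and>
     (\<forall>T\<in>set (snd s). csize T \<le> K)"

lemma csize_machine_bounded:
  assumes "machine_bounded n K i s"
  shows "csize s \<le> 1 + (1 + 2 * i) * (4 * n + 4) + i * (K + 1)"
proof -
  have "csize t \<le> 4 * n + 3" if "t \<in> set (fst s)" for t
  proof -
    obtain b Z X where t: "dest_task t = (b, Z, X)" by (cases "dest_task t")
    then have "length Z \<le> n" "length X \<le> n"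
      using assms that unfolding machine_bounded_def by force+
    then show ?thesis
      using csize_bool_le[of b] csize_bool_list_le[of Z] csize_bool_list_le[of X]
      by (simp add: encode_task_def t)
  qed
  then have "csize (fst s) \<le> length (fst s) * (4 * n + 3 + 1)" by (rule csize_list_le)
  also have "\<dots> \<le> (1 + 2 * i) * (4 * n + 4)"
    using assms by (intro mult_le_mono) (auto simp: machine_bounded_def)
  finally have tasks: "csize (fst s) \<le> (1 + 2 * i) * (4 * n + 4)" .
  have "csize (snd s) \<le> length (snd s) * (K + 1)"
    using assms by (intro csize_list_le) (auto simp: machine_bounded_def)
  also have "\<dots> \<le> i * (K + 1)" using assms by (intro mult_le_mono1) (simp add: machine_bounded_def)
  finally show ?thesis using tasks by (simp add: csize_prod)
qed

lemma machine_bounded_step: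
  assumes K: "\<And>Z. length Z \<le> length (fst e) \<Longrightarrow> csize (states r M (fst e) Z) \<le> K"
    and s: "machine_bounded (length (fst e)) K i s"
  shows "machine_bounded (length (fst e)) K (Suc i) (machine_step r M cover e s)"
proof (cases "fst s")
  case Nil
  then show ?thesis using s by (auto simp: machine_bounded_def machine_step_def)
next
  case (Cons t ts)
  have tables: "csize (leaf_table r M cover e Z) \<le> K" "csize (join_table r M e Z X T T') \<le> K"
    if "length Z \<le> length (fst e)" for Z X T T'
    unfolding leaf_table_def join_table_def by (rule order_trans[OF csize_filter_le K[OF that]])+
  show ?thesis
  proof (cases t)
    case (Solve Z)
    then show ?thesis
      using s Cons tables(1)[of Z] length_split_vec_le[of r "fst e" Z]
      by (auto simp: machine_bounded_def machine_step_def Let_def diff_vec_def)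
  next
    case (Combine Z X)
    then show ?thesis
      using s Cons tables(2)[of Z]
      by (auto simp: machine_bounded_def machine_step_def split: list.split)
  qed
qed

lemma machine_bounded_run:
  assumes "\<And>Z. length Z \<le> length (fst e) \<Longrightarrow> csize (states r M (fst e) Z) \<le> K"
  shows "machine_bounded (length (fst e)) K i (run_machine r M cover e i)"
proof (induction i)
  case 0
  show ?case by (simp add: machine_bounded_def run_machine_def)
next
  case (Suc i)
  from machine_bounded_step[OF assms this] show ?case by (simp add: run_machine_def)
qed

lemma pbounded_csize_states:
  obtains K where "pbounded K" "\<And>e Z. length Z \<le> length (fst e) \<Longrightarrow>
    csize (states r M (fst e) Z) \<le> K (e :: inst)"
proof -
  have "ptime (\<lambda>p. states r M (fst p) (snd p))" by (intro ptime_intros)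
  from pbounded_csize_ptime[OF this] obtain k where
    k: "\<And>p. csize (states r M (fst p) (snd p)) \<le> (csize p + 2) ^ k"
    by (meson pboundedE)
  let ?K = "\<lambda>e :: inst. (3 * csize (fst e) + 3) ^ k"
  show ?thesis
  proof (rule that)
    show "pbounded ?K" by (intro pbounded_intros pbounded_csize_ptime ptime_intros)
    fix e :: inst and Z :: vec assume "length Z \<le> length (fst e)"
    then have "csize (fst e, Z) + 2 \<le> 3 * csize (fst e) + 3"
      using csize_bool_list_le[of Z] length_le_csize[of "fst e"] by simp
    then have "(csize (fst e, Z) + 2) ^ k \<le> ?K e" by (rule power_mono) simp
    then show "csize (states r M (fst e) Z) \<le> ?K e" using k[of "(fst e, Z)"] by simp
  qed
qed

lemma ptime_root_table [ptime_intros]: "ptime f \<Longrightarrow> ptime (\<lambda>x. root_table r M cover (f x))"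
proof (rule ptime_comp[of "root_table r M cover"])
  obtain K where K: "pbounded K" "\<And>e Z. length Z \<le> length (fst e) \<Longrightarrow>
      csize (states r M (fst e) Z) \<le> K (e :: inst)"
    by (rule pbounded_csize_states) blast
  let ?bound = "\<lambda>e :: inst. 1 + (1 + 2 * (3 * csize (fst e))) * (4 * csize (fst e) + 4) +
    3 * csize (fst e) * (K e + 1)"
  have "ptime (\<lambda>e. run_machine r M cover e (3 * length (fst e)))"
    unfolding run_machine_def
  proof (rule ptime_funpow[where bound = ?bound])
    show "pbounded ?bound" by (intro pbounded_intros pbounded_csize_ptime ptime_intros K)
    fix e :: inst and i assume "i \<le> 3 * length (fst e)"
    then have i: "i \<le> 3 * csize (fst e)" using length_le_csize[of "fst e"] by simp
    have "csize (run_machine r M cover e i) \<le>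
        1 + (1 + 2 * i) * (4 * length (fst e) + 4) + i * (K e + 1)"
      by (intro csize_machine_bounded machine_bounded_run K)
    also have "\<dots> \<le> ?bound e"
      using i length_le_csize[of "fst e"] by (intro add_mono mult_le_mono) auto
    finally show "csize ((machine_step r M cover e ^^ i)
        ([Solve (map (\<lambda>_. True) [0..<length (fst e)])], [])) \<le> ?bound e"
      unfolding run_machine_def .
  qed (intro ptime_intros)+
  then show "ptime (root_table r M cover)" unfolding root_table_def[abs_def] by (intro ptime_intros)
qed

lemma ptime_weights [ptime_intros]: "ptime f \<Longrightarrow> ptime (\<lambda>x. weights r M cover (f x))"
  by (rule ptime_comp) (unfold weights_def, intro ptime_intros)+

subsection \<open>States of cells\<close>

lemma sum_le_mult:
  fixes f :: "nat \<Rightarrow> nat"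
  assumes "N \<subseteq> {..<n}" "\<And>v. v < n \<Longrightarrow> f v \<le> M"
  shows "sum f N \<le> M * n"
proof -
  have "sum f N \<le> of_nat (card N) * M" by (rule sum_bounded_above) (use assms in auto)
  also have "\<dots> \<le> n * M" using card_mono[OF _ assms(1)] by (intro mult_le_mono1) simp
  finally show ?thesis by (simp add: mult.commute)
qed

context adj_matrix
begin

definition nb :: "nat \<Rightarrow> nat set" where
  "nb v = {w. w < n \<and> nbr A v w}"

definition across :: "nat set \<Rightarrow> nat \<Rightarrow> nat set" where
  "across S v = (if v \<in> S then nb v - S else nb v \<inter> S)"

definition signature :: "nat set \<Rightarrow> nat \<Rightarrow> bool \<times> nat set" where
  "signature S v = (v \<in> S, across S v)"

definition cut_weight :: "(nat \<Rightarrow> nat) \<Rightarrow> nat set \<Rightarrow> nat \<Rightarrow> nat" where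
  "cut_weight f S v = sum f (across S v)"

lemma nb_subset: "nb v \<subseteq> V"
  by (auto simp: nb_def)

lemma finite_nb [simp]: "finite (nb v)"
  using finite_subset[OF nb_subset] by simp

lemma nb_vertex: "v < n \<Longrightarrow> nb v = {w. E v w}"
  using adj_less by (auto simp: nb_def nbr_def)

lemma nb_top [simp]: "nb n = V"
  by (auto simp: nb_def nbr_def)

lemma not_in_nb: "v < n \<Longrightarrow> v \<notin> nb v"
  by (simp add: nb_vertex adj_irrefl)

lemma cut_weight_le:
  assumes "\<And>v. v < n \<Longrightarrow> f v \<le> M"
  shows "cut_weight f S v \<le> M * n"
  unfolding cut_weight_def using nb_subset[of v]
  by (intro sum_le_mult assms) (auto simp: across_def)

lemma twins_iff_signature:
  assumes "support Z \<subseteq> V"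
  shows "twins A Z p v \<longleftrightarrow> signature (support Z) p = signature (support Z) v"
proof -
  have "(\<forall>w<n. (w \<in> support Z \<longleftrightarrow> \<not> b) \<longrightarrow> (nbr A p w \<longleftrightarrow> nbr A v w)) \<longleftrightarrow>
      (if b then nb p - support Z = nb v - support Z else nb p \<inter> support Z = nb v \<inter> support Z)"
    for b
    using assms by (auto simp: nb_def)
  from this[of "p \<in> support Z"] show ?thesis
    unfolding twins_def mem_iff_support[of Z] signature_def across_def by auto
qed

text \<open>The vertices of \<open>S\<close> have rows of the cut matrix of \<open>S\<close> as signatures, the vertices outside \<open>S\<close>
  rows of its transpose.\<close>

lemma card_signatures_le:
  assumes S: "S \<subseteq> V" "cut_rank E V S \<le> r"
  shows "card (signature S ` {..n}) \<le> 2 ^ r + 2 ^ r + 1"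
proof -
  let ?in = "Pair True ` row_space E S (V - S)" and ?out = "Pair False ` row_space E (V - S) S"
  have finS: "finite S" using S(1) finite_subset by blast
  have row: "nb v \<inter> C \<in> row_space E X C" if "v \<in> X" "X \<subseteq> V" for v X C
    using that unfolding row_space_def by (intro image_eqI[of _ _ "{v}"]) (auto simp: nb_vertex)
  have "signature S v \<in> ?in \<union> ?out \<union> {signature S n}" if v: "v \<le> n" for v
  proof -
    consider "v = n" | "v < n" "v \<in> S" | "v < n" "v \<notin> S" using v by linarith
    then show ?thesis
    proof cases
      case 2
      then have "nb v - S = nb v \<inter> (V - S)" using nb_subset by blast
      then show ?thesis using 2 row[of v S "V - S"] S(1) by (simp add: signature_def across_def)
    next
      case 3
      then show ?thesis using row[of v "V - S" S] by (simp add: signature_def across_def)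
    qed simp
  qed
  then have "signature S ` {..n} \<subseteq> ?in \<union> ?out \<union> {signature S n}" by blast
  then have "card (signature S ` {..n}) \<le> card (?in \<union> ?out \<union> {signature S n})"
    using finS by (intro card_mono) (auto simp: finite_row_space)
  also have "\<dots> \<le> card ?in + card ?out + 1"
    using card_Un_le[of "?in \<union> ?out" "{signature S n}"] card_Un_le[of ?in ?out] by simp
  also have "card ?in = 2 ^ cut_rank E V S"
    using finS by (simp add: card_image inj_on_def card_row_space cut_rank_def)
  also have "card ?out = 2 ^ cut_rank E V (V - S)"
    using S(1) by (simp add: card_image inj_on_def card_row_space cut_rank_def double_diff)
  also have "cut_rank E V (V - S) = cut_rank E V S"
    using S(1) adj_sym by (intro cut_rank_compl) (auto simp: symp_def)
  finally have "card (signature S ` {..n}) \<le> 2 ^ cut_rank E V S + 2 ^ cut_rank E V S + 1" .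
  moreover have "(2::nat) ^ cut_rank E V S \<le> 2 ^ r" using S(2) by (intro power_increasing) auto
  ultimately show ?thesis by linarith
qed

lemma class_vectors_SucI:
  assumes "s \<in> set (class_vectors M A Z i)" "p \<le> n" "y \<le> M * n"
  shows "\<exists>t\<in>set (class_vectors M A Z (Suc i)). \<forall>v\<le>n.
    val t v = (if twins A Z p v then y else val s v)"
proof (intro bexI allI impI)
  let ?t = "map (\<lambda>v. if twins A Z p v then y else val s v) [0..<Suc n]"
  show "?t \<in> set (class_vectors M A Z (Suc i))"
    using assms by (simp del: upt_Suc) (intro bexI[of _ s] bexI[of _ p] imageI; simp)
  show "val ?t v = (if twins A Z p v then y else val s v)" if "v \<le> n" for v
    using that by (simp add: lookup_map_upt del: upt_Suc)
qed

lemma class_vectors_complete: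
  assumes Z: "support Z \<subseteq> V" and f: "\<And>v. v < n \<Longrightarrow> f v \<le> M"
    and Q: "Q \<subseteq> signature (support Z) ` {..n}" "card Q \<le> i"
  shows "\<exists>s\<in>set (class_vectors M A Z i). \<forall>v\<le>n. val s v =
    (if signature (support Z) v \<in> Q then cut_weight f (support Z) v else 0)"
  using Q
proof (induction i arbitrary: Q)
  case 0
  have "finite Q" using finite_subset[OF 0(1)] by simp
  then have "Q = {}" using 0 by simp
  then show ?case by (simp add: lookup_nth)
next
  case (Suc i)
  let ?sig = "signature (support Z)" and ?w = "cut_weight f (support Z)"
  obtain p Q' y where p: "p \<le> n" "y \<le> M * n" and Q': "Q' \<subseteq> ?sig ` {..n}" "card Q' \<le> i"
    and Q: "\<And>v. v \<le> n \<Longrightarrow> (if ?sig p = ?sig v then y else if ?sig v \<in> Q' then ?w v else 0) =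
        (if ?sig v \<in> Q then ?w v else 0)"
  proof (cases "Q = {}")
    case True
    then show ?thesis using that[of n 0 "{}"] by simp
  next
    case False
    then obtain p where p: "?sig p \<in> Q" "p \<le> n" using Suc.prems(1) by blast
    show ?thesis
    proof (rule that[of p "?w p" "Q - {?sig p}"])
      show "card (Q - {?sig p}) \<le> i"
        using p(1) finite_subset[OF Suc.prems(1)] Suc.prems(2) by simp
      show "?w p \<le> M * n" by (rule cut_weight_le[OF f])
    qed (use p Suc.prems(1) in \<open>auto simp: signature_def cut_weight_def\<close>)
  qed
  obtain s where s: "s \<in> set (class_vectors M A Z i)"
    "\<forall>v\<le>n. val s v = (if ?sig v \<in> Q' then ?w v else 0)"
    using Suc.IH[OF Q'] by blast
  obtain t where t: "t \<in> set (class_vectors M A Z (Suc i))"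
    "\<forall>v\<le>n. val t v = (if ?sig p = ?sig v then y else val s v)"
    using class_vectors_SucI[OF s(1) p] unfolding twins_iff_signature[OF Z] by blast
  have "val t v = (if ?sig v \<in> Q then ?w v else 0)" if "v \<le> n" for v
    unfolding Q[OF that, symmetric] using s(2) t(2) that by simp
  then show ?case using t(1) by blast
qed

lemma states_complete:
  assumes Z: "support Z \<subseteq> V" "cut_rank E V (support Z) \<le> r" and f: "\<And>v. v < n \<Longrightarrow> f v \<le> M"
  shows "\<exists>s\<in>set (states r M A Z). \<forall>v\<le>n. val s v = cut_weight f (support Z) v"
  using class_vectors_complete[OF Z(1) f order_refl card_signatures_le[OF Z]]
  unfolding states_def by auto

lemma cut_weight_three_cells:
  assumes "X \<inter> Y = {}"
  shows "v \<in> X \<Longrightarrow> cut_weight f X v = cut_weight f Y v + cut_weight f (X \<union> Y) v"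
    and "v \<in> Y \<Longrightarrow> cut_weight f Y v = cut_weight f X v + cut_weight f (X \<union> Y) v"
    and "v \<notin> X \<union> Y \<Longrightarrow> cut_weight f (X \<union> Y) v = cut_weight f X v + cut_weight f Y v"
proof -
  have split: "sum f K = sum f N + sum f N'" if "K = N \<union> N'" "N \<inter> N' = {}" "K \<subseteq> nb v" for K N N'
    using that finite_subset[OF that(3)] by (auto simp: sum.union_disjoint)
  have "sum f (nb v - X) = sum f (nb v \<inter> Y) + sum f (nb v - (X \<union> Y))"
    "sum f (nb v - Y) = sum f (nb v \<inter> X) + sum f (nb v - (X \<union> Y))"
    "sum f (nb v \<inter> (X \<union> Y)) = sum f (nb v \<inter> X) + sum f (nb v \<inter> Y)"
    using assms by (intro split; blast)+
  then show "v \<in> X \<Longrightarrow> cut_weight f X v = cut_weight f Y v + cut_weight f (X \<union> Y) v"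
    "v \<in> Y \<Longrightarrow> cut_weight f Y v = cut_weight f X v + cut_weight f (X \<union> Y) v"
    "v \<notin> X \<union> Y \<Longrightarrow> cut_weight f (X \<union> Y) v = cut_weight f X v + cut_weight f Y v"
    using assms by (auto simp: cut_weight_def across_def)
qed

end

subsection \<open>Tables\<close>

locale dynamic_program = adj_matrix +
  fixes ks us :: "nat list" and r M :: nat and cover :: bool
  assumes split_exists: "\<And>Z. Z \<subseteq> V \<Longrightarrow> 2 \<le> card Z \<Longrightarrow> cut_rank E V Z \<le> r \<Longrightarrow>
      \<exists>X. low_rank_split E V r Z X"
    and us_le: "\<And>v. v < n \<Longrightarrow> val us v \<le> M"
begin

abbreviation e :: inst where "e \<equiv> (A, ks, us)"

definition feasible :: "(nat \<Rightarrow> nat) \<Rightarrow> bool" where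
  "feasible f \<longleftrightarrow> (\<forall>v<n. admissible cover e v (f v) (f v + sum f (nb v)))"

text \<open>On \<open>S\<close>, the state prescribes the weight contributed by the neighbours outside \<open>S\<close>.\<close>

definition realizes :: "nat set \<Rightarrow> (nat \<Rightarrow> nat) \<Rightarrow> nat list \<Rightarrow> bool" where
  "realizes S f s \<longleftrightarrow>
     (\<forall>v\<in>S. admissible cover e v (f v) (f v + sum f (nb v \<inter> S) + val s v)) \<and>
     (\<forall>v\<le>n. v \<notin> S \<longrightarrow> val s v = sum f (nb v \<inter> S))"

definition sound_table :: "nat set \<Rightarrow> nat list list \<Rightarrow> bool" where
  "sound_table S T \<longleftrightarrow> (\<forall>s\<in>set T. \<exists>f. realizes S f s)"

definition complete_table :: "nat set \<Rightarrow> nat list list \<Rightarrow> bool" where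
  "complete_table S T \<longleftrightarrow> (\<forall>f. feasible f \<longrightarrow> (\<exists>s\<in>set T. \<forall>v\<le>n. val s v = cut_weight f S v))"

lemma feasible_le: "feasible f \<Longrightarrow> v < n \<Longrightarrow> f v \<le> M"
  using us_le[of v] by (auto simp: feasible_def admissible_def)

lemma feasible_state:
  assumes "feasible f" "support Z \<subseteq> V" "cut_rank E V (support Z) \<le> r"
  obtains s where "s \<in> set (states r M A Z)" "\<forall>v\<le>n. val s v = cut_weight f (support Z) v"
  using states_complete[OF assms(2,3), of f M] feasible_le[OF assms(1)] by blast

lemma sum_nb_singleton:
  fixes f :: "nat \<Rightarrow> nat"
  assumes "v < n"
  shows "sum f (nb w \<inter> {v}) = (if nbr A w v then f v else 0)"
  using assms by (simp add: nb_def)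

lemma sound_leaf_table:
  assumes Z: "support Z = {v}" and v: "v < n"
  shows "sound_table {v} (leaf_table r M cover e Z)"
  unfolding sound_table_def
proof
  fix s assume "s \<in> set (leaf_table r M cover e Z)"
  then obtain x where "admissible cover e v x (x + val s v)"
    "\<forall>w<Suc n. w \<noteq> v \<longrightarrow> val s w = (if nbr A w v then x else 0)"
    unfolding leaf_table_def mem_iff_support Z by auto
  moreover have "nb v \<inter> {v} = {}" using not_in_nb[OF v] by simp
  ultimately have "realizes {v} (\<lambda>_. x) s"
    unfolding realizes_def by (simp add: sum_nb_singleton[OF v] less_Suc_eq_le del: sum_constant)
  then show "\<exists>f. realizes {v} f s" by blast
qed

lemma complete_leaf_table:
  assumes Z: "support Z = {v}" "cut_rank E V {v} \<le> r" and v: "v < n"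
  shows "complete_table {v} (leaf_table r M cover e Z)"
  unfolding complete_table_def
proof (intro allI impI)
  fix f assume f: "feasible f"
  obtain s where s: "s \<in> set (states r M A Z)" "\<forall>w\<le>n. val s w = cut_weight f {v} w"
    using feasible_state[OF f, of Z] Z v by auto
  have "nb v - {v} = nb v" using not_in_nb[OF v] by simp
  then have val_v: "val s v = sum f (nb v)" using s(2) v by (simp add: cut_weight_def across_def)
  have "val s w = (if nbr A w v then f v else 0)" if "w \<le> n" "w \<noteq> v" for w
    using s(2) that sum_nb_singleton[OF v, of f w] by (simp add: cut_weight_def across_def)
  moreover have "f v < Suc M" using feasible_le[OF f v] by simp
  moreover have "admissible cover e v (f v) (f v + val s v)"
    using f v val_v by (simp add: feasible_def)
  ultimately have "s \<in> set (leaf_table r M cover e Z)"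
    using s(1) v Z(1)
    by (auto simp: leaf_table_def mem_iff_support less_Suc_eq_le
        intro!: exI[of _ v] exI[of _ "f v"])
  then show "\<exists>s\<in>set (leaf_table r M cover e Z). \<forall>w\<le>n. val s w = cut_weight f {v} w"
    using s(2) by blast
qed

lemma realizes_Un:
  assumes f: "realizes X f t" and g: "realizes Y g t'" and disj: "X \<inter> Y = {}" "X \<union> Y \<subseteq> V"
    and val_X: "\<And>v. v \<in> X \<Longrightarrow> val t v = val t' v + val s v"
    and val_Y: "\<And>v. v \<in> Y \<Longrightarrow> val t' v = val t v + val s v"
    and val_out: "\<And>v. v \<le> n \<Longrightarrow> v \<notin> X \<union> Y \<Longrightarrow> val s v = val t v + val t' v"
  shows "realizes (X \<union> Y) (\<lambda>v. if v \<in> X then f v else g v) s"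
proof -
  define h where "h = (\<lambda>v. if v \<in> X then f v else g v)"
  have "sum h (nb v \<inter> X) = sum f (nb v \<inter> X)" "sum h (nb v \<inter> Y) = sum g (nb v \<inter> Y)" for v
    using disj(1) by (auto simp: h_def intro!: sum.cong)
  moreover have "sum h (nb v \<inter> (X \<union> Y)) = sum h (nb v \<inter> X) + sum h (nb v \<inter> Y)" for v
    using disj(1) by (subst sum.union_disjoint[symmetric]) (auto intro!: arg_cong[of _ _ "sum h"])
  ultimately have sum_h: "sum h (nb v \<inter> (X \<union> Y)) = sum f (nb v \<inter> X) + sum g (nb v \<inter> Y)" for v
    by simp
  have "admissible cover e v (h v) (h v + sum h (nb v \<inter> (X \<union> Y)) + val s v)" if v: "v \<in> X \<union> Y" for v
  proof (cases "v \<in> X")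
    case True
    have h_v: "h v = f v" using True by (simp add: h_def)
    have "v \<notin> Y" "v \<le> n" using True disj by auto
    then have "val t' v = sum g (nb v \<inter> Y)" using g by (simp add: realizes_def)
    then have "h v + sum h (nb v \<inter> (X \<union> Y)) + val s v = f v + sum f (nb v \<inter> X) + val t v"
      using True val_X by (simp add: sum_h h_v)
    moreover have "admissible cover e v (f v) (f v + sum f (nb v \<inter> X) + val t v)"
      using f True by (simp add: realizes_def)
    ultimately show ?thesis by (simp only: h_v)
  next
    case False
    have h_v: "h v = g v" using False by (simp add: h_def)
    have "v \<in> Y" "v \<le> n" using False v disj(2) by auto
    then have "val t v = sum f (nb v \<inter> X)" using f False by (simp add: realizes_def)
    then have "h v + sum h (nb v \<inter> (X \<union> Y)) + val s v = g v + sum g (nb v \<inter> Y) + val t' v"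
      using \<open>v \<in> Y\<close> val_Y by (simp add: sum_h h_v)
    moreover have "admissible cover e v (g v) (g v + sum g (nb v \<inter> Y) + val t' v)"
      using g \<open>v \<in> Y\<close> by (simp add: realizes_def)
    ultimately show ?thesis by (simp only: h_v)
  qed
  moreover have "val s v = sum h (nb v \<inter> (X \<union> Y))" if "v \<le> n" "v \<notin> X \<union> Y" for v
    using f g that val_out by (simp add: realizes_def sum_h)
  ultimately show ?thesis unfolding realizes_def h_def by blast
qed

lemma sound_join_table:
  assumes Z: "support Z \<subseteq> V" and X: "support X \<subseteq> support Z"
    and T: "sound_table (support X) T" and T': "sound_table (support Z - support X) T'"
  shows "sound_table (support Z) (join_table r M e Z X T T')"
  unfolding sound_table_def
proof
  let ?Y = "support Z - support X"
  fix s assume "s \<in> set (join_table r M e Z X T T')"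
  then obtain t t' where t: "t \<in> set T" "t' \<in> set T'" and joins: "joins n Z X t t' s"
    unfolding join_table_def by auto
  obtain f g where f: "realizes (support X) f t" and g: "realizes ?Y g t'"
    using T T' t unfolding sound_table_def by blast
  have "realizes (support X \<union> ?Y) (\<lambda>v. if v \<in> support X then f v else g v) s"
  proof (rule realizes_Un[OF f g])
    have entries: "if v \<in> support X then val t v = val t' v + val s v
        else if v \<in> support Z then val t' v = val t v + val s v
        else val s v = val t v + val t' v" if "v \<le> n" for v
      using joins that unfolding joins_def mem_iff_support by (simp add: less_Suc_eq_le)
    have bounded: "v \<le> n" if "v \<in> support Z" for v using that Z by auto
    show "val t v = val t' v + val s v" if "v \<in> support X" for v
      using entries[of v] bounded that X by auto
    show "val t' v = val t v + val s v" if "v \<in> ?Y" for v using entries[of v] bounded that by auto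
    show "val s v = val t v + val t' v" if "v \<le> n" "v \<notin> support X \<union> ?Y" for v
      using entries[of v] that by auto
  qed (use Z X in auto)
  moreover have "support X \<union> ?Y = support Z" using X by auto
  ultimately show "\<exists>f. realizes (support Z) f s" by auto
qed

lemma complete_join_table:
  assumes Z: "support Z \<subseteq> V" "cut_rank E V (support Z) \<le> r" and X: "support X \<subseteq> support Z"
    and T: "complete_table (support X) T" and T': "complete_table (support Z - support X) T'"
  shows "complete_table (support Z) (join_table r M e Z X T T')"
  unfolding complete_table_def
proof (intro allI impI)
  let ?Y = "support Z - support X"
  fix f assume f: "feasible f"
  obtain s where s: "s \<in> set (states r M A Z)" "\<forall>v\<le>n. val s v = cut_weight f (support Z) v"
    using f Z by (rule feasible_state)
  obtain t where t: "t \<in> set T" "\<forall>v\<le>n. val t v = cut_weight f (support X) v"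
    using T f unfolding complete_table_def by blast
  obtain t' where t': "t' \<in> set T'" "\<forall>v\<le>n. val t' v = cut_weight f ?Y v"
    using T' f unfolding complete_table_def by blast
  have "support X \<inter> ?Y = {}" "support X \<union> ?Y = support Z" using X by auto
  note cells = cut_weight_three_cells[OF this(1), unfolded this(2)]
  have "joins n Z X t t' s"
    unfolding joins_def mem_iff_support using s(2) t(2) t'(2) cells[of _ f]
    by (simp add: less_Suc_eq_le)
  then have "s \<in> set (join_table r M e Z X T T')"
    unfolding join_table_def using s(1) t(1) t'(1) by auto
  then show "\<exists>s\<in>set (join_table r M e Z X T T'). \<forall>v\<le>n. val s v = cut_weight f (support Z) v"
    using s(2) by blast
qed

subsection \<open>The machine\<close>

definition computes_table :: "vec \<Rightarrow> nat \<Rightarrow> bool" where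
  "computes_table Z k \<longleftrightarrow> (\<exists>T. sound_table (support Z) T \<and> complete_table (support Z) T \<and>
     (\<forall>ts Ts. (machine_step r M cover e ^^ k) (Solve Z # ts, Ts) = (ts, T # Ts)))"

lemma computes_table_leaf:
  assumes Z: "support Z = {v}" "v < n" "cut_rank E V {v} \<le> r"
  shows "computes_table Z 1"
proof -
  have "is_single n Z" unfolding is_single_def mem_iff_support Z(1) by simp
  then have "machine_step r M cover e (Solve Z # ts, Ts) = (ts, leaf_table r M cover e Z # Ts)"
    for ts Ts
    by (simp add: machine_step_def)
  then show ?thesis
    unfolding computes_table_def
    using sound_leaf_table[OF Z(1,2)] complete_leaf_table[OF Z(1,3,2)] Z(1) by auto
qed

lemma computes_table_join:
  assumes Z: "support Z \<subseteq> V" "2 \<le> card (support Z)" "cut_rank E V (support Z) \<le> r"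
    and X: "support (split_vec r A Z) \<subseteq> support Z"
    and T: "computes_table (split_vec r A Z) k"
    and T': "computes_table (diff_vec n Z (split_vec r A Z)) k'"
  shows "computes_table Z (k + k' + 2)"
proof -
  let ?X = "split_vec r A Z" and ?step = "machine_step r M cover e"
  have support_Y: "support (diff_vec n Z ?X) = support Z - support ?X"
    by (rule support_diff_vec[OF Z(1)])
  obtain T where T: "sound_table (support ?X) T" "complete_table (support ?X) T"
    "\<And>ts Ts. (?step ^^ k) (Solve ?X # ts, Ts) = (ts, T # Ts)"
    using T unfolding computes_table_def by blast
  obtain T' where T': "sound_table (support Z - support ?X) T'" "complete_table (support Z - support ?X) T'"
    "\<And>ts Ts. (?step ^^ k') (Solve (diff_vec n Z ?X) # ts, Ts) = (ts, T' # Ts)"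
    using T' unfolding computes_table_def support_Y by blast
  have "\<not> is_single n Z"
  proof
    assume single: "is_single n Z"
    have "card (support Z) \<le> Suc 0"
      using finite_subset[OF Z(1)] single Z(1)
      by (auto simp: card_le_Suc0_iff_eq is_single_def mem_iff_support)
    then show False using Z(2) by simp
  qed
  then have split: "?step (Solve Z # ts, Ts) =
      (Solve ?X # Solve (diff_vec n Z ?X) # Combine Z ?X # ts, Ts)" for ts Ts
    by (simp add: machine_step_def Let_def)
  have join: "?step (Combine Z ?X # ts, T' # T # Ts) = (ts, join_table r M e Z ?X T T' # Ts)"
    for ts Ts
    by (simp add: machine_step_def)
  have "(?step ^^ (k + k' + 2)) s = ?step ((?step ^^ k') ((?step ^^ k) (?step s)))" for s
    by (simp add: add.commute[of k k'] funpow_add funpow_swap1)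
  then have "(?step ^^ (k + k' + 2)) (Solve Z # ts, Ts) = (ts, join_table r M e Z ?X T T' # Ts)"
    for ts Ts
    using T(3) T'(3) split join by simp
  then show ?thesis
    unfolding computes_table_def
    using sound_join_table[OF Z(1) X T(1) T'(1)] complete_join_table[OF Z(1,3) X T(2) T'(2)]
    by blast
qed

lemma computes_table_in_time:
  assumes "support Z \<noteq> {}" "support Z \<subseteq> V" "cut_rank E V (support Z) \<le> r"
  shows "\<exists>k. k + 2 \<le> 3 * card (support Z) \<and> computes_table Z k"
  using assms
proof (induction "card (support Z)" arbitrary: Z rule: less_induct)
  case less
  have fin: "finite (support Z)" using finite_subset[OF less.prems(2)] by simp
  then have "card (support Z) \<noteq> 0" using less.prems(1) by simp
  then consider "card (support Z) = 1" | "2 \<le> card (support Z)" by linarith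
  then show ?case
  proof cases
    case 1
    then obtain v where v: "support Z = {v}" by (rule card_1_singletonE)
    then have "computes_table Z 1" using less.prems by (intro computes_table_leaf) auto
    then show ?thesis using 1 by (intro exI[of _ 1]) simp
  next
    case 2
    define X where "X = split_vec r A Z"
    define Y where "Y = diff_vec n Z X"
    have support_Y: "support Y = support Z - support X"
      unfolding Y_def by (rule support_diff_vec[OF less.prems(2)])
    have "low_rank_split E V r (support Z) (support X)"
      unfolding X_def using split_exists[OF less.prems(2) 2 less.prems(3)]
      by (intro low_rank_split_split_vec less.prems)
    note X = low_rank_splitD(1-3)[OF this] and Y = low_rank_splitD(4-6)[OF this, folded support_Y]
    obtain k where k: "k + 2 \<le> 3 * card (support X)" "computes_table X k"
      using less.hyps[OF psubset_card_mono[OF fin X(2)] X(1) _ X(3)] X(2) less.prems(2) by auto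
    obtain k' where k': "k' + 2 \<le> 3 * card (support Y)" "computes_table Y k'"
      using less.hyps[OF psubset_card_mono[OF fin Y(2)] Y(1) _ Y(3)] Y(2) less.prems(2) by auto
    have "computes_table Z (k + k' + 2)"
      using X(2) k(2) k'(2) unfolding Y_def X_def
      by (intro computes_table_join less.prems 2) auto
    moreover have "card (support X) + card (support Y) = card (support Z)"
      unfolding support_Y using X(2) finite_subset[OF _ fin] card_mono[OF fin, of "support X"]
      by (simp add: card_Diff_subset)
    ultimately show ?thesis using k(1) k'(1) by (intro exI[of _ "k + k' + 2"]) simp
  qed
qed

lemma root_table_correct:
  assumes "0 < n"
  shows "sound_table V (root_table r M cover e)" "complete_table V (root_table r M cover e)"
proof -
  let ?step = "machine_step r M cover e" and ?Z = "map (\<lambda>_. True) [0..<n]"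
  have Z: "support ?Z = V" by (auto simp: support_def)
  have "rank E V {} \<le> rank E {} {}"
    using rank_transpose[of V "{}" E] rank_le_card_rows[of "{}" "\<lambda>w x. E x w" V] by simp
  then have "cut_rank E V V \<le> r" using rank_le_card_rows[of "{}" E "{}"] by (simp add: cut_rank_def)
  then obtain k T where k: "k + 2 \<le> 3 * n" and T: "sound_table V T" "complete_table V T"
    and run: "\<And>ts Ts. (?step ^^ k) (Solve ?Z # ts, Ts) = (ts, T # Ts)"
    using computes_table_in_time[of ?Z] assms unfolding computes_table_def Z by auto
  have idle: "(?step ^^ i) ([], Ts) = ([], Ts)" for i Ts
    by (induction i) (simp_all add: machine_step_def)
  have "3 * n = (3 * n - k) + k" using k by simp
  then have "run_machine r M cover e (3 * n) =
      (?step ^^ (3 * n - k)) ((?step ^^ k) ([Solve ?Z], []))"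
    unfolding run_machine_def by (metis comp_apply fst_conv funpow_add)
  then have "root_table r M cover e = T" by (simp add: root_table_def run idle)
  then show "sound_table V (root_table r M cover e)" "complete_table V (root_table r M cover e)"
    using T by simp_all
qed

theorem set_weights:
  assumes "0 < n"
  shows "set (weights r M cover e) = {sum f V | f. feasible f}"
proof (intro set_eqI iffI)
  have nb_V: "nb v \<inter> V = nb v" for v using nb_subset by blast
  fix x assume "x \<in> set (weights r M cover e)"
  then obtain s where s: "s \<in> set (root_table r M cover e)" "\<forall>v<n. val s v = 0" "val s n = x"
    unfolding weights_def by (auto simp del: upt_Suc)
  then obtain f where "realizes V f s"
    using root_table_correct(1)[OF assms] by (auto simp: sound_table_def)
  then have "feasible f" "x = sum f V" using s(2,3) by (auto simp: realizes_def feasible_def nb_V)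
  then show "x \<in> {sum f V | f. feasible f}" by blast
next
  fix x assume "x \<in> {sum f V | f. feasible f}"
  then obtain f where f: "feasible f" "x = sum f V" by blast
  obtain s where s: "s \<in> set (root_table r M cover e)" "\<forall>v\<le>n. val s v = cut_weight f V v"
    using root_table_correct(2)[OF assms] f unfolding complete_table_def by blast
  have "across V v = {}" if "v < n" for v using that nb_subset[of v] by (auto simp: across_def)
  then have "\<forall>v<n. val s v = 0" using s(2) by (simp add: cut_weight_def)
  moreover have "val s n = x" using s(2) f(2) by (simp add: cut_weight_def across_def)
  moreover have "x \<le> M * n" using sum_le_mult[OF order_refl feasible_le[OF f(1)]] f(2) by simp
  ultimately show "x \<in> set (weights r M cover e)"
    unfolding weights_def using s(1) by (auto simp del: upt_Suc)
qed

end

section \<open>Input and output\<close>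

fun bits :: "nat \<Rightarrow> bool list" where
  "bits n = (if n = 0 then [] else odd n # bits (n div 2))"

declare bits.simps [simp del]

lemma bits_0 [simp]: "bits 0 = []"
  by (simp add: bits.simps)

lemma encode_bits: "encode (bits n) = enc_nat n"
proof (induction n rule: bits.induct)
  case (1 n)
  then show ?case by (subst bits.simps, subst enc_nat.simps) (simp add: encode_bool_def)
qed

lemma length_bits_le: "length (bits n) \<le> n"
proof (induction n rule: bits.induct)
  case (1 n)
  show ?case
  proof (cases "n = 0")
    case False
    then have "length (bits (n div 2)) \<le> n div 2" "n div 2 < n" using 1 by auto
    then show ?thesis using False bits.simps[of n] by simp
  qed simp
qed

definition bits_step :: "nat \<times> bool list \<Rightarrow> nat \<times> bool list" where
  "bits_step p = (if fst p = 0 then p else (fst p div 2, snd p @ [odd (fst p)]))"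

lemma bits_step_invariant:
  "(bits_step ^^ i) (n, []) = (m, bs) \<Longrightarrow> m \<le> n - i \<and> bs @ bits m = bits n"
proof (induction i arbitrary: m bs)
  case (Suc i)
  obtain m' bs' where prev: "(bits_step ^^ i) (n, []) = (m', bs')" by fastforce
  have IH: "m' \<le> n - i" "bs' @ bits m' = bits n" using Suc.IH[OF prev] by auto
  have step: "bits_step (m', bs') = (m, bs)" using Suc.prems prev by simp
  show ?case
  proof (cases "m' = 0")
    case True
    then show ?thesis using step IH by (simp add: bits_step_def)
  next
    case False
    then have m: "m = m' div 2" "bs = bs' @ [odd m']" using step by (auto simp: bits_step_def)
    have "m' div 2 \<le> n - Suc i" using IH(1) False by linarith
    moreover have "bits m' = odd m' # bits (m' div 2)" using False by (simp add: bits.simps[of m'])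
    ultimately show ?thesis using IH(2) m by simp
  qed
qed simp

lemma ptime_bits [ptime_intros]: "ptime f \<Longrightarrow> ptime (\<lambda>x. bits (f x))"
proof (rule ptime_comp[of bits])
  have "ptime (\<lambda>n. (bits_step ^^ n) (n, []))"
  proof (rule ptime_funpow[of "\<lambda>_. bits_step", where bound = "\<lambda>n. 1 + csize n + 2 * csize n"])
    show "ptime (\<lambda>p :: nat \<times> nat \<times> bool list. bits_step (snd p))"
      unfolding bits_step_def by (intro ptime_intros)
    fix n i :: nat
    obtain m bs where state: "(bits_step ^^ i) (n, []) = (m, bs)" by fastforce
    have "m \<le> n" "length bs \<le> length (bits n)"
      using bits_step_invariant[OF state] by (auto dest: arg_cong[of _ _ length])
    then show "csize ((bits_step ^^ i) (n, [])) \<le> 1 + csize n + 2 * csize n"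
      unfolding state using csize_bool_list_le[of bs] length_bits_le[of n] by simp
  qed (intro ptime_intros pbounded_intros)+
  then have "ptime (\<lambda>n. snd ((bits_step ^^ n) (n, [])))" by (intro ptime_intros)
  moreover have "snd ((bits_step ^^ n) (n, [])) = bits n" for n
  proof -
    obtain m bs where state: "(bits_step ^^ n) (n, []) = (m, bs)" by fastforce
    then show ?thesis using bits_step_invariant[OF state] by auto
  qed
  ultimately show "ptime bits" by simp
qed

text \<open>A number in binary can be exponentially larger than its code, so the conversion to unary stops
  at \<open>cap\<close>.\<close>

definition unary_step :: "nat \<Rightarrow> bool \<Rightarrow> nat \<Rightarrow> nat" where
  "unary_step cap b a = (let a' = a + a + (if b then 1 else 0) in if cap \<le> a' then cap else a')"

definition unary :: "nat \<Rightarrow> bool list \<Rightarrow> nat" where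
  "unary cap bs = fold (unary_step cap) (rev bs) 0"

lemma ptime_unary [ptime_intros]: "ptime f \<Longrightarrow> ptime g \<Longrightarrow> ptime (\<lambda>x. unary (f x) (g x))"
proof (rule ptime_comp2[of unary])
  have "a \<le> cap \<Longrightarrow> fold (unary_step cap) bs a \<le> cap" for cap bs a
    by (induction bs arbitrary: a) (auto simp: unary_step_def Let_def)
  then show "ptime (\<lambda>p. unary (fst p) (snd p))"
    unfolding unary_def
    by (intro ptime_fold[where bound = "\<lambda>p. csize (fst p)"] ptime_intros pbounded_csize_ptime)
      (unfold unary_step_def, intro ptime_intros, simp)
qed

lemma unary_bits: "unary cap (bits n) = min cap n"
proof (induction n rule: bits.induct)
  case (1 n)
  show ?case
  proof (cases "n = 0")
    case False
    then have "unary cap (bits n) = unary_step cap (odd n) (unary cap (bits (n div 2)))"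
      by (subst bits.simps) (simp add: unary_def)
    moreover have "n = n div 2 + n div 2 + (if odd n then 1 else 0)" by presburger
    ultimately show ?thesis using 1 False by (auto simp: unary_step_def Let_def min_def)
  qed (simp add: unary_def)
qed

definition adj_mat :: "graph \<Rightarrow> matrix" where
  "adj_mat G = map (\<lambda>v. map (\<lambda>w. (v, w) \<in> parcs G) [0..<card (pverts G)]) [0..<card (pverts G)]"

type_synonym input = "matrix \<times> bool list list \<times> bool list list"

fun input_of :: "bounded_inst \<Rightarrow> input" where
  "input_of (G, k, u) = (adj_mat G, map (\<lambda>v. bits (k v)) [0..<card (pverts G)],
     map (\<lambda>v. bits (u v)) [0..<card (pverts G)])"

definition preprocess :: "nat \<Rightarrow> input \<Rightarrow> inst" where
  "preprocess M d = (fst d, map (unary (Suc (M + M * length (fst d)))) (fst (snd d)),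
     map (unary (Suc M)) (snd (snd d)))"

text \<open>The empty graph is treated separately because \<^const>\<open>root_table\<close> returns no states for it.\<close>

definition algorithm :: "nat \<Rightarrow> nat \<Rightarrow> bool \<Rightarrow> input \<Rightarrow> bool list" where
  "algorithm r M cover d =
    (if fst d = [] then [False]
     else let ws = weights r M cover (preprocess M d)
       in case if cover then ws else rev ws of [] \<Rightarrow> [] | w # _ \<Rightarrow> False # bits w)"

lemma ptime_preprocess [ptime_intros]: "ptime f \<Longrightarrow> ptime (\<lambda>x. preprocess M (f x))"
  by (rule ptime_comp) (unfold preprocess_def, intro ptime_intros)+

lemma ptime_algorithm: "ptime (algorithm r M cover)"
  unfolding algorithm_def[abs_def] by (intro ptime_intros)

lemma encode_map: "encode (map f xs) = enc_list (map (\<lambda>x. encode (f x)) xs)"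
  by (simp add: encode_list_def o_def)

lemma encode_adj_mat: "encode (adj_mat G) = enc_graph G"
  by (simp add: adj_mat_def enc_graph_def enc_vector_def encode_map encode_bool_def)

lemma encode_input_of: "encode (input_of x) = enc_bounded_inst x"
  by (cases x) (simp add: encode_adj_mat encode_map encode_bits enc_vector_def)

section \<open>Correctness of the algorithm\<close>

lemma length_adj_mat [simp]: "length (adj_mat G) = card (pverts G)"
  by (simp add: adj_mat_def)

lemma mem_row_adj_mat:
  assumes "input_graph G"
  shows "mem (row (adj_mat G) v) w \<longleftrightarrow> (v, w) \<in> parcs G"
proof -
  have "v < card (pverts G) \<and> w < card (pverts G)" if "(v, w) \<in> parcs G"
    using input_graph_arcs[OF assms that] input_graph_verts[OF assms] by auto
  then show ?thesis by (auto simp: adj_mat_def lookup_map_upt)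
qed

lemma adj_matrix_adj_mat:
  assumes "input_graph G"
  shows "adj_matrix (adj_mat G)"
proof
  fix v w
  show "v < length (adj_mat G) \<and> w < length (adj_mat G)" if "mem (row (adj_mat G) v) w"
    using that input_graph_arcs[OF assms, of v w] input_graph_verts[OF assms]
    by (auto simp: mem_row_adj_mat[OF assms])
  show "mem (row (adj_mat G) v) w \<longleftrightarrow> mem (row (adj_mat G) w) v" "\<not> mem (row (adj_mat G) v) v"
    using input_graph_sym[OF assms, of v w] input_graph_arcs[OF assms, of v v]
    by (auto simp: mem_row_adj_mat[OF assms])
qed

lemma dynamic_program_adj_mat:
  assumes G: "input_graph G" and cw: "clique_width G \<le> c" and u: "\<And>v. v \<in> pverts G \<Longrightarrow> u v \<le> M"
  shows "dynamic_program (adj_mat G) (map u [0..<card (pverts G)]) (6 * Suc c) M"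
proof -
  interpret adj_matrix "adj_mat G" by (rule adj_matrix_adj_mat[OF G])
  have verts: "{..<length (adj_mat G)} = pverts G" using input_graph_verts[OF G] by simp
  show ?thesis
  proof
    show "\<exists>X. low_rank_split E V (6 * Suc c) Z X"
      if "Z \<subseteq> V" "2 \<le> card Z" "cut_rank E V Z \<le> 6 * Suc c" for Z
      using clique_width_low_rank_split[OF G le_SucI[OF cw]] that
      unfolding mem_row_adj_mat[OF G] verts by simp
    show "val (map u [0..<card (pverts G)]) v \<le> M" if "v < length (adj_mat G)" for v
      using that u verts by (auto simp: lookup_map_upt)
  qed
qed

fun solution :: "bool \<Rightarrow> bounded_inst \<Rightarrow> (nat \<Rightarrow> nat) \<Rightarrow> bool" where
  "solution cover (G, k, u) f \<longleftrightarrow> (\<forall>v\<in>pverts G. f v \<le> u v \<and>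
     (if cover then k v \<le> (\<Sum>w\<in>closed_nbhd G v. f w) else (\<Sum>w\<in>closed_nbhd G v. f w) \<le> k v))"

lemma (in dynamic_program) feasible_iff_uncapped:
  assumes cap: "M + M * n < cap" and ks: "\<And>v. v < n \<Longrightarrow> val ks v = min cap (k v)"
  shows "feasible f \<longleftrightarrow> (\<forall>v<n. f v \<le> val us v \<and>
    (if cover then k v \<le> f v + sum f (nb v) else f v + sum f (nb v) \<le> k v))"
proof (cases "\<forall>v<n. f v \<le> val us v")
  case True
  then have bounded: "f v \<le> M" if "v < n" for v using us_le[OF that] that by (meson le_trans)
  have "f v + sum f (nb v) < cap" if "v < n" for v
    using bounded[OF that] sum_le_mult[OF nb_subset bounded] cap by (meson add_mono le_less_trans)
  then have "min cap (k v) \<le> f v + sum f (nb v) \<longleftrightarrow> k v \<le> f v + sum f (nb v)"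
    "f v + sum f (nb v) \<le> min cap (k v) \<longleftrightarrow> f v + sum f (nb v) \<le> k v" if "v < n" for v
    using that by (auto simp: min_le_iff_disj dest: leD intro: less_imp_le)
  then show ?thesis unfolding feasible_def admissible_def by (simp add: ks)
qed (auto simp: feasible_def admissible_def)

lemma set_weights_preprocess:
  assumes G: "input_graph G" "pverts G \<noteq> {}" and cw: "clique_width G \<le> c"
    and u: "\<And>v. v \<in> pverts G \<Longrightarrow> u v \<le> M"
  shows "set (weights (6 * Suc c) M cover (preprocess M (input_of (G, k, u)))) =
    {\<Sum>v\<in>pverts G. f v | f. solution cover (G, k, u) f}"
proof -
  let ?N = "card (pverts G)"
  let ?ks = "map (\<lambda>v. min (Suc (M + M * ?N)) (k v)) [0..<?N]" and ?us = "map u [0..<?N]"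
  have verts: "pverts G = {..<?N}" by (rule input_graph_verts[OF G(1)])
  have "map (\<lambda>v. min (Suc M) (u v)) [0..<?N] = ?us"
  proof (rule map_cong[OF refl])
    fix v assume "v \<in> set [0..<?N]"
    then have "u v \<le> M" using verts by (intro u) auto
    then show "min (Suc M) (u v) = u v" by simp
  qed
  then have preprocessed: "preprocess M (input_of (G, k, u)) = (adj_mat G, ?ks, ?us)"
    by (simp add: preprocess_def unary_bits o_def)
  interpret dynamic_program "adj_mat G" ?ks ?us "6 * Suc c" M cover by (rule dynamic_program_adj_mat[OF G(1) cw u])
  have nbhd: "(\<Sum>w\<in>closed_nbhd G v. f w) = f v + sum f (nb v)" if "v < n" for f :: "nat \<Rightarrow> nat" and v
  proof -
    have "closed_nbhd G v = insert v (nb v)"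
      using that by (simp add: closed_nbhd_def nb_vertex mem_row_adj_mat[OF G(1)])
    then show ?thesis using not_in_nb[OF that] by simp
  qed
  have V: "pverts G = V" using verts by simp
  have "feasible f \<longleftrightarrow> solution cover (G, k, u) f" for f
  proof -
    have "feasible f \<longleftrightarrow> (\<forall>v<n. f v \<le> val ?us v \<and>
        (if cover then k v \<le> f v + sum f (nb v) else f v + sum f (nb v) \<le> k v))"
      by (rule feasible_iff_uncapped) (simp_all add: lookup_map_upt)
    then show ?thesis unfolding solution.simps V
      by (cases cover) (auto simp: nbhd lookup_map_upt)
  qed
  moreover have "0 < n" using G(2) input_graph_finite[OF G(1)] by (simp add: card_gt_0_iff)
  ultimately show ?thesis unfolding preprocessed V using set_weights by simp
qed

lemma Min_sorted: "sorted (x # xs) \<Longrightarrow> Min (set (x # xs)) = x"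
  for x :: "'a::linorder" by (auto intro!: Min_eqI)

lemma Max_sorted: "sorted (rev (x # xs)) \<Longrightarrow> Max (set (x # xs)) = x"
  for x :: "'a::linorder" by (auto intro!: Max_eqI simp: sorted_append)

lemma algorithm_correct:
  assumes G: "input_graph G" and cw: "clique_width G \<le> c" and u: "\<And>v. v \<in> pverts G \<Longrightarrow> u v \<le> M"
  shows "encode (algorithm (6 * Suc c) M cover (input_of (G, k, u))) =
    enc_option (if cover then GDF (G, k, u) else GPF (G, k, u))"
proof (cases "pverts G = {}")
  case True
  then have "algorithm (6 * Suc c) M cover (input_of (G, k, u)) = [False]"
    by (simp add: algorithm_def adj_mat_def)
  moreover have "GDF (G, k, u) = Some 0" "GPF (G, k, u) = Some 0"
    using True by (simp_all add: min_value_def max_value_def)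
  ultimately show ?thesis by (simp add: enc_nat.simps[of 0])
next
  case False
  define ws where "ws = weights (6 * Suc c) M cover (preprocess M (input_of (G, k, u)))"
  have set_ws: "set ws = {\<Sum>v\<in>pverts G. f v | f. solution cover (G, k, u) f}"
    unfolding ws_def by (rule set_weights_preprocess[OF G False cw u])
  have sorted: "sorted ws" unfolding ws_def weights_def by (intro sorted_wrt_filter sorted_upt)
  have "adj_mat G \<noteq> []" using False input_graph_finite[OF G] by (simp add: adj_mat_def)
  then have algorithm_eq: "algorithm (6 * Suc c) M cover (input_of (G, k, u)) =
      (case if cover then ws else rev ws of [] \<Rightarrow> [] | w # _ \<Rightarrow> False # bits w)"
    by (simp add: algorithm_def ws_def Let_def)
  show ?thesis
  proof (cases cover)
    case True
    then have "GDF (G, k, u) = min_value (set ws)" unfolding set_ws by simp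
    then show ?thesis
      unfolding algorithm_eq using True Min_sorted[of "hd ws" "tl ws"] sorted
      by (cases ws) (simp_all add: min_value_def encode_bits del: GDF.simps)
  next
    case False
    then have "GPF (G, k, u) = max_value (set (rev ws))" unfolding set_rev set_ws by simp
    then show ?thesis
      unfolding algorithm_eq using False Max_sorted[of "hd (rev ws)" "tl (rev ws)"] sorted
      by (cases "rev ws") (simp_all add: max_value_def encode_bits del: GPF.simps)
  qed
qed

section \<open>Solvability in polynomial time\<close>

lemma poly_time_solvableI:
  assumes "ptime F" and h: "\<And>x. x \<in> I \<Longrightarrow> encode (h x) = enc x"
    and F: "\<And>x. x \<in> I \<Longrightarrow> encode (F (h x)) = enc_option (P x)"
  shows "poly_time_solvable enc I P"
proof -
  obtain p B T where T: "pbounded T" and p: "subroutine p B T F"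
    using assms(1) unfolding ptime_def by blast
  obtain k where k: "\<And>x. T x \<le> (csize x + 2) ^ k" using T by (meson pboundedE)
  have "\<exists>m\<le>poly ([:2, 1:] ^ k) (size (enc x)). computes_in_time p (enc x) m (enc_option (P x))"
    if x: "x \<in> I" for x
  proof -
    have "((\<lambda>_. Leaf)(0 := enc x)) 0 = encode (h x)" using h[OF x] by simp
    then have "wp p (T (h x)) (\<lambda>s. s 0 = enc_option (P x)) ((\<lambda>_. Leaf)(0 := enc x))"
      by (rule wp_subroutine[OF p]) (simp add: F[OF x])
    moreover have "T (h x) \<le> poly ([:2, 1:] ^ k) (size (enc x))"
      using k[of "h x"] h[OF x] by (simp add: add.commute)
    ultimately show ?thesis unfolding wp_def computes_in_time_def by (meson order_trans)
  qed
  then show ?thesis unfolding poly_time_solvable_def by blast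
qed

lemma poly_time_solvable_mono: "poly_time_solvable enc I P \<Longrightarrow> J \<subseteq> I \<Longrightarrow> poly_time_solvable enc J P"
  unfolding poly_time_solvable_def by blast

theorem bounded_poly_time:
  "poly_time_solvable enc_bounded_inst
     {(G, k, u). input_graph G \<and> (\<forall>v\<in>pverts G. u v \<le> M) \<and> clique_width G \<le> c}
     (if cover then GDF else GPF)"
proof (rule poly_time_solvableI[OF ptime_algorithm encode_input_of])
  fix x :: bounded_inst
  assume x: "x \<in> {(G, k, u). input_graph G \<and> (\<forall>v\<in>pverts G. u v \<le> M) \<and> clique_width G \<le> c}"
  obtain G k u where [simp]: "x = (G, k, u)" by (cases x)
  show "encode (algorithm (6 * Suc c) M cover (input_of x)) =
      enc_option ((if cover then GDF else GPF) x)"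
    using algorithm_correct[of G c u M cover k] x by (auto split: if_splits)
qed

fun unmark :: "nat \<Rightarrow> marked_inst \<Rightarrow> bounded_inst" where
  "unmark l (G, k, t) = (G, k, \<lambda>v. if t v = Zero then 0 else l)"

lemma LDF_eq_GDF: "LDF l x = GDF (unmark l x)" and LPF_eq_GPF: "LPF l x = GPF (unmark l x)"
proof -
  obtain G k t where x: "x = (G, k, t)" by (cases x)
  have "f v \<in> {0..l} \<and> P \<and> (t v = Zero \<longrightarrow> f v = 0) \<longleftrightarrow>
      f v \<le> (if t v = Zero then 0 else l) \<and> P" for f v P
    by auto
  then show "LDF l x = GDF (unmark l x)" "LPF l x = GPF (unmark l x)" by (simp_all add: x)
qed

theorem marked_poly_time:
  "poly_time_solvable enc_marked_inst {(G, k, t). input_graph G \<and> clique_width G \<le> c}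
     (if cover then LDF l else LPF l)"
proof -
  let ?F = "\<lambda>d :: matrix \<times> bool list list \<times> bool list. algorithm (6 * Suc c) l cover
     (fst d, fst (snd d), map (\<lambda>b. if b then bits l else []) (snd (snd d)))"
  let ?h = "\<lambda>(G, k, t). (adj_mat G, map (\<lambda>v. bits (k v)) [0..<card (pverts G)],
     map (\<lambda>v. t v = Free) [0..<card (pverts G)])"
  have "ptime ?F" by (rule ptime_comp[OF ptime_algorithm]) (intro ptime_intros)
  then show ?thesis
  proof (rule poly_time_solvableI[of _ _ ?h])
    fix x :: marked_inst
    assume x: "x \<in> {(G, k, t). input_graph G \<and> clique_width G \<le> c}"
    obtain G k t where inst: "x = (G, k, t)" by (cases x)
    have mark: "enc_bool (m = Free) = enc_mark m" for m by (cases m) auto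
    show "encode (?h x) = enc_marked_inst x"
      by (simp add: inst encode_adj_mat encode_map encode_bits enc_vector_def encode_bool_def mark)
    have "(if t v = Free then bits l else []) = bits (if t v = Zero then 0 else l)" for v
      by (cases "t v") simp_all
    then have "?F (?h x) = algorithm (6 * Suc c) l cover (input_of (unmark l x))"
      by (simp add: inst o_def)
    then show "encode (?F (?h x)) = enc_option ((if cover then LDF l else LPF l) x)"
      using algorithm_correct[of G c "\<lambda>v. if t v = Zero then 0 else l" l cover k] x
      by (simp add: LDF_eq_GDF LPF_eq_GPF inst del: GDF.simps GPF.simps LDF.simps LPF.simps)
  qed
qed

theorem theorem6:
  shows "(\<forall>M c :: nat.
            poly_time_solvable enc_bounded_inst
              {(G, k, u). input_graph G \<and> (\<forall>v\<in>pverts G. u v \<le> M) \<and> clique_width G \<le> c} GDF \<and>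
            poly_time_solvable enc_bounded_inst
              {(G, k, u). input_graph G \<and> (\<forall>v\<in>pverts G. u v \<le> M) \<and> clique_width G \<le> c} GPF) \<and>
         (\<forall>l c :: nat.
            poly_time_solvable enc_marked_inst
              {(G, k, t). input_graph G \<and> (\<forall>v\<in>pverts G. t v = Free) \<and> clique_width G \<le> c} (LDF l) \<and>
            poly_time_solvable enc_marked_inst
              {(G, k, t). input_graph G \<and> (\<forall>v\<in>pverts G. t v = Free) \<and> clique_width G \<le> c} (LPF l) \<and>
            poly_time_solvable enc_marked_inst
              {(G, k, t). input_graph G \<and> clique_width G \<le> c} (LDF l))"
proof (intro conjI allI)
  fix M c l :: nat
  let ?bounded = "{(G, k, u). input_graph G \<and> (\<forall>v\<in>pverts G. u v \<le> M) \<and> clique_width G \<le> c}"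
  let ?marked = "{(G, k, t). input_graph G \<and> clique_width G \<le> c}"
  let ?free = "{(G, k, t). input_graph G \<and> (\<forall>v\<in>pverts G. t v = Free) \<and> clique_width G \<le> c}"
  show "poly_time_solvable enc_bounded_inst ?bounded GDF"
    using bounded_poly_time[of M c True] by simp
  show "poly_time_solvable enc_bounded_inst ?bounded GPF"
    using bounded_poly_time[of M c False] by simp
  show LDF: "poly_time_solvable enc_marked_inst ?marked (LDF l)"
    using marked_poly_time[of c True l] by simp
  show "poly_time_solvable enc_marked_inst ?free (LDF l)"
    by (rule poly_time_solvable_mono[OF LDF]) auto
  show "poly_time_solvable enc_marked_inst ?free (LPF l)"
    using marked_poly_time[of c False l] by (auto elim: poly_time_solvable_mono)
qed

end
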